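(* Every planar graph with at least one vertex containing no subgraph isomorphic to $K_4$, $C_5$, $C_6$ or $C_7$ contains at least one of the configurations (D1)–(D12): (D1) a vertex of degree at most $2$. (D2) a triangle $T(3,3,3)$ or $T(3,3,4)$. (D3) two diamonds $D_1=\mathrm{Dia}(6-3,4,3)$ and $D_2=\mathrm{Dia}(6-3,4,4)$ sharing their middle $6$-vertex and no other vertex. (D4) $\mathrm{Dia}(3-3,4^+,4^+)$. (D5) $\mathrm{Dia}(4-5,3,3)$. (D6) $\mathrm{Dia}(4-3,4,4)$. (D7) $\mathrm{Dia}(5-3,4,4)$ together with a $3$-vertex outside it adjacent to its middle $5$-vertex. (D8) $\mathrm{Dia}(5-5,3,3)$ together with a $3$-vertex outside it adjacent to one of its middle $5$-vertices. (D9) three $3$-vertices $u,v,w$ with $uv,vw\in E(G)$ and $uw\notin E(G)$. (D10) $\mathrm{Dia}(5-3,4,3)$. (D11) a triangle $T(5,3,3)$ together with a $3$-vertex outside it adjacent to its $5$-vertex. (D12) two triangles $T(6,3,3)$ sharing their $6$-vertex and no other vertex.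
   Context: All degrees are degrees in $G$; a $d$-vertex ($d^+$-vertex) is a vertex of degree exactly $d$ (at least $d$). $T(a,b,c)$ denotes a triangle whose vertices have degrees $a,b,c$. A diamond is a subgraph isomorphic to $K_4$ minus an edge; its two vertices of degree $3$ in it are middle vertices, the other two are side vertices. $\mathrm{Dia}(a-b,c,d)$ denotes a diamond whose middle vertices have degrees $a,b$ and whose side vertices have degrees $c,d$; an entry $s^+$ means degree at least $s$. "$G$ contains a configuration" means $G$ has vertices with the described adjacencies, non-adjacencies and degrees. *)

theory Defs
  imports "HOL-Analysis.Analysis"
begin

definition simple_graph :: "'a set \<Rightarrow> ('a \<Rightarrow> 'a \<Rightarrow> bool) \<Rightarrow> bool" where
  "simple_graph V adj \<longleftrightarrow> finite V \<and> (\<forall>u v. adj u v \<longrightarrow> u \<in> V \<and> v \<in> V \<and> u \<noteq> v \<and> adj v u)"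

definition deg :: "'a set \<Rightarrow> ('a \<Rightarrow> 'a \<Rightarrow> bool) \<Rightarrow> 'a \<Rightarrow> nat" where
  "deg V adj v = card {u \<in> V. adj v u}"

definition planar :: "'a set \<Rightarrow> ('a \<Rightarrow> 'a \<Rightarrow> bool) \<Rightarrow> bool" where
  "planar V adj \<longleftrightarrow> (\<exists>(f :: 'a \<Rightarrow> complex) (\<gamma> :: 'a \<Rightarrow> 'a \<Rightarrow> real \<Rightarrow> complex).
     inj_on f V \<and>
     (\<forall>u v. adj u v \<longrightarrow>
        arc (\<gamma> u v) \<and> pathstart (\<gamma> u v) = f u \<and> pathfinish (\<gamma> u v) = f v \<and>
        path_image (\<gamma> u v) = path_image (\<gamma> v u) \<and>
        path_image (\<gamma> u v) \<inter> f ` V = {f u, f v}) \<and>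
     (\<forall>u v x y. adj u v \<longrightarrow> adj x y \<longrightarrow> {u, v} \<noteq> {x, y} \<longrightarrow>
        path_image (\<gamma> u v) \<inter> path_image (\<gamma> x y) \<subseteq> f ` ({u, v} \<inter> {x, y})))"

definition has_K4 :: "'a set \<Rightarrow> ('a \<Rightarrow> 'a \<Rightarrow> bool) \<Rightarrow> bool" where
  "has_K4 V adj \<longleftrightarrow> (\<exists>a b c d. a \<in> V \<and> b \<in> V \<and> c \<in> V \<and> d \<in> V \<and>
     adj a b \<and> adj a c \<and> adj a d \<and> adj b c \<and> adj b d \<and> adj c d)"

text \<open>Subgraph isomorphic to the cycle C_k (k \<ge> 3).\<close>
definition has_cycle :: "'a set \<Rightarrow> ('a \<Rightarrow> 'a \<Rightarrow> bool) \<Rightarrow> nat \<Rightarrow> bool" where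
  "has_cycle V adj k \<longleftrightarrow> (\<exists>c :: nat \<Rightarrow> 'a. inj_on c {..<k} \<and>
     (\<forall>i<k. c i \<in> V \<and> adj (c i) (c (Suc i mod k))))"

definition tri :: "'a set \<Rightarrow> ('a \<Rightarrow> 'a \<Rightarrow> bool) \<Rightarrow> 'a \<Rightarrow> 'a \<Rightarrow> 'a \<Rightarrow> bool" where
  "tri V adj x y z \<longleftrightarrow> x \<in> V \<and> y \<in> V \<and> z \<in> V \<and> adj x y \<and> adj y z \<and> adj x z"

text \<open>Diamond (subgraph K4 minus an edge) with middle vertices x, y and side vertices a, b.\<close>
definition dia :: "'a set \<Rightarrow> ('a \<Rightarrow> 'a \<Rightarrow> bool) \<Rightarrow> 'a \<Rightarrow> 'a \<Rightarrow> 'a \<Rightarrow> 'a \<Rightarrow> bool" where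
  "dia V adj x y a b \<longleftrightarrow> x \<in> V \<and> y \<in> V \<and> a \<in> V \<and> b \<in> V \<and> a \<noteq> b \<and>
     adj x y \<and> adj x a \<and> adj y a \<and> adj x b \<and> adj y b"

end

(* Proof idea. In a plane drawing call a cycle a face if no path joins two of its vertices through its inside.
   A cycle with such an ear is the symmetric difference of two cycles with smaller insides, so the faces generate
   the cycle space over GF(2), and counting elements gives |E| + 1 <= |F| + |V|. Winding numbers of two faces with a
   common edge show that the two insides fill up a neighbourhood of that edge, so no edge lies in three faces, and
   two faces share two consecutive edges a-b-c only if b is cut off from the rest.

   To exclude the latter, restrict to a minimal vertex set B attached to the rest of G in at most one vertex v, and
   invert the plane so that v lies on the outer face.

   Faces have length 3, 4 or at least 8. Give each vertex of degree d the weight 6d - 16 and each face of length k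
   the weight 2k - 16; the total is at most -16. Every vertex pays 2 to each face of length at most 4 through it,
   and the vertices of a triangle pay it 4 more. Excluding the configurations (with their degrees taken in G)
   makes this affordable at every vertex except v, which is overdrawn by at most 15. *)
theory Submission
  imports Defs "HOL-Complex_Analysis.Winding_Numbers"
begin

text \<open>Length 8 is the first face length after the excluded ones, so 2k - 16 is chosen to
  vanish there. The weight 6d - 16 then matches it: degrees sum to 2|E| and face lengths to at most
  2|E|, so the total is at most 16(|E| - |V| - |F|). One inequality of Euler's formula is enough for
  this, and it comes from counting sums of faces; the components of the complement of the drawing
  never occur.

  Shared corners are the obstacle. Two short faces on a common edge produce a forbidden cycle only
  if their next vertices differ, but when something is cut off at b, two faces can run along the
  same two edges at b while the rest hangs inside one of them. In an end block a third edge at b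
  would continue to an ear. The vertex v may have too few edges in the block for this argument,
  hence its place on the outer face. Its degree in the block can also differ from that in G, so no
  configuration is applied at v; a total of -16 leaves room for one such vertex.\<close>

section \<open>Closed curves sharing an arc\<close>

text \<open>The inverse parametrization orders any three points of the image. A disc stays connected
  when the middle one is removed, so its image on the line cannot miss the middle value while
  containing the other two. This later provides a centre of inversion off the drawing.\<close>

lemma interior_arc_image:
  fixes g :: "real \<Rightarrow> complex"
  assumes "arc g"
  shows "interior (path_image g) = {}"
proof (rule ccontr)
  assume "interior (path_image g) \<noteq> {}"
  then obtain x e where e: "e > 0" "ball x e \<subseteq> path_image g"
    by (meson equals0I mem_interior)
  obtain h where h: "homeomorphism {0..1} (path_image g) g h"
    using homeomorphism_arc[OF assms] by blast
  have "infinite (ball x e)"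
    using uncountable_ball[OF e(1), of x] countable_finite by blast
  then obtain W where W: "W \<subseteq> ball x e" "finite W" "card W = 3"
    using infinite_arbitrarily_large by blast
  have injh: "inj_on h (path_image g)"
    by (rule inj_on_inverseI[of _ g]) (use h in \<open>simp add: homeomorphism_apply2\<close>)
  have "card (h ` W) = 3"
    using W e injh by (metis card_image inj_on_subset order_trans)
  then obtain p q r where pqr: "h ` W = {p, q, r}" "p \<noteq> q" "p \<noteq> r" "q \<noteq> r"
    by (auto simp: card_3_iff)
  have "\<exists>s\<in>{p, q, r}. \<exists>t\<in>{p, q, r}. \<exists>u\<in>{p, q, r}. s < t \<and> t < u"
    using pqr(2-4) by auto
  then obtain a b c where abc: "a \<in> W" "b \<in> W" "c \<in> W" "h a < h b" "h b < h c"
    unfolding pqr(1)[symmetric] by blast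
  have "connected (ball x e - {b})"
    by (rule connected_open_delete) auto
  moreover have "continuous_on (ball x e - {b}) h"
    using h e by (meson Diff_subset continuous_on_subset homeomorphism_cont2 order_trans)
  ultimately have "connected (h ` (ball x e - {b}))"
    by (rule connected_continuous_image[rotated])
  moreover have "h a \<in> h ` (ball x e - {b})" "h c \<in> h ` (ball x e - {b})"
    using abc W by auto
  ultimately have "h b \<in> h ` (ball x e - {b})"
    using abc(4,5) by (meson connectedD_interval less_imp_le)
  then show False
    using injh abc W e by (auto simp: inj_on_def)
qed

lemma arc_pair_loop:
  fixes g h :: "real \<Rightarrow> complex"
  assumes "arc g" "arc h" "pathstart g = a" "pathfinish g = b" "pathstart h = a" "pathfinish h = b"
    "path_image g \<inter> path_image h = {a, b}"
  shows "simple_path (g +++ reversepath h)"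
    "pathfinish (g +++ reversepath h) = pathstart (g +++ reversepath h)"
    "path_image (g +++ reversepath h) = path_image g \<union> path_image h"
  using assms by (auto simp: simple_path_join_loop_eq arc_reversepath path_image_join)

lemma winding_number_pair:
  fixes g h :: "real \<Rightarrow> complex"
  assumes "path g" "path h" "pathfinish g = pathfinish h"
    "z \<notin> path_image g" "z \<notin> path_image h"
  shows "winding_number (g +++ reversepath h) z = winding_number g z - winding_number h z"
  using assms by (simp add: winding_number_join winding_number_reversepath)

text \<open>The winding number of the loop from \<open>P\<close> to \<open>Q\<close> is constant on \<open>U\<close>, and it is the difference of the
  winding numbers of the two closed curves through \<open>A\<close>. Near \<open>A\<close> it is nonzero, so at every point of \<open>U\<close>
  off \<open>A\<close> one of the two curves winds.\<close>

lemma two_sides_of_common_arc: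
  fixes A P Q :: "real \<Rightarrow> complex"
  assumes arcs: "arc A" "arc P" "arc Q"
    and ends: "pathstart A = a" "pathfinish A = b" "pathstart P = a" "pathfinish P = b"
      "pathstart Q = a" "pathfinish Q = b"
    and AP: "path_image A \<inter> path_image P = {a, b}" and AQ: "path_image A \<inter> path_image Q = {a, b}"
    and disj: "inside (path_image A \<union> path_image P) \<inter> inside (path_image A \<union> path_image Q) = {}"
    and U: "open U" "connected U" "U \<inter> path_image P = {}" "U \<inter> path_image Q = {}"
      "U \<inter> path_image A \<noteq> {}"
  shows "U \<subseteq> path_image A \<union> inside (path_image A \<union> path_image P) \<union> inside (path_image A \<union> path_image Q)"
proof
  fix z assume z: "z \<in> U"
  define C where "C = A +++ reversepath P"
  define D where "D = A +++ reversepath Q"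
  define W where "W = P +++ reversepath Q"
  note CC = arc_pair_loop[OF arcs(1,2) ends(1-4) AP, folded C_def]
  note DD = arc_pair_loop[OF arcs(1,3) ends(1,2,5,6) AQ, folded D_def]
  note JC = Jordan_inside_outside[OF CC(1,2), unfolded CC(3)]
  note JD = Jordan_inside_outside[OF DD(1,2), unfolded DD(3)]
  have paths: "path A" "path P" "path Q"
    using arcs arc_imp_path by auto
  \<comment> \<open>\<open>P\<close> and \<open>Q\<close> may touch or overlap between their ends,
    so \<open>W\<close> need not be simple; its winding numbers are still defined where the Jordan
    curve theorem says nothing about it.\<close>
  have W: "path W" "pathfinish W = pathstart W" "path_image W = path_image P \<union> path_image Q"
    using paths ends by (auto simp: W_def path_image_join)
  have WU: "winding_number W y = winding_number W z" if "y \<in> U" for y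
    by (rule winding_number_eq[OF W(1,2) that z U(2)]) (use U W(3) in auto)
  have diff: "winding_number W y = winding_number D y - winding_number C y"
    if "y \<in> U" "y \<notin> path_image A" for y
    using that U ends paths by (auto simp: C_def D_def W_def winding_number_pair disjoint_iff)
  have out: "winding_number C y = 0" if "y \<notin> path_image A" "y \<in> U"
     "y \<notin> inside (path_image A \<union> path_image P)" for y
    using that U CC winding_number_zero_in_outside[of C y] JC
    by (metis Compl_iff DiffD2 UnE disjoint_iff simple_path_imp_path)
  have outD: "winding_number D y = 0" if "y \<notin> path_image A" "y \<in> U"
     "y \<notin> inside (path_image A \<union> path_image Q)" for y
    using that U DD winding_number_zero_in_outside[of D y] JD
    by (metis Compl_iff DiffD2 UnE disjoint_iff simple_path_imp_path)
  obtain p where p: "p \<in> U" "p \<in> path_image A" using U by auto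
  \<comment> \<open>The arc \<open>A\<close> lies on the frontier of the first inside, so
    \<open>U\<close> reaches into that inside. At such a point \<open>y\<close> the first curve
    winds, while the second, whose inside is disjoint from the first, does not.\<close>
  then have "p \<in> closure (inside (path_image A \<union> path_image P))"
    using JC by (metis Un_iff frontier_def Diff_iff)
  then obtain y where y: "y \<in> U" "y \<in> inside (path_image A \<union> path_image P)"
    using U(1) p(1) by (meson closure_iff_nhds_not_empty disjoint_iff order_refl)
  then have yA: "y \<notin> path_image A" using inside_no_overlap by blast
  have "winding_number C y \<noteq> 0"
    using simple_closed_path_norm_winding_number_inside[OF CC(1)] y CC(3) by fastforce
  moreover have "winding_number D y = 0"
    using outD yA y disj by blast
  ultimately have "winding_number W z \<noteq> 0"
    using diff[OF y(1) yA] WU[OF y(1)] by simp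
  then show "z \<in> path_image A \<union> inside (path_image A \<union> path_image P) \<union> inside (path_image A \<union> path_image Q)"
    using diff[OF z] out outD z by fastforce
qed

text \<open>The chord \<open>c\<close> splits the inside into two smaller insides and the open
  chord; the points of the chord make the inclusion strict. This strictness drives the induction
  that splits cycles into faces.\<close>

lemma inside_theta_subset:
  fixes c1 c2 c :: "real \<Rightarrow> complex"
  assumes arcs: "arc c1" "arc c2" "arc c"
    and ends: "pathstart c1 = a" "pathfinish c1 = b" "pathstart c2 = a" "pathfinish c2 = b"
      "pathstart c = a" "pathfinish c = b"
    and meet: "path_image c1 \<inter> path_image c2 = {a, b}"
    and c: "path_image c - {a, b} \<subseteq> inside (path_image c1 \<union> path_image c2)"
  shows "inside (path_image c1 \<union> path_image c) \<subset> inside (path_image c1 \<union> path_image c2)"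
proof -
  have ab: "a \<noteq> b" using arcs(1) ends by (metis arc_distinct_ends)
  have off: "inside (path_image c1 \<union> path_image c2) \<inter> (path_image c1 \<union> path_image c2) = {}"
    using inside_no_overlap by blast
  have ends': "{a, b} \<subseteq> path_image c1" "{a, b} \<subseteq> path_image c2" "{a, b} \<subseteq> path_image c"
    using pathstart_in_path_image[of c1] pathfinish_in_path_image[of c1]
      pathstart_in_path_image[of c2] pathfinish_in_path_image[of c2]
      pathstart_in_path_image[of c] pathfinish_in_path_image[of c] by (simp_all add: ends)
  have m1: "path_image c1 \<inter> path_image c = {a, b}"
    using c off ends' by blast
  have m2: "path_image c2 \<inter> path_image c = {a, b}"
    using c off ends' by blast
  have ne: "path_image c - {a, b} \<noteq> {}"
    using nonempty_simple_path_endless[OF arc_imp_simple_path[OF arcs(3)]] ends by simp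
  then have ne': "path_image c \<inter> inside (path_image c1 \<union> path_image c2) \<noteq> {}"
    using c by blast
  have "inside (path_image c1 \<union> path_image c) \<union> inside (path_image c2 \<union> path_image c) \<union>
           (path_image c - {a,b}) = inside(path_image c1 \<union> path_image c2)"
    by (rule split_inside_simple_closed_curve[of c1 a b c2 c])
       (simp_all add: arcs[THEN arc_imp_simple_path] ends ab meet m1 m2 ne')
  moreover have "inside (path_image c1 \<union> path_image c) \<inter> path_image c = {}"
    using inside_no_overlap by blast
  ultimately show "inside (path_image c1 \<union> path_image c) \<subset> inside (path_image c1 \<union> path_image c2)"
    using ne by blast
qed

section \<open>Paths and cycles as edge sets\<close>

fun ed :: "'a list \<Rightarrow> 'a set set" where
  "ed (x # y # zs) = insert {x, y} (ed (y # zs))"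
| "ed _ = {}"

definition gpath :: "('a \<Rightarrow> 'a \<Rightarrow> bool) \<Rightarrow> 'a list \<Rightarrow> bool" where
  "gpath adj p \<longleftrightarrow> distinct p \<and> successively adj p"

text \<open>A cycle is its set of edges and not a vertex list: rotations and reversals become equal,
  and sums over GF(2) are plain symmetric differences.\<close>

definition is_cycle :: "('a \<Rightarrow> 'a \<Rightarrow> bool) \<Rightarrow> 'a set set \<Rightarrow> bool" where
  "is_cycle adj C \<longleftrightarrow> (\<exists>p. gpath adj p \<and> 3 \<le> length p \<and> adj (last p) (hd p) \<and>
     C = insert {last p, hd p} (ed p))"

definition edges :: "('a \<Rightarrow> 'a \<Rightarrow> bool) \<Rightarrow> 'a set set" where
  "edges adj = {{u, v} | u v. adj u v}"

lemma ed_Cons: "p \<noteq> [] \<Longrightarrow> ed (x # p) = insert {x, hd p} (ed p)"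
  by (cases p) auto

lemma ed_append: "p \<noteq> [] \<Longrightarrow> q \<noteq> [] \<Longrightarrow> ed (p @ q) = ed p \<union> insert {last p, hd q} (ed q)"
  by (induction p rule: induct_list012) (auto simp: ed_Cons)

lemma ed_append_shared: "ed (p @ y # q) = ed (p @ [y]) \<union> ed (y # q)"
  by (induction p rule: induct_list012) (auto simp: ed_Cons)

lemma ed_rev [simp]: "ed (rev p) = ed p"
proof (induction p)
  case (Cons x p)
  then show ?case
    by (cases "p = []") (auto simp: ed_Cons ed_append last_rev insert_commute)
qed simp

lemma ed_subset_set: "e \<in> ed p \<Longrightarrow> e \<subseteq> set p"
  by (induction p rule: ed.induct) auto

lemma Union_ed: "2 \<le> length p \<Longrightarrow> \<Union> (ed p) = set p"
proof (induction p rule: ed.induct)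
  case (1 x y zs)
  then show ?case by (cases zs) auto
qed auto

lemma finite_ed [simp]: "finite (ed p)"
  by (induction p rule: ed.induct) auto

lemma card_ed: "distinct p \<Longrightarrow> card (ed p) = length p - 1"
proof (induction p rule: ed.induct)
  case (1 x y zs)
  have "{x, y} \<notin> ed (y # zs)"
    using 1(2) ed_subset_set[of "{x, y}" "y # zs"] by auto
  then show ?case using 1 by simp
qed auto

text \<open>Each end of a path lies on only one of its edges. This keeps the closing edge of a cycle
  apart from the others, and it prevents two paths that meet only in their common ends from sharing
  an edge unless both are that edge.\<close>

lemma ed_endpoints:
  assumes "distinct p" "p \<noteq> []" "{hd p, last p} \<in> ed p"
  shows "p = [hd p, last p]"
proof (cases p rule: ed.cases)
  case (1 x y zs)
  show ?thesis
  proof (cases zs)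
    case Nil then show ?thesis using 1 by simp
  next
    case (Cons z w)
    have "{hd p, last p} \<noteq> {x, y}"
      using assms(1) 1 Cons last_in_set[of zs] by (auto simp: doubleton_eq_iff)
    moreover have "{hd p, last p} \<notin> ed (y # zs)"
      using assms(1) 1 ed_subset_set[of "{hd p, last p}" "y # zs"] by auto
    ultimately show ?thesis using assms(3) 1 by simp
  qed
qed (use assms in auto)

lemma ed_obtain:
  assumes "e \<in> ed p"
  obtains xs x y ys where "p = xs @ x # y # ys" "e = {x, y}"
  using assms
proof (induction p arbitrary: thesis rule: ed.induct)
  case (1 x y zs)
  then consider "e = {x, y}" | "e \<in> ed (y # zs)" by auto
  then show ?case
  proof cases
    case 1 then show ?thesis using "1.prems"(1)[of "[]" x y zs] by simp
  next
    case 2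
    then obtain xs u v ys where "y # zs = xs @ u # v # ys" "e = {u, v}"
      using "1.IH" by blast
    then show ?thesis using "1.prems"(1)[of "x # xs" u v ys] by simp
  qed
qed auto

lemma ed_distinct:
  assumes "distinct p" "e \<in> ed p"
  obtains x y where "e = {x, y}" "x \<noteq> y"
  using ed_obtain[OF assms(2)] assms(1) by (metis distinct.simps(2) distinct_append list.set_intros(1))

lemma gpath_append:
  "gpath adj (p @ q) \<longleftrightarrow> gpath adj p \<and> gpath adj q \<and> set p \<inter> set q = {} \<and>
     (p = [] \<or> q = [] \<or> adj (last p) (hd q))"
  by (auto simp: gpath_def successively_append_iff)

lemma gpath_Cons:
  "gpath adj (x # p) \<longleftrightarrow> gpath adj p \<and> x \<notin> set p \<and> (p = [] \<or> adj x (hd p))"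
  by (auto simp: gpath_def successively_Cons)

lemma gpath_simps [simp]: "gpath adj []" "gpath adj [x]"
  by (auto simp: gpath_def)

lemma gpath_rev:
  assumes "symp adj" "gpath adj p"
  shows "gpath adj (rev p)"
  using assms sympD[OF assms(1)] by (auto simp: gpath_def intro: successively_mono)

lemma hd_neq_last: "distinct p \<Longrightarrow> 2 \<le> length p \<Longrightarrow> hd p \<noteq> last p"
  by (cases p rule: ed.cases) auto

lemma ed_subset_edges: "gpath adj p \<Longrightarrow> ed p \<subseteq> edges adj"
  by (induction p rule: ed.induct) (auto simp: gpath_Cons edges_def)

lemma gpath_restrict:
  assumes "symp adj'" "gpath adj p" "ed p \<subseteq> edges adj'"
  shows "gpath adj' p"
  using assms(2,3)
proof (induction p rule: ed.induct)
  case (1 x y zs)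
  then have "adj' x y"
    using assms(1) by (auto simp: edges_def doubleton_eq_iff dest: sympD)
  then show ?case using 1 by (auto simp: gpath_Cons)
qed auto

lemma is_cycle_subset_edges:
  assumes "is_cycle adj C" shows "C \<subseteq> edges adj"
  using assms ed_subset_edges unfolding is_cycle_def edges_def by blast

lemma is_cycle_restrict:
  assumes "symp adj'" "is_cycle adj C" "C \<subseteq> edges adj'"
  shows "is_cycle adj' C"
proof -
  obtain p where p: "gpath adj p" "3 \<le> length p" "C = insert {last p, hd p} (ed p)"
    using assms(2) unfolding is_cycle_def by blast
  then have "{last p, hd p} \<in> edges adj'" "ed p \<subseteq> edges adj'"
    using assms(3) by auto
  then have "adj' (last p) (hd p)" "gpath adj' p"
    using assms(1) gpath_restrict[OF assms(1) p(1)]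
    by (auto simp: edges_def doubleton_eq_iff dest: sympD)
  then show ?thesis using p unfolding is_cycle_def by blast
qed

lemma cycle_closed_list:
  assumes "gpath adj p" "3 \<le> length p"
  shows "card (insert {last p, hd p} (ed p)) = length p"
    "\<Union> (insert {last p, hd p} (ed p)) = set p"
    "{last p, hd p} \<notin> ed p"
proof -
  have d: "distinct p" "p \<noteq> []" using assms by (auto simp: gpath_def)
  show *: "{last p, hd p} \<notin> ed p"
  proof
    assume "{last p, hd p} \<in> ed p"
    then have "p = [hd p, last p]" using ed_endpoints[OF d] by (simp add: insert_commute)
    from arg_cong[OF this, of length] show False using assms(2) by simp
  qed
  show "card (insert {last p, hd p} (ed p)) = length p"
    using * card_ed[OF d(1)] assms(2) by simp
  show "\<Union> (insert {last p, hd p} (ed p)) = set p"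
    using Union_ed[of p] assms(2) d by auto
qed

lemma card_Union_cycle:
  assumes "is_cycle adj C"
  shows "card (\<Union> C) = card C"
proof -
  obtain p where p: "gpath adj p" "3 \<le> length p" "C = insert {last p, hd p} (ed p)"
    using assms unfolding is_cycle_def by blast
  then show ?thesis
    using cycle_closed_list(1,2)[OF p(1,2)] by (simp add: gpath_def distinct_card)
qed

lemma card_cycle_ge_3: "is_cycle adj C \<Longrightarrow> 3 \<le> card C"
  unfolding is_cycle_def by (auto simp: cycle_closed_list(1))

lemma card_cycle_has_cycle:
  assumes "simple_graph V adj" "is_cycle adj C"
  shows "has_cycle V adj (card C)"
proof -
  obtain p where p: "gpath adj p" "3 \<le> length p" "adj (last p) (hd p)" "C = insert {last p, hd p} (ed p)"
    using assms(2) unfolding is_cycle_def by blast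
  have len: "card C = length p" using cycle_closed_list(1)[OF p(1,2)] p(4) by simp
  have *: "adj (p ! i) (p ! (Suc i mod length p))" if "i < length p" for i
  proof (cases "Suc i < length p")
    case True
    then show ?thesis using p(1) by (simp add: gpath_def successively_conv_nth)
  next
    case False
    then have "Suc i = length p" using that by simp
    then show ?thesis using p(2,3) by (cases p rule: rev_cases) (auto simp: hd_conv_nth nth_append)
  qed
  have "p ! i \<in> V" if "i < length p" for i
    using * that assms(1) unfolding simple_graph_def by blast
  then show ?thesis
    unfolding has_cycle_def len using p(1) *
    by (intro exI[of _ "(!) p"]) (auto simp: gpath_def inj_on_nth)
qed

lemma cycle_rotate:
  assumes "is_cycle adj C" "a \<in> \<Union> C"
  obtains p where "gpath adj (a # p)" "2 \<le> length p" "adj (last p) a"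
    "C = insert {last p, a} (ed (a # p))"
proof -
  obtain p where p: "gpath adj p" "3 \<le> length p" "adj (last p) (hd p)" "C = insert {last p, hd p} (ed p)"
    using assms(1) unfolding is_cycle_def by blast
  then have "a \<in> set p" using assms(2) cycle_closed_list(2)[OF p(1,2)] unfolding p(4) by (simp only:)
  then obtain xs ys where xy: "p = xs @ a # ys" by (metis split_list)
  show thesis
  proof (cases "xs = []")
    case True
    then show thesis using p xy by (intro that[of ys]) (auto split: if_splits)
  next
    case False
    have "gpath adj (a # ys @ xs)"
      using p xy False by (auto simp: gpath_append gpath_Cons split: if_splits)
    moreover have "adj (last (ys @ xs)) a" "2 \<le> length (ys @ xs)"
      using p xy False by (auto simp: gpath_append)
    moreover have "C = insert {last (ys @ xs), a} (ed (a # ys @ xs))"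
      using p(4) xy False ed_append[of xs "a # ys"] ed_append[of "a # ys" xs] by auto
    ultimately show thesis using that by blast
  qed
qed

text \<open>The vertex list is rotated to start at \<open>a\<close> and cut at \<open>b\<close>; the
  second half is read backwards. A common edge of the halves could only be \<open>{a, b}\<close>,
  which would leave a cycle of length 2.\<close>

lemma cycle_split:
  assumes "symp adj" "is_cycle adj C" "a \<in> \<Union> C" "b \<in> \<Union> C" "a \<noteq> b"
  obtains p q where "gpath adj p" "gpath adj q" "hd p = a" "last p = b" "hd q = a" "last q = b"
    "2 \<le> length p" "2 \<le> length q" "set p \<inter> set q = {a, b}" "C = ed p \<union> ed q" "ed p \<inter> ed q = {}"
    "\<Union> C = set p \<union> set q"
proof -
  obtain r where r: "gpath adj (a # r)" "2 \<le> length r" "adj (last r) a"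
    "C = insert {last r, a} (ed (a # r))"
    using cycle_rotate[OF assms(2,3)] .
  have U: "\<Union> C = set (a # r)" using cycle_closed_list(2)[OF r(1)] r(2,4) by (auto split: if_splits)
  then obtain xs ys where xy: "r = xs @ b # ys" using assms(4,5) by (auto dest: split_list)
  let ?p = "a # xs @ [b]" and ?q = "a # rev ys @ [b]"
  have gp: "gpath adj ?p" using r(1) xy by (auto simp: gpath_append gpath_Cons hd_append split: if_splits)
  have gr: "gpath adj (b # ys)" "a \<notin> set (b # ys)" "adj a (last (b # ys))"
    using r(1,3) xy sympD[OF assms(1)] by (auto simp: gpath_append gpath_Cons)
  then have gq: "gpath adj ?q"
    using gpath_rev[OF assms(1) gr(1)] by (auto simp: gpath_Cons hd_rev hd_append split: if_splits)
  have CC: "C = ed ?p \<union> ed ?q"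
  proof -
    have "ed ?q = insert {last r, a} (ed (b # ys))"
      using ed_rev[of "b # ys"] ed_Cons[of "rev ys @ [b]" a] xy
      by (auto simp: hd_append hd_rev insert_commute split: if_splits)
    then show ?thesis
      using r(4) xy ed_append_shared[of "a # xs" b ys] by auto
  qed
  have sets: "set ?p \<inter> set ?q = {a, b}"
    using r(1) xy by (auto simp: gpath_def)
  have "ed ?p \<inter> ed ?q = {}"
  proof (rule ccontr)
    assume "ed ?p \<inter> ed ?q \<noteq> {}"
    then obtain e where e: "e \<in> ed ?p" "e \<in> ed ?q" by blast
    then have "e \<subseteq> {a, b}" using ed_subset_set sets by blast
    moreover obtain x y where "e = {x, y}" "x \<noteq> y"
      using ed_distinct[OF _ e(1)] gp by (auto simp: gpath_def)
    ultimately have "e = {a, b}" by auto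
    then have "?p = [a, b]" "?q = [a, b]"
      using ed_endpoints[of ?p] ed_endpoints[of ?q] e gp gq by (auto simp: gpath_def)
    then have "length r = 1" using xy by simp
    then show False using r(2) by simp
  qed
  then show thesis
    using that[OF gp gq] sets CC U xy by auto
qed

text \<open>The converse of \<open>cycle_split\<close>: traverse \<open>p\<close> and return along
  the inner vertices of \<open>q\<close>. The length bound on \<open>p\<close> rules out that both
  paths are the edge \<open>{a, b}\<close>.\<close>

lemma theta_cycle:
  assumes "symp adj" "gpath adj p" "gpath adj q" "hd p = a" "last p = b" "hd q = a" "last q = b"
    "a \<noteq> b" "p \<noteq> []" "q \<noteq> []" "set p \<inter> set q = {a, b}" "3 \<le> length p"
  shows "is_cycle adj (ed p \<union> ed q)" "ed p \<inter> ed q = {}"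
proof -
  obtain p' where p': "p = a # p'" using assms by (cases p) auto
  obtain q' where q': "q = a # q' @ [b]" using assms
    by (cases q; cases "tl q" rule: rev_cases) (auto split: if_splits)
  let ?r = "p @ rev q'"
  have "gpath adj (rev (q' @ [b]))"
    using assms(3) q' by (intro gpath_rev[OF assms(1)]) (simp add: gpath_Cons)
  moreover have "set p \<inter> set q' = {}"
    using assms(3,11) q' by (auto simp: gpath_def)
  ultimately have g: "gpath adj ?r"
    using assms q' by (auto simp: gpath_append gpath_Cons hd_rev)
  have a: "adj (last ?r) a"
  proof (cases "q' = []")
    case True
    then show ?thesis using assms q' sympD[OF assms(1)] by (auto simp: gpath_Cons)
  next
    case False
    then show ?thesis using assms(3) q' sympD[OF assms(1)] by (auto simp: gpath_Cons last_rev)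
  qed
  have "ed p \<union> ed q = insert {last ?r, hd ?r} (ed ?r)"
  proof (cases "q' = []")
    case True
    then show ?thesis using q' assms by (auto simp: insert_commute)
  next
    case False
    then show ?thesis using q' assms ed_append[of p "rev q'"] ed_append[of q' "[b]"]
      by (auto simp: insert_commute ed_Cons hd_rev last_rev)
  qed
  then show "is_cycle adj (ed p \<union> ed q)"
    unfolding is_cycle_def using g a assms p' by (intro exI[of _ ?r]) auto
  show "ed p \<inter> ed q = {}"
  proof (rule ccontr)
    assume "ed p \<inter> ed q \<noteq> {}"
    then obtain e where e: "e \<in> ed p" "e \<in> ed q" by blast
    then have "e \<subseteq> {a, b}" using ed_subset_set assms by blast
    moreover obtain x y where "e = {x, y}" "x \<noteq> y"
      using ed_distinct[OF _ e(1)] assms(2) by (auto simp: gpath_def)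
    ultimately have "e = {a, b}" by auto
    then have "p = [a, b]"
      using ed_endpoints[of p] e assms by (simp add: gpath_def)
    then show False using assms(12) by simp
  qed
qed

text \<open>\<open>cycle_split\<close> is applied at the ends of the edge: the half containing the
  edge is nothing but the edge, and the other half is the required path.\<close>

lemma cycle_minus_edge:
  assumes "symp adj" "is_cycle adj C" "{a, b} \<in> C"
  obtains p where "gpath adj p" "hd p = a" "last p = b" "3 \<le> length p" "C = insert {a, b} (ed p)"
    "{a, b} \<notin> ed p" "\<Union> C = set p" "a \<noteq> b"
proof -
  note found = that
  have ab: "a \<noteq> b"
  proof
    assume "a = b"
    obtain r where r: "gpath adj r" "3 \<le> length r" "C = insert {last r, hd r} (ed r)"
      using assms(2) unfolding is_cycle_def by blast
    have "card e = 2" if "e \<in> C" for e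
    proof -
      have "e = {last r, hd r} \<or> e \<in> ed r" using that r(3) by simp
      then consider "e = {last r, hd r}" | "e \<in> ed r" by blast
      then show ?thesis
      proof cases
        case 1 then show ?thesis using hd_neq_last[of r] r by (auto simp: gpath_def)
      next
        case 2
        then obtain xs x y ys where "r = xs @ x # y # ys" "e = {x, y}"
          using ed_obtain[OF 2] by blast
        then show ?thesis using r(1) by (auto simp: gpath_def)
      qed
    qed
    then show False using assms(3) \<open>a = b\<close> by fastforce
  qed
  obtain p q where pq: "gpath adj p" "gpath adj q" "hd p = a" "last p = b" "hd q = a" "last q = b"
    "2 \<le> length p" "2 \<le> length q" "set p \<inter> set q = {a, b}" "C = ed p \<union> ed q" "ed p \<inter> ed q = {}"
    "\<Union> C = set p \<union> set q"
    by (rule cycle_split[OF assms(1,2) _ _ ab]) (use assms(3) in auto)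
  have *: thesis if pq: "gpath adj p" "gpath adj q" "hd p = a" "last p = b" "hd q = a" "last q = b"
    "2 \<le> length p" "2 \<le> length q" "set p \<inter> set q = {a, b}" "C = ed p \<union> ed q" "ed p \<inter> ed q = {}"
    "\<Union> C = set p \<union> set q" "{a, b} \<in> ed p" for p q
  proof -
    have p: "p = [a, b]"
      using ed_endpoints[of p] pq by (cases "p = []") (auto simp: gpath_def)
    have "length q \<noteq> 2"
    proof
      assume "length q = 2"
      then have "q = [a, b]" using pq(5,6) by (cases q rule: ed.cases) auto
      then show False using p pq(11) by simp
    qed
    then show thesis
      using found[of q] pq p ab by auto
  qed
  have "{a, b} \<in> ed p \<or> {a, b} \<in> ed q" using assms(3) pq(10) by simp
  then show thesis
  proof
    assume "{a, b} \<in> ed p"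
    then show thesis by (rule *[OF pq])
  next
    assume "{a, b} \<in> ed q"
    show thesis
      by (rule *[OF pq(2,1,5,6,3,4,8,7) _ _ _ _ \<open>{a, b} \<in> ed q\<close>])
        (use pq in \<open>simp_all add: Int_commute Un_commute\<close>)
  qed
qed

lemma cycle_minus_corner:
  assumes "symp adj" "is_cycle adj C" "{a, b} \<in> C" "{b, c} \<in> C" "a \<noteq> c"
  obtains p where "gpath adj p" "hd p = a" "last p = c" "2 \<le> length p" "b \<notin> set p"
    "C = {{a, b}, {b, c}} \<union> ed p" "\<Union> C = insert b (set p)"
proof -
  obtain q where q: "gpath adj q" "hd q = b" "last q = a" "3 \<le> length q" "C = insert {b, a} (ed q)"
    "{b, a} \<notin> ed q" "\<Union> C = set q" "b \<noteq> a"
    by (rule cycle_minus_edge[OF assms(1,2), of b a]) (use assms(3) in \<open>simp_all add: insert_commute\<close>)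
  obtain y q' where y: "q = b # y # q'" using q by (cases q rule: ed.cases) auto
  have "{b, c} \<in> ed q" using assms(4,5) q(5) by (auto simp: doubleton_eq_iff)
  moreover have "{b, c} \<notin> ed (y # q')" using ed_subset_set q(1) y by (fastforce simp: gpath_def)
  ultimately have "c = y" using y by (auto simp: doubleton_eq_iff)
  have "gpath adj (rev (y # q'))"
    using q(1) y by (intro gpath_rev[OF assms(1)]) (simp add: gpath_Cons)
  then show thesis
    by (rule that[of "rev (y # q')"])
      (use q y \<open>c = y\<close> ed_rev[of "y # q'"] in \<open>auto simp: hd_rev hd_append insert_commute gpath_def split: if_splits\<close>)
qed

lemma card_nbrs_cycle:
  assumes "symp adj" "is_cycle adj C" "v \<in> \<Union> C"
  shows "card {x. {v, x} \<in> C} = 2"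
proof -
  obtain r where r: "gpath adj (v # r)" "2 \<le> length r" "C = insert {last r, v} (ed (v # r))"
    using cycle_rotate[OF assms(2,3)] .
  obtain y q where q: "r = y # q" "q \<noteq> []" using r(2) by (cases r rule: ed.cases) auto
  have "{v, x} \<notin> ed r" for x
    using ed_subset_set[of "{v, x}" r] r(1) by (auto simp: gpath_Cons)
  then have "{x. {v, x} \<in> C} = {last r, y}"
    using r(3) q by (auto simp: doubleton_eq_iff)
  moreover have "last r \<noteq> y" using r(1) q last_in_set[of q] by (auto simp: gpath_def)
  ultimately show ?thesis by simp
qed

lemma reachable_gpath:
  assumes "rtranclp R x y"
  shows "\<exists>p. gpath R p \<and> p \<noteq> [] \<and> hd p = x \<and> last p = y"
  using assms
proof (induction rule: rtranclp_induct)
  case base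
  then show ?case by (intro exI[of _ "[x]"]) auto
next
  case (step y z)
  then obtain p where p: "gpath R p" "p \<noteq> []" "hd p = x" "last p = y" by blast
  show ?case
  proof (cases "z \<in> set p")
    case True
    then obtain xs ys where "p = xs @ z # ys" by (metis split_list)
    then show ?thesis using p
      by (intro exI[of _ "xs @ [z]"]) (auto simp: gpath_append gpath_Cons hd_append)
  next
    case False
    then show ?thesis using p step(2)
      by (intro exI[of _ "p @ [z]"]) (auto simp: gpath_append)
  qed
qed

section \<open>The cycle space\<close>

lemma simple_graphD:
  assumes "simple_graph V adj"
  shows "finite V" "adj u v \<Longrightarrow> u \<in> V" "adj u v \<Longrightarrow> v \<in> V" "adj u v \<Longrightarrow> u \<noteq> v" "adj u v \<Longrightarrow> adj v u"
    "symp adj"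
  using assms unfolding simple_graph_def by (auto intro: sympI)

lemma edge_iff: "symp adj \<Longrightarrow> {u, v} \<in> edges adj \<longleftrightarrow> adj u v"
  by (auto simp: edges_def doubleton_eq_iff dest: sympD)

lemma edges_subset_Pow: "simple_graph V adj \<Longrightarrow> edges adj \<subseteq> Pow V"
  by (auto simp: edges_def simple_graph_def)

lemma finite_edges: "simple_graph V adj \<Longrightarrow> finite (edges adj)"
  using finite_subset[OF edges_subset_Pow, of V adj] simple_graphD(1)[of V adj] by simp

text \<open>All neighbours of the first vertex of a longest path lie on that path. One of them is
  not the second vertex, and the edge to it closes a cycle of length at least 3.\<close>

lemma min_degree_2_imp_cycle:
  assumes G: "simple_graph V adj" and "V \<noteq> {}" and "\<forall>v\<in>V. 2 \<le> deg V adj v"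
  shows "\<exists>C. is_cycle adj C"
proof -
  define P where "P = (\<lambda>p. gpath adj p \<and> p \<noteq> [] \<and> set p \<subseteq> V)"
  obtain v where "v \<in> V" using assms(2) by auto
  then have "P [v]" by (simp add: P_def)
  moreover have "length p \<le> card V" if "P p" for p
    using that card_mono[OF simple_graphD(1)[OF G], of "set p"] by (auto simp: P_def gpath_def distinct_card)
  then have "\<forall>p. P p \<longrightarrow> length p < Suc (card V)" by (simp add: less_Suc_eq_le)
  ultimately obtain p where p: "P p" "\<And>q. P q \<Longrightarrow> length q \<le> length p"
    using ex_has_greatest_nat[of P "[v]" length "Suc (card V)"] by blast
  obtain x ps where ps: "p = x # ps" using p(1) by (cases p) (auto simp: P_def)
  have nbr: "y \<in> set ps" if "adj x y" for y
  proof (rule ccontr)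
    assume "y \<notin> set ps"
    then have "P (y # p)"
      using p(1) that ps simple_graphD[OF G] by (auto simp: P_def gpath_Cons)
    then show False using p(2)[of "y # p"] by simp
  qed
  have "x \<in> V" using p(1) ps by (simp add: P_def)
  then have "2 \<le> card {u \<in> V. adj x u}" using assms(3) by (simp add: deg_def)
  then have "\<not> {u \<in> V. adj x u} \<subseteq> {hd ps}"
    using card_mono[of "{hd ps}" "{u \<in> V. adj x u}"] by auto
  then obtain y where y: "adj x y" "y \<noteq> hd ps" by auto
  then have "y \<in> set ps" using nbr by simp
  then obtain us vs where uv: "ps = us @ y # vs" by (metis split_list)
  then have "us \<noteq> []" using y by auto
  have "gpath adj (x # us @ [y])"
    using p(1) ps uv by (auto simp: P_def gpath_Cons gpath_append hd_append split: if_splits)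
  moreover have "3 \<le> length (x # us @ [y])" using \<open>us \<noteq> []\<close> by (cases us) auto
  ultimately have "is_cycle adj (insert {last (x # us @ [y]), hd (x # us @ [y])} (ed (x # us @ [y])))"
    unfolding is_cycle_def using y simple_graphD(5)[OF G] by (intro exI[of _ "x # us @ [y]"]) auto
  then show ?thesis by blast
qed

text \<open>Without cycles some vertex has degree at most 1; deleting it removes one vertex and at
  most one edge.\<close>

lemma card_edges_forest:
  assumes "simple_graph V adj" "V \<noteq> {}" "\<nexists>C. is_cycle adj C"
  shows "card (edges adj) + 1 \<le> card V"
  using assms
proof (induction "card V" arbitrary: V adj rule: less_induct)
  case less
  note G = less.prems(1)
  obtain v where v: "v \<in> V" "deg V adj v \<le> 1"
    using min_degree_2_imp_cycle[OF less.prems(1,2)] less.prems(3) by force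
  show ?case
  proof (cases "V = {v}")
    case True
    then have "\<not> adj u w" for u w
      using simple_graphD(2-4)[OF G, of u w] by auto
    then have "edges adj = {}"
      unfolding edges_def by blast
    then show ?thesis using True by simp
  next
    case False
    define adj' where "adj' = (\<lambda>u w. adj u w \<and> u \<noteq> v \<and> w \<noteq> v)"
    have G': "simple_graph (V - {v}) adj'"
      using G unfolding simple_graph_def adj'_def by auto
    have "\<nexists>C. is_cycle adj' C"
    proof
      assume "\<exists>C. is_cycle adj' C"
      then obtain C where C: "is_cycle adj' C" by blast
      have "edges adj' \<subseteq> edges adj" by (auto simp: edges_def adj'_def)
      then have "is_cycle adj C"
        using is_cycle_restrict[OF simple_graphD(6)[OF G] C] is_cycle_subset_edges[OF C] by blast
      then show False using less.prems(3) by blast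
    qed
    moreover have "card (V - {v}) < card V"
      using v(1) simple_graphD(1)[OF G] by (intro psubset_card_mono) auto
    moreover have "V - {v} \<noteq> {}" using False v(1) by blast
    ultimately have IH: "card (edges adj') + 1 \<le> card (V - {v})"
      using less.hyps[OF _ G'] by blast
    have "edges adj \<subseteq> edges adj' \<union> (\<lambda>u. {v, u}) ` {u \<in> V. adj v u}"
    proof
      fix e assume "e \<in> edges adj"
      then obtain u w where "e = {u, w}" "adj u w" by (auto simp: edges_def)
      then show "e \<in> edges adj' \<union> (\<lambda>u. {v, u}) ` {u \<in> V. adj v u}"
        using simple_graphD[OF G] by (cases "u = v \<or> w = v") (auto simp: edges_def adj'_def)
    qed
    then have "card (edges adj) \<le> card (edges adj' \<union> (\<lambda>u. {v, u}) ` {u \<in> V. adj v u})"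
      using finite_edges[OF G'] simple_graphD(1)[OF G] by (intro card_mono) auto
    also have "\<dots> \<le> card (edges adj') + card ((\<lambda>u. {v, u}) ` {u \<in> V. adj v u})"
      by (rule card_Un_le)
    also have "\<dots> \<le> card (edges adj') + 1"
      using v(2) card_image_le[of "{u \<in> V. adj v u}" "\<lambda>u. {v, u}"] simple_graphD(1)[OF G]
      unfolding deg_def by simp
    finally show ?thesis
      using IH v(1) simple_graphD(1)[OF G] by simp
  qed
qed

text \<open>\<open>Z\<close> contains the cycle space, whose dimension is at least |E| - |V| + 1;
  powers of 2 stand for dimensions, and the factor on the right avoids a subtraction. For the
  induction an edge \<open>e\<close> of a cycle \<open>C\<close> is deleted: the members of
  \<open>Z\<close> without \<open>e\<close> serve the smaller graph, and adding \<open>C\<close> to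
  each of them gives as many members with \<open>e\<close>.\<close>

lemma card_cycle_closed_family:
  assumes "simple_graph V adj" "V \<noteq> {}" "Z \<subseteq> Pow (edges adj)" "{} \<in> Z"
    "\<And>X C. X \<in> Z \<Longrightarrow> is_cycle adj C \<Longrightarrow> sym_diff X C \<in> Z"
  shows "2 ^ (card (edges adj) + 1) \<le> card Z * 2 ^ card V"
  using assms
proof (induction "card (edges adj)" arbitrary: adj Z rule: less_induct)
  case less
  note G = less.prems(1)
  have finZ: "finite Z"
    by (rule finite_subset[OF less.prems(3)]) (simp add: finite_edges[OF G])
  show ?case
  proof (cases "\<exists>C. is_cycle adj C")
    case False
    then have "(2::nat) ^ (card (edges adj) + 1) \<le> 2 ^ card V"
      using card_edges_forest[OF G less.prems(2)] by (intro power_increasing) auto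
    moreover have "card Z \<ge> 1"
      using finZ less.prems(4) card_gt_0_iff[of Z] by auto
    ultimately show ?thesis
      using mult_le_mono[of 1 "card Z"] by fastforce
  next
    case True
    then obtain C where C: "is_cycle adj C" by blast
    then obtain e where e: "e \<in> C" using card_cycle_ge_3 by fastforce
    define adj' where "adj' = (\<lambda>u w. adj u w \<and> {u, w} \<noteq> e)"
    have G': "simple_graph V adj'"
      using G unfolding simple_graph_def adj'_def by (auto simp: insert_commute)
    have edges': "edges adj' = edges adj - {e}"
      by (auto simp: edges_def adj'_def)
    have eE: "e \<in> edges adj" using is_cycle_subset_edges[OF C] e by blast
    then have cardE: "card (edges adj) = card (edges adj') + 1"
      unfolding edges' using finite_edges[OF G]
      using card_Suc_Diff1[of "edges adj" e] by simp
    define Z' where "Z' = {X \<in> Z. e \<notin> X}"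
    have "2 ^ (card (edges adj') + 1) \<le> card Z' * 2 ^ card V"
    proof (rule less.hyps)
      show "card (edges adj') < card (edges adj)" using cardE by simp
      show "simple_graph V adj'" by fact
      show "V \<noteq> {}" by fact
      show "Z' \<subseteq> Pow (edges adj')" using less.prems(3) edges' by (auto simp: Z'_def)
      show "{} \<in> Z'" using less.prems(4) by (simp add: Z'_def)
      fix X D assume X: "X \<in> Z'" and D: "is_cycle adj' D"
      have "D \<subseteq> edges adj - {e}" using is_cycle_subset_edges[OF D] edges' by simp
      moreover have "is_cycle adj D"
        using is_cycle_restrict[OF simple_graphD(6)[OF G] D] calculation by blast
      ultimately show "sym_diff X D \<in> Z'"
        using X less.prems(5)[of X D] by (auto simp: Z'_def)
    qed
    moreover have "2 * card Z' \<le> card Z"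
    proof -
      let ?h = "\<lambda>X. sym_diff X C"
      have "inj_on ?h Z'" by (rule inj_onI) blast
      then have "card (?h ` Z') = card Z'" by (rule card_image)
      moreover have "Z' \<inter> ?h ` Z' = {}" using e by (auto simp: Z'_def)
      moreover have "Z' \<union> ?h ` Z' \<subseteq> Z" using less.prems(5)[OF _ C] by (auto simp: Z'_def)
      moreover have "finite Z'" using finZ by (simp add: Z'_def)
      ultimately show ?thesis
        using card_mono[OF finZ, of "Z' \<union> ?h ` Z'"] card_Un_disjoint[of Z' "?h ` Z'"] by simp
    qed
    ultimately have "2 * 2 ^ (card (edges adj') + 1) \<le> card Z * 2 ^ card V"
      using mult_le_mono1[of "2 * card Z'" "card Z" "2 ^ card V"] by linarith
    then show ?thesis using cardE by simp
  qed
qed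

text \<open>The sum over GF(2) of the members of \<open>T\<close>, each regarded as its indicator
  vector.\<close>

definition parity_sum :: "'a set set \<Rightarrow> 'a set" where
  "parity_sum T = {e. odd (card {D \<in> T. e \<in> D})}"

lemma odd_card_sym_diff:
  assumes "finite A" "finite B"
  shows "odd (card (sym_diff A B)) \<longleftrightarrow> odd (card A) \<noteq> odd (card B)"
proof -
  have "card A = card (A - B) + card (A \<inter> B)" "card B = card (B - A) + card (A \<inter> B)"
    using assms card_Int_Diff[of A B] card_Int_Diff[of B A] by (simp_all add: Int_commute)
  moreover have "card (sym_diff A B) = card (A - B) + card (B - A)"
    using assms by (intro card_Un_disjoint) auto
  ultimately show ?thesis by presburger
qed

lemma parity_sum_sym_diff:
  assumes "finite S" "finite T"
  shows "parity_sum (sym_diff S T) = sym_diff (parity_sum S) (parity_sum T)"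
proof -
  have "odd (card {D \<in> sym_diff S T. e \<in> D}) \<longleftrightarrow>
      odd (card {D \<in> S. e \<in> D}) \<noteq> odd (card {D \<in> T. e \<in> D})" for e
  proof -
    have "{D \<in> sym_diff S T. e \<in> D} = sym_diff {D \<in> S. e \<in> D} {D \<in> T. e \<in> D}" by blast
    then show ?thesis using odd_card_sym_diff[of "{D \<in> S. e \<in> D}" "{D \<in> T. e \<in> D}"] assms by simp
  qed
  then show ?thesis by (auto simp: parity_sum_def)
qed

text \<open>Subfamilies of \<open>F\<close> have at most 2^|F| different sums. These sums form a
  family closed under adding cycles, so the lower bound on the size of such a family applies, and
  exponents are compared.\<close>

lemma card_cycle_generators:
  assumes G: "simple_graph V adj" and V: "V \<noteq> {}" and F: "F \<subseteq> Pow (edges adj)"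
    and gen: "\<And>C. is_cycle adj C \<Longrightarrow> \<exists>T\<subseteq>F. C = parity_sum T"
  shows "card (edges adj) + 1 \<le> card F + card V"
proof -
  have finF: "finite F" by (rule finite_subset[OF F]) (simp add: finite_edges[OF G])
  define Z where "Z = parity_sum ` Pow F"
  have "2 ^ (card (edges adj) + 1) \<le> card Z * 2 ^ card V"
  proof (rule card_cycle_closed_family[OF G V])
    show "Z \<subseteq> Pow (edges adj)"
    proof
      fix X assume "X \<in> Z"
      then obtain T where T: "T \<subseteq> F" "X = parity_sum T" by (auto simp: Z_def)
      have "e \<in> edges adj" if "e \<in> parity_sum T" for e
      proof -
        have "{D \<in> T. e \<in> D} \<noteq> {}" using that unfolding parity_sum_def by (intro notI) simp
        then show ?thesis using T F by blast
      qed
      then show "X \<in> Pow (edges adj)" using T by blast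
    qed
    show "{} \<in> Z" by (auto simp: Z_def parity_sum_def intro!: image_eqI[of _ _ "{}"])
    fix X C assume "X \<in> Z" and C: "is_cycle adj C"
    then obtain S where "S \<subseteq> F" "X = parity_sum S" by (auto simp: Z_def)
    moreover obtain T where "T \<subseteq> F" "C = parity_sum T" using gen[OF C] by blast
    ultimately show "sym_diff X C \<in> Z"
      using parity_sum_sym_diff[of S T] finite_subset[OF _ finF]
      unfolding Z_def by (intro image_eqI[of _ _ "sym_diff S T"]) auto
  qed
  also have "card Z \<le> 2 ^ card F"
    using card_image_le[of "Pow F" parity_sum] finF by (simp add: Z_def card_Pow)
  finally have "(2::nat) ^ (card (edges adj) + 1) \<le> 2 ^ (card F + card V)"
    by (simp add: power_add)
  then show ?thesis by (simp del: power_Suc)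
qed

section \<open>Plane drawings\<close>

text \<open>The witnesses of \<open>planar\<close> become locale parameters because two drawings of
  the same graph occur: the given one and its image under an inversion.\<close>

locale plane_drawing =
  fixes V :: "'a set" and adj :: "'a \<Rightarrow> 'a \<Rightarrow> bool" and f :: "'a \<Rightarrow> complex"
    and \<gamma> :: "'a \<Rightarrow> 'a \<Rightarrow> real \<Rightarrow> complex"
  assumes graph: "simple_graph V adj"
    and inj: "inj_on f V"
    and arc: "adj u v \<Longrightarrow> arc (\<gamma> u v)"
    and ends: "adj u v \<Longrightarrow> pathstart (\<gamma> u v) = f u" "adj u v \<Longrightarrow> pathfinish (\<gamma> u v) = f v"
    and sym_image: "adj u v \<Longrightarrow> path_image (\<gamma> u v) = path_image (\<gamma> v u)"
    and vertices_on_edge: "adj u v \<Longrightarrow> path_image (\<gamma> u v) \<inter> f ` V = {f u, f v}"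
    and crossing: "adj u v \<Longrightarrow> adj x y \<Longrightarrow> {u, v} \<noteq> {x, y} \<Longrightarrow>
      path_image (\<gamma> u v) \<inter> path_image (\<gamma> x y) \<subseteq> f ` ({u, v} \<inter> {x, y})"
begin

lemmas graphD = simple_graphD[OF graph]

definition draw :: "'a set set \<Rightarrow> complex set" where
  "draw E = \<Union> {path_image (\<gamma> u v) | u v. adj u v \<and> {u, v} \<in> E}"

lemma draw_Un: "draw (E \<union> E') = draw E \<union> draw E'"
  unfolding draw_def by blast

lemma draw_mono: "E \<subseteq> E' \<Longrightarrow> draw E \<subseteq> draw E'"
  unfolding draw_def by blast

lemma draw_edge: "adj u v \<Longrightarrow> draw {{u, v}} = path_image (\<gamma> u v)"
  unfolding draw_def using sym_image by (fastforce simp: doubleton_eq_iff)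

lemma draw_insert: "adj u v \<Longrightarrow> draw (insert {u, v} E) = path_image (\<gamma> u v) \<union> draw E"
  using draw_Un[of "{{u, v}}" E] draw_edge by simp

lemma draw_Int:
  assumes "E \<inter> E' = {}"
  shows "draw E \<inter> draw E' \<subseteq> f ` (\<Union> E \<inter> \<Union> E')"
proof
  fix z assume "z \<in> draw E \<inter> draw E'"
  then obtain u v x y where *: "adj u v" "{u, v} \<in> E" "z \<in> path_image (\<gamma> u v)"
     "adj x y" "{x, y} \<in> E'" "z \<in> path_image (\<gamma> x y)"
    unfolding draw_def by blast
  then have "{u, v} \<noteq> {x, y}" using assms by auto
  then have "z \<in> f ` ({u, v} \<inter> {x, y})" using crossing * by blast
  then show "z \<in> f ` (\<Union> E \<inter> \<Union> E')" using *(2,5) by blast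
qed

lemma vertex_in_draw:
  assumes "E \<subseteq> edges adj" "v \<in> V"
  shows "f v \<in> draw E \<longleftrightarrow> v \<in> \<Union> E"
proof
  assume "f v \<in> draw E"
  then obtain x y where xy: "adj x y" "{x, y} \<in> E" "f v \<in> path_image (\<gamma> x y)"
    unfolding draw_def by blast
  then have "f v \<in> {f x, f y}" using vertices_on_edge[OF xy(1)] assms(2) by blast
  then have "v \<in> {x, y}" using inj assms(2) graphD(2,3)[OF xy(1)] by (auto dest: inj_onD)
  then show "v \<in> \<Union> E" using xy by blast
next
  assume "v \<in> \<Union> E"
  then obtain e where e: "e \<in> E" "v \<in> e" by blast
  then obtain x y where xy: "e = {x, y}" "adj x y" using assms(1) by (auto simp: edges_def)
  then have "f v \<in> path_image (\<gamma> x y)" using e vertices_on_edge[OF xy(2)] by auto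
  then show "f v \<in> draw E" unfolding draw_def using e xy by blast
qed

lemma edges_vertices: "E \<subseteq> edges adj \<Longrightarrow> \<Union> E \<subseteq> V"
  using edges_subset_Pow[OF graph] by blast

text \<open>The first edge and the remaining path share only the vertex between them, so their
  drawings meet in one point and joining them gives an arc again.\<close>

lemma gpath_arc:
  assumes "gpath adj p" "2 \<le> length p"
  obtains g where "arc g" "pathstart g = f (hd p)" "pathfinish g = f (last p)" "path_image g = draw (ed p)"
  using assms
proof (induction p arbitrary: thesis rule: ed.induct)
  case (1 x y zs)
  have xy: "adj x y" "gpath adj (y # zs)" "x \<notin> set (y # zs)" using "1.prems"(2) by (auto simp: gpath_Cons)
  show ?case
  proof (cases "zs = []")
    case True
    then show ?thesis
      using "1.prems"(1)[of "\<gamma> x y"] xy arc ends draw_edge by simp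
  next
    case False
    then obtain g where g: "arc g" "pathstart g = f (hd (y # zs))" "pathfinish g = f (last (y # zs))"
        "path_image g = draw (ed (y # zs))"
      using "1.IH"[OF _ xy(2)] by (cases zs) auto
    have "{x, y} \<notin> ed (y # zs)" using ed_subset_set[of "{x, y}" "y # zs"] xy(3) by auto
    then have "draw {{x, y}} \<inter> draw (ed (y # zs)) \<subseteq> f ` (\<Union> {{x, y}} \<inter> \<Union> (ed (y # zs)))"
      by (intro draw_Int) auto
    also have "\<dots> \<subseteq> {f y}" using ed_subset_set[of _ "y # zs"] xy(3) by auto
    finally have "path_image (\<gamma> x y) \<inter> path_image g \<subseteq> {pathstart g}"
      using g xy draw_edge by simp
    then have "arc (\<gamma> x y +++ g)"
      using g xy arc ends by (intro arc_join) auto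
    moreover have "path_image (\<gamma> x y +++ g) = draw (ed (x # y # zs))"
      using g xy ends draw_insert by (simp add: path_image_join)
    ultimately show ?thesis
      using "1.prems"(1)[of "\<gamma> x y +++ g"] g xy ends False by auto
  qed
qed auto

lemma draw_paths_Int:
  assumes "gpath adj p" "gpath adj q" "2 \<le> length p" "2 \<le> length q" "ed p \<inter> ed q = {}"
  shows "draw (ed p) \<inter> draw (ed q) = f ` (set p \<inter> set q)"
proof
  show "draw (ed p) \<inter> draw (ed q) \<subseteq> f ` (set p \<inter> set q)"
    using draw_Int[OF assms(5)] Union_ed[OF assms(3)] Union_ed[OF assms(4)] by simp
  have sub: "ed p \<subseteq> edges adj" "ed q \<subseteq> edges adj" using assms ed_subset_edges by auto
  have "f v \<in> draw (ed p) \<inter> draw (ed q)" if v: "v \<in> set p" "v \<in> set q" for v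
  proof -
    have vu: "v \<in> \<Union> (ed p)" "v \<in> \<Union> (ed q)" using v Union_ed assms(3,4) by auto
    then have "v \<in> V" using edges_vertices[OF sub(1)] by blast
    then show ?thesis using vertex_in_draw[OF sub(1)] vertex_in_draw[OF sub(2)] vu by blast
  qed
  then show "f ` (set p \<inter> set q) \<subseteq> draw (ed p) \<inter> draw (ed q)" by blast
qed

lemma cycle_loop:
  assumes "is_cycle adj C"
  obtains g where "simple_path g" "pathfinish g = pathstart g" "path_image g = draw C"
proof -
  obtain e where e: "e \<in> C" using card_cycle_ge_3[OF assms] by fastforce
  then obtain a b where ab: "{a, b} \<in> C" using is_cycle_subset_edges[OF assms] by (auto simp: edges_def)
  obtain p where p: "gpath adj p" "hd p = a" "last p = b" "3 \<le> length p" "C = insert {a, b} (ed p)"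
    "{a, b} \<notin> ed p" "\<Union> C = set p" "a \<noteq> b"
    by (rule cycle_minus_edge[OF graphD(6) assms ab])
  have adj: "adj a b"
    using is_cycle_subset_edges[OF assms] ab edge_iff[OF graphD(6)] by blast
  obtain g where g: "arc g" "pathstart g = f (hd p)" "pathfinish g = f (last p)" "path_image g = draw (ed p)"
    by (rule gpath_arc[OF p(1)]) (use p in auto)
  have q: "gpath adj [a, b]" using adj p by (simp add: gpath_Cons)
  have "set p \<inter> {a, b} = {a, b}" using p(2-4) by (cases "p = []") auto
  then have "path_image g \<inter> path_image (\<gamma> a b) = {f a, f b}"
    using draw_paths_Int[OF p(1) q] p draw_edge[OF adj] g by simp
  then have m: "path_image (\<gamma> a b) \<inter> path_image g = {f a, f b}" by blast
  show thesis
    by (rule that[OF arc_pair_loop(1,2)[OF arc[OF adj] g(1) ends[OF adj] _ _ m]])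
      (use g p adj ends in \<open>auto simp: path_image_join draw_insert\<close>)
qed

lemma cycle_Jordan:
  assumes "is_cycle adj C"
  shows "inside (draw C) \<noteq> {}" "open (inside (draw C))" "connected (inside (draw C))"
    "bounded (inside (draw C))" "frontier (inside (draw C)) = draw C" "inside (draw C) \<inter> draw C = {}"
  using cycle_loop[OF assms] Jordan_inside_outside inside_no_overlap by metis+

lemma bounded_draw_cycle: "is_cycle adj C \<Longrightarrow> bounded (draw C)"
  using cycle_loop[of C] by (metis bounded_simple_path_image)

text \<open>An edge of \<open>C\<close> outside \<open>D\<close> could meet \<open>draw D\<close>
  only at its two ends, but an arc has further points.\<close>

lemma cycle_draw_inj:
  assumes "is_cycle adj C" "is_cycle adj D" "draw C = draw D"
  shows "C \<subseteq> D"
proof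
  fix e assume e: "e \<in> C"
  then obtain u v where uv: "e = {u, v}" "adj u v"
    using is_cycle_subset_edges[OF assms(1)] by (auto simp: edges_def)
  show "e \<in> D"
  proof (rule ccontr)
    assume "e \<notin> D"
    then have "draw {e} \<inter> draw D \<subseteq> f ` (\<Union> {e} \<inter> \<Union> D)"
      by (intro draw_Int) auto
    also have "\<dots> \<subseteq> {f u, f v}" using uv by auto
    finally have "path_image (\<gamma> u v) \<inter> draw D \<subseteq> {f u, f v}" using uv draw_edge by simp
    moreover have "path_image (\<gamma> u v) \<subseteq> draw D"
      using draw_mono[of "{e}" C] e uv draw_edge assms(3) by simp
    ultimately show False
      using nonempty_simple_path_endless[OF arc_imp_simple_path[OF arc[OF uv(2)]]] ends[OF uv(2)] by auto
  qed
qed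

section \<open>Faces as cycles without inner ears\<close>

definition inner_ear :: "'a set set \<Rightarrow> 'a list \<Rightarrow> bool" where
  "inner_ear C p \<longleftrightarrow> gpath adj p \<and> 2 \<le> length p \<and> hd p \<in> \<Union> C \<and> last p \<in> \<Union> C \<and>
     draw (ed p) - {f (hd p), f (last p)} \<subseteq> inside (draw C)"

text \<open>The inside of a face may contain parts of the drawing that meet the face in at most one vertex.\<close>

definition face :: "'a set set \<Rightarrow> bool" where
  "face C \<longleftrightarrow> is_cycle adj C \<and> (\<nexists>p. inner_ear C p)"

text \<open>The ends of the ear cut \<open>C\<close> into two paths. Each of them together with the
  ear is a cycle, and in the symmetric difference of these cycles the ear cancels.\<close>

lemma split_at_inner_ear:
  assumes C: "is_cycle adj C" and p: "inner_ear C p"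
  shows "\<exists>C1 C2. is_cycle adj C1 \<and> is_cycle adj C2 \<and> inside (draw C1) \<subset> inside (draw C) \<and>
     inside (draw C2) \<subset> inside (draw C) \<and> C = sym_diff C1 C2"
proof -
  define a where "a = hd p"
  define b where "b = last p"
  have gp: "gpath adj p" "2 \<le> length p" "a \<in> \<Union> C" "b \<in> \<Union> C"
    and ins: "draw (ed p) - {f a, f b} \<subseteq> inside (draw C)"
    using p by (auto simp: inner_ear_def a_def b_def)
  have ab: "a \<noteq> b" using hd_neq_last gp by (auto simp: gpath_def a_def b_def)
  have CE: "C \<subseteq> edges adj" using is_cycle_subset_edges[OF C] .
  obtain q r where qr: "gpath adj q" "gpath adj r" "hd q = a" "last q = b" "hd r = a" "last r = b"
    "2 \<le> length q" "2 \<le> length r" "set q \<inter> set r = {a, b}" "C = ed q \<union> ed r" "ed q \<inter> ed r = {}"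
    "\<Union> C = set q \<union> set r"
    by (rule cycle_split[OF graphD(6) C gp(3,4) ab])
  obtain g where g: "arc g" "pathstart g = f (hd p)" "pathfinish g = f (last p)" "path_image g = draw (ed p)"
    by (rule gpath_arc[OF gp(1,2)])
  obtain gq where gq: "arc gq" "pathstart gq = f (hd q)" "pathfinish gq = f (last q)" "path_image gq = draw (ed q)"
    by (rule gpath_arc[OF qr(1,7)])
  obtain gr where gr: "arc gr" "pathstart gr = f (hd r)" "pathfinish gr = f (last r)" "path_image gr = draw (ed r)"
    by (rule gpath_arc[OF qr(2,8)])
  have meet: "path_image gq \<inter> path_image gr = {f a, f b}"
    using draw_paths_Int[OF qr(1,2,7,8,11)] qr(9) gq gr by simp
  have dC: "draw C = path_image gq \<union> path_image gr"
    using qr(10) gq gr draw_Un by simp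
  have int: "set p \<inter> \<Union> C = {a, b}"
  proof
    show "set p \<inter> \<Union> C \<subseteq> {a, b}"
    proof
      fix w assume w: "w \<in> set p \<inter> \<Union> C"
      then have wV: "w \<in> V" using edges_vertices[OF CE] by blast
      have abV: "a \<in> V" "b \<in> V" using edges_vertices[OF CE] gp(3,4) by auto
      have "f w \<in> draw C" using vertex_in_draw[OF CE wV] w by blast
      moreover have "f w \<in> draw (ed p)"
        using vertex_in_draw[OF ed_subset_edges[OF gp(1)] wV] Union_ed[OF gp(2)] w by blast
      ultimately have "f w \<in> {f a, f b}" using ins cycle_Jordan(6)[OF C] by blast
      then show "w \<in> {a, b}" using inj wV abV by (auto dest: inj_onD)
    qed
    have "p \<noteq> []" using gp(2) by auto
    then show "{a, b} \<subseteq> set p \<inter> \<Union> C" using gp(3,4) by (auto simp: a_def b_def)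
  qed
  \<comment> \<open>Stated for an arbitrary half of \<open>C\<close>, since both halves need
    it.\<close>
  have part: "is_cycle adj (ed q \<union> ed p) \<and> ed q \<inter> ed p = {} \<and> inside (draw (ed q \<union> ed p)) \<subset> inside (draw C)"
    if qr: "gpath adj q" "hd q = a" "last q = b" "2 \<le> length q" "set q \<subseteq> \<Union> C" "ed q \<subseteq> C"
      and gq: "arc gq" "pathstart gq = f (hd q)" "pathfinish gq = f (last q)" "path_image gq = draw (ed q)"
      and gr: "arc gr" "pathstart gr = f a" "pathfinish gr = f b"
        "path_image gq \<inter> path_image gr = {f a, f b}" "draw C = path_image gq \<union> path_image gr"
    for q gq gr
  proof -
    have ne: "q \<noteq> []" "p \<noteq> []" using qr gp by auto
    then have sets: "set q \<inter> set p = {a, b}"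
      using int qr hd_in_set[OF ne(1)] last_in_set[OF ne(1)] by blast
    \<comment> \<open>If both paths were single edges, the ear would be the edge
      \<open>{a, b}\<close> of \<open>C\<close> itself, which is drawn on \<open>C\<close> and not
      inside it.\<close>
    have "3 \<le> length q \<or> 3 \<le> length p"
    proof (rule ccontr)
      assume "\<not> ?thesis"
      then have "length q = 2" "length p = 2" using qr gp by auto
      then have "q = [a, b]" "p = [a, b]"
        using qr(2,3) a_def b_def by (auto simp: length_Suc_conv numeral_2_eq_2)
      then have "draw (ed p) \<subseteq> draw C" using qr(6) draw_mono by simp
      then have "draw (ed p) \<subseteq> {f a, f b}" using ins cycle_Jordan(6)[OF C] by blast
      then show False
        using nonempty_simple_path_endless[OF arc_imp_simple_path[OF g(1)]] g by (auto simp: a_def b_def)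
    qed
    then have cyc: "is_cycle adj (ed q \<union> ed p) \<and> ed q \<inter> ed p = {}"
    proof
      assume "3 \<le> length q"
      then show ?thesis
        using theta_cycle[OF graphD(6) qr(1) gp(1) qr(2,3) _ _ ab ne sets] by (simp add: a_def b_def)
    next
      assume "3 \<le> length p"
      then have "is_cycle adj (ed p \<union> ed q)" "ed p \<inter> ed q = {}"
        using theta_cycle[OF graphD(6) gp(1) qr(1) _ _ qr(2,3) ab ne(2,1)] sets
        by (simp_all add: a_def b_def Int_commute)
      then show ?thesis by (simp add: Un_commute Int_commute)
    qed
    have "inside (path_image gq \<union> path_image g) \<subset> inside (path_image gq \<union> path_image gr)"
      by (rule inside_theta_subset[OF gq(1) gr(1) g(1), of "f a" "f b"])
        (use gq gr g qr ins in \<open>simp_all add: a_def b_def\<close>)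
    then show ?thesis using cyc gq g gr draw_Un by simp
  qed
  have 1: "is_cycle adj (ed q \<union> ed p) \<and> ed q \<inter> ed p = {} \<and> inside (draw (ed q \<union> ed p)) \<subset> inside (draw C)"
    by (rule part[OF qr(1,3,4,7) _ _ gq gr(1)]) (use qr gr meet dC in auto)
  have 2: "is_cycle adj (ed r \<union> ed p) \<and> ed r \<inter> ed p = {} \<and> inside (draw (ed r \<union> ed p)) \<subset> inside (draw C)"
    by (rule part[OF qr(2,5,6,8) _ _ gr gq(1)]) (use qr gq meet dC in auto)
  have "C = sym_diff (ed q \<union> ed p) (ed r \<union> ed p)" using 1 2 qr(10,11) by blast
  then show ?thesis using 1 2 by blast
qed

text \<open>The number of cycles with a strictly smaller inside is a finite stand-in for the size of
  the inside. It drops for both cycles obtained from an ear, and a sum of two sums of faces is again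
  one by \<open>parity_sum_sym_diff\<close>.\<close>

lemma cycle_is_parity_sum_of_faces:
  "is_cycle adj C \<Longrightarrow> \<exists>T\<subseteq>{D. face D}. C = parity_sum T"
proof (induction "card {D. is_cycle adj D \<and> inside (draw D) \<subset> inside (draw C)}" arbitrary: C rule: less_induct)
  case less
  have "{D. is_cycle adj D} \<subseteq> Pow (edges adj)" using is_cycle_subset_edges by blast
  then have fin: "finite {D. is_cycle adj D}"
    using finite_edges[OF graph] finite_Pow_iff finite_subset by fast
  show ?case
  proof (cases "face C")
    case True
    have "C = parity_sum {C}"
      by (auto simp: parity_sum_def Collect_conv_if)
    then show ?thesis using True by blast
  next
    case False
    then obtain p where "inner_ear C p" using less.prems by (auto simp: face_def)
    then obtain C1 C2 where C12: "is_cycle adj C1" "is_cycle adj C2" "inside (draw C1) \<subset> inside (draw C)"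
      "inside (draw C2) \<subset> inside (draw C)" "C = sym_diff C1 C2"
      using split_at_inner_ear less.prems by blast
    have dec: "\<exists>T\<subseteq>{D. face D}. D = parity_sum T"
      if D: "is_cycle adj D" "inside (draw D) \<subset> inside (draw C)" for D
    proof (rule less.hyps[OF _ D(1)])
      show "card {E. is_cycle adj E \<and> inside (draw E) \<subset> inside (draw D)}
          < card {E. is_cycle adj E \<and> inside (draw E) \<subset> inside (draw C)}"
        using D by (intro psubset_card_mono finite_subset[OF _ fin]) auto
    qed
    obtain T1 where T1: "T1 \<subseteq> {D. face D}" "C1 = parity_sum T1" using dec[OF C12(1,3)] by blast
    obtain T2 where T2: "T2 \<subseteq> {D. face D}" "C2 = parity_sum T2" using dec[OF C12(2,4)] by blast
    have "T1 \<subseteq> {D. is_cycle adj D}" "T2 \<subseteq> {D. is_cycle adj D}"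
      using T1(1) T2(1) by (auto simp: face_def)
    then have "finite T1" "finite T2" using fin finite_subset by auto
    then have "C = parity_sum (sym_diff T1 T2)"
      using parity_sum_sym_diff[of T1 T2] T1 T2 C12(5) by simp
    then show ?thesis using T1 T2 by (intro exI[of _ "sym_diff T1 T2"]) auto
  qed
qed

lemma card_faces:
  assumes "V \<noteq> {}"
  shows "card (edges adj) + 1 \<le> card {D. face D} + card V"
  by (rule card_cycle_generators[OF graph assms _ cycle_is_parity_sum_of_faces])
    (auto simp: face_def dest: is_cycle_subset_edges)

text \<open>The path is cut wherever it returns to \<open>D\<close>, and some piece still enters the
  inside. A piece that meets \<open>D\<close> only at its ends is, without these ends, a connected
  set off \<open>draw D\<close>, so all of it lies inside.\<close>

lemma inner_ear_of_path:
  assumes D: "is_cycle adj D" and "gpath adj p" "2 \<le> length p" "hd p \<in> \<Union> D" "last p \<in> \<Union> D"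
    "draw (ed p) \<inter> inside (draw D) \<noteq> {}"
  shows "\<exists>q. inner_ear D q"
  using assms(2-)
proof (induction "length p" arbitrary: p rule: less_induct)
  case less
  note p = less.prems
  have DE: "D \<subseteq> edges adj" using is_cycle_subset_edges[OF D] .
  show ?case
  proof (cases "\<exists>xs y ys. p = xs @ y # ys \<and> xs \<noteq> [] \<and> ys \<noteq> [] \<and> y \<in> \<Union> D")
    case True
    then obtain xs y ys where y: "p = xs @ y # ys" "xs \<noteq> []" "ys \<noteq> []" "y \<in> \<Union> D" by blast
    have "draw (ed p) = draw (ed (xs @ [y])) \<union> draw (ed (y # ys))"
      using y(1) ed_append_shared draw_Un by metis
    then consider "draw (ed (xs @ [y])) \<inter> inside (draw D) \<noteq> {}" | "draw (ed (y # ys)) \<inter> inside (draw D) \<noteq> {}"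
      using p(5) by blast
    then show ?thesis
    proof cases
      case 1
      show ?thesis
        by (rule less.hyps[of "xs @ [y]"])
          (use p y 1 in \<open>auto simp: gpath_append gpath_Cons hd_append Suc_le_eq\<close>)
    next
      case 2
      show ?thesis
        by (rule less.hyps[of "y # ys"])
          (use p y 2 in \<open>auto simp: gpath_append gpath_Cons Suc_le_eq\<close>)
    qed
  next
    case False
    have int: "set p \<inter> \<Union> D \<subseteq> {hd p, last p}"
    proof
      fix y assume y: "y \<in> set p \<inter> \<Union> D"
      then obtain xs ys where xy: "p = xs @ y # ys" by (meson IntD1 split_list)
      then have "xs = [] \<or> ys = []" using False y by blast
      then show "y \<in> {hd p, last p}" using xy by auto
    qed
    \<comment> \<open>A piece that used an edge of \<open>D\<close> would consist of that edge alone
      and would be drawn on \<open>D\<close>, so it could not enter the inside.\<close>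
    have "ed p \<inter> D = {}"
    proof (rule ccontr)
      assume "ed p \<inter> D \<noteq> {}"
      then obtain e where e: "e \<in> ed p" "e \<in> D" by blast
      have "e \<subseteq> {hd p, last p}" using int ed_subset_set[OF e(1)] e(2) by blast
      moreover obtain x y where "e = {x, y}" "x \<noteq> y"
        using ed_distinct[OF _ e(1)] p(1) by (auto simp: gpath_def)
      ultimately have eq: "e = {hd p, last p}" by auto
      then have "p = [hd p, last p]" using ed_endpoints[of p] e p by (cases "p = []") (auto simp: gpath_def)
      then have "ed p = {{hd p, last p}}" by (metis ed.simps(1) ed.simps(3))
      then have "draw (ed p) \<subseteq> draw D" using e eq draw_mono by simp
      then show False using p(5) cycle_Jordan(6)[OF D] by blast
    qed
    then have off: "draw (ed p) \<inter> draw D \<subseteq> {f (hd p), f (last p)}"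
      using draw_Int[of "ed p" D] Union_ed[OF p(2)] int by blast
    obtain g where g: "arc g" "pathstart g = f (hd p)" "pathfinish g = f (last p)" "path_image g = draw (ed p)"
      by (rule gpath_arc[OF p(1,2)])
    let ?S = "draw (ed p) - {f (hd p), f (last p)}"
    have "connected ?S"
      using connected_simple_path_endless[OF arc_imp_simple_path[OF g(1)]] g by simp
    moreover have "?S \<inter> frontier (inside (draw D)) = {}"
      using off cycle_Jordan(5)[OF D] by blast
    moreover have "?S \<inter> inside (draw D) \<noteq> {}"
    proof -
      have "hd p \<in> V" "last p \<in> V" using p(3,4) edges_vertices[OF DE] by auto
      then have "f (hd p) \<in> draw D" "f (last p) \<in> draw D"
        using vertex_in_draw[OF DE] p(3,4) by auto
      then show ?thesis using p(5) cycle_Jordan(6)[OF D] by blast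
    qed
    ultimately have "?S \<subseteq> inside (draw D)"
      using connected_Int_frontier[of ?S "inside (draw D)"] by blast
    then have "inner_ear D p" using p by (auto simp: inner_ear_def)
    then show ?thesis ..
  qed
qed

text \<open>Deleting the common edge from \<open>C\<close> leaves a path with both ends on
  \<open>D\<close>, and if it entered the inside of \<open>D\<close> there would be an inner ear. So
  neither curve enters the inside of the other, and insides that meet must coincide together with
  their frontiers. Without a common edge one face may be nested in another.\<close>

lemma inside_faces_disjoint:
  assumes "face C" "face D" "C \<noteq> D" "e \<in> C" "e \<in> D"
  shows "inside (draw C) \<inter> inside (draw D) = {}"
proof (rule ccontr)
  assume meet: "inside (draw C) \<inter> inside (draw D) \<noteq> {}"
  have off: "draw C \<inter> inside (draw D) = {}"
    if C: "is_cycle adj C" and D: "face D" and e: "e \<in> C" "e \<in> D" for C D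
  proof (rule ccontr)
    assume ne: "draw C \<inter> inside (draw D) \<noteq> {}"
    obtain a b where ab: "e = {a, b}" "adj a b"
      using is_cycle_subset_edges[OF C] e by (auto simp: edges_def)
    obtain p where p: "gpath adj p" "hd p = a" "last p = b" "3 \<le> length p" "C = insert {a, b} (ed p)"
      by (rule cycle_minus_edge[OF graphD(6) C]) (use ab e in blast)
    have cD: "is_cycle adj D" using D by (simp add: face_def)
    have "path_image (\<gamma> a b) \<subseteq> draw D" using draw_edge[OF ab(2)] draw_mono[of "{e}" D] e ab(1) by simp
    then have "draw (ed p) \<inter> inside (draw D) \<noteq> {}"
      using ne cycle_Jordan(6)[OF cD] draw_insert[OF ab(2)] p(5) by blast
    then have "\<exists>q. inner_ear D q"
      by (intro inner_ear_of_path[OF cD p(1)]) (use p e ab in auto)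
    then show False using D by (simp add: face_def)
  qed
  have cC: "is_cycle adj C" and cD: "is_cycle adj D" using assms by (auto simp: face_def)
  have "inside (draw C) \<subseteq> inside (draw D)"
    using connected_Int_frontier[OF cycle_Jordan(3)[OF cC] meet] off[OF cD assms(1,5,4)]
      cycle_Jordan(5)[OF cD] by blast
  moreover have "inside (draw D) \<subseteq> inside (draw C)"
    using connected_Int_frontier[OF cycle_Jordan(3)[OF cD], of "inside (draw C)"] meet
      off[OF cC assms(2,4,5)] cycle_Jordan(5)[OF cC] by blast
  ultimately have "inside (draw C) = inside (draw D)" by (rule subset_antisym)
  then have "frontier (inside (draw C)) = frontier (inside (draw D))" by (rule arg_cong)
  then have "draw C = draw D"
    unfolding cycle_Jordan(5)[OF cC] cycle_Jordan(5)[OF cD] .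
  then show False
    using cycle_draw_inj[OF cC cD] cycle_draw_inj[OF cD cC] assms(3) by (simp add: subset_antisym)
qed

text \<open>Carries \<open>two_sides_of_common_arc\<close> over to graphs: \<open>r\<close> is a
  common part of the two faces, in use a single edge or a corner of two edges, and \<open>p\<close>
  and \<open>q\<close> are the remaining paths.\<close>

lemma two_sides_of_common_path:
  assumes F: "face C" "face D" "C \<noteq> D"
    and r: "gpath adj r" "2 \<le> length r" "hd r = a" "last r = b"
    and p: "gpath adj p" "2 \<le> length p" "hd p = a" "last p = b" "C = ed r \<union> ed p" "set r \<inter> set p = {a, b}"
      "ed r \<inter> ed p = {}"
    and q: "gpath adj q" "2 \<le> length q" "hd q = a" "last q = b" "D = ed r \<union> ed q" "set r \<inter> set q = {a, b}"
      "ed r \<inter> ed q = {}"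
    and U: "open U" "connected U" "U \<inter> draw (ed p) = {}" "U \<inter> draw (ed q) = {}" "U \<inter> draw (ed r) \<noteq> {}"
  shows "U \<subseteq> draw (ed r) \<union> inside (draw C) \<union> inside (draw D)"
proof -
  obtain gr where gr: "arc gr" "pathstart gr = f (hd r)" "pathfinish gr = f (last r)" "path_image gr = draw (ed r)"
    by (rule gpath_arc[OF r(1,2)])
  obtain gp where gp: "arc gp" "pathstart gp = f (hd p)" "pathfinish gp = f (last p)" "path_image gp = draw (ed p)"
    by (rule gpath_arc[OF p(1,2)])
  obtain gq where gq: "arc gq" "pathstart gq = f (hd q)" "pathfinish gq = f (last q)" "path_image gq = draw (ed q)"
    by (rule gpath_arc[OF q(1,2)])
  obtain e where "e \<in> ed r" using r(2) by (cases r rule: ed.cases) auto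
  then have disj: "inside (draw C) \<inter> inside (draw D) = {}"
    using inside_faces_disjoint[OF F, of e] p(5) q(5) by blast
  have "draw C = path_image gr \<union> path_image gp" "draw D = path_image gr \<union> path_image gq"
    using p(5) q(5) gr gp gq draw_Un by auto
  then show ?thesis
    using two_sides_of_common_arc[OF gr(1) gp(1) gq(1), of "f a" "f b" U] gr gp gq r p q U disj
      draw_paths_Int[OF r(1) p(1) r(2) p(2) p(7)] draw_paths_Int[OF r(1) q(1) r(2) q(2) q(7)]
    by simp
qed

lemma closed_draw_path:
  assumes "gpath adj p" "2 \<le> length p"
  shows "closed (draw (ed p))"
  by (rule gpath_arc[OF assms]) (metis arc_imp_path closed_path_image)

text \<open>A small disc around an inner point \<open>z\<close> of the edge is filled by the edge
  and the insides of \<open>C1\<close> and \<open>C2\<close>. The inside of \<open>C3\<close> has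
  \<open>z\<close> on its frontier, so it would have to meet one of these.\<close>

lemma edge_in_two_faces:
  assumes F: "face C1" "face C2" "face C3" and e: "e \<in> C1" "e \<in> C2" "e \<in> C3"
    and ne: "C1 \<noteq> C2" "C1 \<noteq> C3" "C2 \<noteq> C3"
  shows False
proof -
  have cyc: "is_cycle adj C1" "is_cycle adj C2" "is_cycle adj C3" using F by (auto simp: face_def)
  obtain a b where ab: "e = {a, b}" "adj a b"
    using is_cycle_subset_edges[OF cyc(1)] e by (auto simp: edges_def)
  obtain p where p: "gpath adj p" "hd p = a" "last p = b" "3 \<le> length p" "C1 = insert {a, b} (ed p)" "{a, b} \<notin> ed p"
    by (rule cycle_minus_edge[OF graphD(6) cyc(1)]) (use ab e in blast)
  obtain q where q: "gpath adj q" "hd q = a" "last q = b" "3 \<le> length q" "C2 = insert {a, b} (ed q)" "{a, b} \<notin> ed q"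
    by (rule cycle_minus_edge[OF graphD(6) cyc(2)]) (use ab e in blast)
  have r: "gpath adj [a, b]" using ab graphD(4) by (simp add: gpath_Cons)
  obtain z where z: "z \<in> path_image (\<gamma> a b)" "z \<noteq> f a" "z \<noteq> f b"
    using nonempty_simple_path_endless[OF arc_imp_simple_path[OF arc[OF ab(2)]]] ends[OF ab(2)] by auto
  have "p \<noteq> []" "q \<noteq> []" using p(4) q(4) by auto
  then have "a \<in> set p" "b \<in> set p" "a \<in> set q" "b \<in> set q"
    using p(2,3) q(2,3) hd_in_set last_in_set by metis+
  then have sets: "{a, b} \<inter> set p = {a, b}" "{a, b} \<inter> set q = {a, b}" by auto
  have off: "z \<notin> draw (ed p)" "z \<notin> draw (ed q)"
    using draw_paths_Int[OF r p(1)] draw_paths_Int[OF r q(1)] p q z sets draw_edge[OF ab(2)] by auto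
  have "closed (draw (ed p))" "closed (draw (ed q))"
    using closed_draw_path p q by auto
  then have "open (- (draw (ed p) \<union> draw (ed q)))"
    by (intro open_Compl closed_Un)
  then obtain d where d: "d > 0" "ball z d \<subseteq> - (draw (ed p) \<union> draw (ed q))"
    using off by (meson ComplI UnE open_contains_ball)
  have "z \<in> ball z d \<inter> draw (ed [a, b])"
    using d(1) z(1) draw_edge[OF ab(2)] by simp
  then have "ball z d \<inter> draw (ed [a, b]) \<noteq> {}" by blast
  then have sub: "ball z d \<subseteq> draw (ed [a, b]) \<union> inside (draw C1) \<union> inside (draw C2)"
    by (intro two_sides_of_common_path[OF F(1,2) ne(1) r, of a b p q])
      (use p q d sets in auto)
  have "z \<in> draw C3" using draw_mono[of "{e}" C3] e(3) ab draw_edge z by auto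
  then have "z \<in> closure (inside (draw C3))" using cycle_Jordan(5)[OF cyc(3)] unfolding frontier_def by blast
  then obtain w where w: "w \<in> ball z d" "w \<in> inside (draw C3)"
    using d(1) by (metis closure_approachable dist_commute mem_ball)
  have "draw (ed [a, b]) \<subseteq> draw C3" using draw_mono[of "{e}" C3] e(3) ab by simp
  then have "w \<notin> draw (ed [a, b])" using w cycle_Jordan(6)[OF cyc(3)] by blast
  then show False
    using sub w inside_faces_disjoint[OF F(1,3) ne(2) e(1,3)] inside_faces_disjoint[OF F(2,3) ne(3) e(2,3)]
    by blast
qed

text \<open>\<open>U\<close> need not be small: the statement serves both for a disc around
  \<open>f b\<close> and for an unbounded region containing \<open>f b\<close>.\<close>

lemma common_corner_sides:
  assumes F: "face C" "face D" "C \<noteq> D"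
    and corner: "{a, b} \<in> C" "{b, c} \<in> C" "{a, b} \<in> D" "{b, c} \<in> D" "a \<noteq> c"
    and U: "open U" "connected U" "f b \<in> U" "U \<inter> draw {e \<in> edges adj. b \<notin> e} = {}"
  shows "U \<subseteq> draw {{a, b}, {b, c}} \<union> inside (draw C) \<union> inside (draw D)"
proof -
  have cyc: "is_cycle adj C" "is_cycle adj D" using F by (auto simp: face_def)
  obtain p where p: "gpath adj p" "hd p = a" "last p = c" "2 \<le> length p" "b \<notin> set p"
    "C = {{a, b}, {b, c}} \<union> ed p"
    by (rule cycle_minus_corner[OF graphD(6) cyc(1) corner(1,2,5)])
  obtain q where q: "gpath adj q" "hd q = a" "last q = c" "2 \<le> length q" "b \<notin> set q"
    "D = {{a, b}, {b, c}} \<union> ed q"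
    by (rule cycle_minus_corner[OF graphD(6) cyc(2) corner(3,4,5)])
  have adj: "adj a b" "adj b c"
    using is_cycle_subset_edges[OF cyc(1)] corner edge_iff[OF graphD(6)] by blast+
  then have r: "gpath adj [a, b, c]" using corner(5) graphD(4) by (auto simp: gpath_Cons)
  have "p \<noteq> []" "q \<noteq> []" using p(4) q(4) by auto
  then have "a \<in> set p" "c \<in> set p" "a \<in> set q" "c \<in> set q"
    using p(2,3) q(2,3) hd_in_set last_in_set by metis+
  then have sets: "set [a, b, c] \<inter> set p = {a, c}" "set [a, b, c] \<inter> set q = {a, c}"
    using p(5) q(5) by auto
  have off: "ed [a, b, c] \<inter> ed p = {}" "ed [a, b, c] \<inter> ed q = {}"
    using ed_subset_set p(5) q(5) by fastforce+
  have E: "ed p \<subseteq> {e \<in> edges adj. b \<notin> e}" "ed q \<subseteq> {e \<in> edges adj. b \<notin> e}"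
    using ed_subset_edges p q ed_subset_set by blast+
  have "U \<inter> draw (ed p) = {}" using U(4) draw_mono[OF E(1)] by blast
  moreover have "U \<inter> draw (ed q) = {}" using U(4) draw_mono[OF E(2)] by blast
  moreover have "f b \<in> draw (ed [a, b, c])"
    using adj ends(1)[OF adj(2)] pathstart_in_path_image[of "\<gamma> b c"] draw_insert draw_edge by simp
  ultimately have "U \<subseteq> draw (ed [a, b, c]) \<union> inside (draw C) \<union> inside (draw D)"
    using U by (intro two_sides_of_common_path[OF F r, of a c p q]) (use p q sets off in auto)
  then show ?thesis by simp
qed

text \<open>The corner and the two insides together form a bounded set, and they cover
  \<open>U\<close>. A vertex with an unbounded \<open>U\<close> is therefore no shared corner,
  whatever its degree.\<close>

lemma no_common_corner_outer:
  assumes F: "face C" "face D" "C \<noteq> D"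
    and corner: "{a, b} \<in> C" "{b, c} \<in> C" "{a, b} \<in> D" "{b, c} \<in> D" "a \<noteq> c"
    and U: "open U" "connected U" "f b \<in> U" "U \<inter> draw {e \<in> edges adj. b \<notin> e} = {}"
  shows "bounded U"
proof -
  have cyc: "is_cycle adj C" "is_cycle adj D" using F by (auto simp: face_def)
  have "draw {{a, b}, {b, c}} \<subseteq> draw C" using corner draw_mono by simp
  then have "bounded (draw {{a, b}, {b, c}} \<union> inside (draw C) \<union> inside (draw D))"
    using bounded_draw_cycle[OF cyc(1)] cycle_Jordan(4)[OF cyc(1)] cycle_Jordan(4)[OF cyc(2)]
    by (auto intro: bounded_subset)
  then show ?thesis using common_corner_sides[OF assms] bounded_subset by blast
qed

lemma vertex_neighbourhood:
  assumes "b \<in> V"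
  obtains d where "d > 0" "ball (f b) d \<inter> draw {e \<in> edges adj. b \<notin> e} = {}"
proof -
  let ?E = "{e \<in> edges adj. b \<notin> e}"
  have eq: "draw ?E = (\<Union>e\<in>?E. draw {e})" unfolding draw_def by blast
  have cl: "closed (draw {e})" if "e \<in> ?E" for e
  proof -
    obtain u v where "e = {u, v}" "adj u v" using \<open>e \<in> ?E\<close> by (auto simp: edges_def)
    then show ?thesis using draw_edge arc arc_imp_path closed_path_image by metis
  qed
  have "closed (\<Union>e\<in>?E. draw {e})"
    by (rule closed_UN) (use finite_edges[OF graph] cl in auto)
  then have "open (- draw ?E)" unfolding eq by (rule open_Compl)
  moreover have "f b \<notin> draw ?E" using vertex_in_draw[of ?E b] assms by auto
  ultimately show thesis
    using that open_contains_ball_eq[of "- draw ?E" "f b"] by blast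
qed

text \<open>The third edge at \<open>b\<close> must start inside one of the two faces. Continued
  from \<open>x\<close> to \<open>a\<close> in the graph without \<open>b\<close>, it becomes a path
  between two vertices of that face, and such a path contains an inner ear.\<close>

lemma no_common_corner_linked:
  assumes F: "face C" "face D" "C \<noteq> D"
    and corner: "{a, b} \<in> C" "{b, c} \<in> C" "{a, b} \<in> D" "{b, c} \<in> D" "a \<noteq> c"
    and x: "adj b x" "x \<noteq> a" "x \<noteq> c"
    and link: "(\<lambda>u w. adj u w \<and> u \<noteq> b \<and> w \<noteq> b)\<^sup>*\<^sup>* x a"
  shows False
proof -
  have cyc: "is_cycle adj C" "is_cycle adj D" using F by (auto simp: face_def)
  have adj: "adj a b" "adj b c"
    using is_cycle_subset_edges[OF cyc(1)] corner edge_iff[OF graphD(6)] by blast+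
  then have bV: "b \<in> V" using graphD(3) by blast
  obtain d where d: "d > 0" "ball (f b) d \<inter> draw {e \<in> edges adj. b \<notin> e} = {}"
    by (rule vertex_neighbourhood[OF bV])
  have sub: "ball (f b) d \<subseteq> draw {{a, b}, {b, c}} \<union> inside (draw C) \<union> inside (draw D)"
    using common_corner_sides[OF F corner] d by auto
  define R where "R = (\<lambda>u w. adj u w \<and> u \<noteq> b \<and> w \<noteq> b)"
  obtain p where p: "gpath R p" "p \<noteq> []" "hd p = x" "last p = a"
    using reachable_gpath[OF link[folded R_def]] by blast
  \<comment> \<open>Every step of \<open>R\<close> avoids \<open>b\<close> at both ends, and
    \<open>p\<close> has at least one step because \<open>x\<close> is not \<open>a\<close>.\<close>
  have pb: "b \<notin> set p"
  proof
    assume "b \<in> set p"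
    moreover have "length p \<ge> 2" using p x by (cases p rule: ed.cases) auto
    ultimately obtain e where e: "e \<in> ed p" "b \<in> e" using Union_ed by blast
    then show False using ed_subset_edges[OF p(1)] by (auto simp: edges_def R_def)
  qed
  have "gpath adj p"
  proof (rule gpath_restrict[OF graphD(6) p(1)])
    have "edges R \<subseteq> edges adj" by (auto simp: edges_def R_def)
    then show "ed p \<subseteq> edges adj" using ed_subset_edges[OF p(1)] by blast
  qed
  then have gp: "gpath adj (b # p)" using pb p x by (simp add: gpath_Cons)
  have bx: "{b, x} \<in> ed (b # p)" using p ed_Cons[of p b] by simp
  obtain z where z: "z \<in> path_image (\<gamma> b x)" "z \<noteq> f b" "z \<in> ball (f b) d"
  proof -
    have gb: "\<gamma> b x 0 = f b" using ends(1)[OF x(1)] by (simp add: pathstart_def)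
    have "continuous_on {0..1} (\<gamma> b x)" using arc[OF x(1)] by (simp add: arc_def path_def)
    then obtain \<delta> where "\<delta> > 0" and \<delta>: "\<And>t. t \<in> {0..1} \<Longrightarrow> dist t 0 < \<delta> \<Longrightarrow> dist (\<gamma> b x t) (\<gamma> b x 0) < d"
      using d(1) unfolding continuous_on_iff by (metis atLeastAtMost_iff order_refl zero_le_one)
    \<comment> \<open>A small parameter keeps the point within \<open>d\<close> of
      \<open>f b\<close>, and a positive one makes it differ from \<open>f b\<close> by injectivity
      of the arc.\<close>
    define t where "t = min 1 (\<delta> / 2)"
    have t: "t \<in> {0..1}" "t \<noteq> 0" "dist t 0 < \<delta>" using \<open>\<delta> > 0\<close> by (auto simp: t_def)
    have "\<gamma> b x t \<noteq> \<gamma> b x 0" using arc[OF x(1)] t by (auto simp: arc_def dest: inj_onD)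
    then show thesis
      using that[of "\<gamma> b x t"] \<delta>[OF t(1,3)] t(1) gb by (auto simp: path_image_def dist_commute)
  qed
  have "draw {{b, x}} \<inter> draw {{a, b}, {b, c}} \<subseteq> f ` (\<Union> {{b, x}} \<inter> \<Union> {{a, b}, {b, c}})"
    using x by (intro draw_Int) (auto simp: doubleton_eq_iff)
  also have "\<dots> \<subseteq> {f b}" using x by auto
  finally have "z \<notin> draw {{a, b}, {b, c}}" using z draw_edge[OF x(1)] by auto
  then consider "z \<in> inside (draw C)" | "z \<in> inside (draw D)" using sub z by blast
  moreover have "z \<in> draw (ed (b # p))"
    using z(1) draw_edge[OF x(1)] draw_mono[of "{{b, x}}" "ed (b # p)"] bx by auto
  moreover have "2 \<le> length (b # p)" "hd (b # p) = b" "last (b # p) = a"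
    using p by (auto simp: Suc_le_eq)
  moreover have "b \<in> \<Union> C" "a \<in> \<Union> C" "b \<in> \<Union> D" "a \<in> \<Union> D" using corner by blast+
  ultimately have "(\<exists>q. inner_ear C q) \<or> (\<exists>q. inner_ear D q)"
    using inner_ear_of_path[OF cyc(1) gp] inner_ear_of_path[OF cyc(2) gp] by (metis IntI emptyE)
  then show False using F by (simp add: face_def)
qed

end

section \<open>Moving a vertex to the outer region by inversion\<close>

lemma interior_finite_Union_empty:
  fixes \<S> :: "complex set set"
  assumes "finite \<S>" "\<And>S. S \<in> \<S> \<Longrightarrow> closed S \<and> interior S = {}"
  shows "interior (\<Union> \<S>) = {}"
  using assms
proof (induction \<S> rule: finite_induct)
  case (insert S \<S>)
  then show ?case
    using interior_closed_Un_empty_interior[of S "\<Union> \<S>"] by simp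
qed simp

context plane_drawing
begin

text \<open>Invert at a point \<open>c\<close> near \<open>f v\<close> and off the drawing. A disc
  around \<open>f v\<close>, punctured at \<open>c\<close>, becomes an unbounded open set around the
  new position of \<open>v\<close>, and its image still misses every edge not at
  \<open>v\<close>.\<close>

lemma outer_drawing:
  assumes v: "v \<in> V"
  obtains f' \<gamma>' U where "plane_drawing V adj f' \<gamma>'" "open U" "connected U" "\<not> bounded U" "f' v \<in> U"
    "U \<inter> plane_drawing.draw adj \<gamma>' {e \<in> edges adj. v \<notin> e} = {}"
proof -
  let ?E = "{e \<in> edges adj. v \<notin> e}"
  obtain d where d: "d > 0" "ball (f v) d \<inter> draw ?E = {}"
    by (rule vertex_neighbourhood[OF v])
  \<comment> \<open>\<open>K\<close> is the whole drawing, isolated vertices included. A finite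
    union of closed sets without interior points cannot fill a disc, so a centre \<open>c\<close>
    exists.\<close>
  define K where "K = \<Union> ((\<lambda>e. draw {e}) ` edges adj \<union> (\<lambda>u. {f u}) ` V)"
  have "interior K = {}"
    unfolding K_def
  proof (rule interior_finite_Union_empty)
    show "finite ((\<lambda>e. draw {e}) ` edges adj \<union> (\<lambda>u. {f u}) ` V)"
      using finite_edges[OF graph] graphD(1) by simp
    fix S assume "S \<in> (\<lambda>e. draw {e}) ` edges adj \<union> (\<lambda>u. {f u}) ` V"
    then consider x y where "adj x y" "S = path_image (\<gamma> x y)" | u where "S = {f u}"
      using draw_edge by (auto simp: edges_def)
    then show "closed S \<and> interior S = {}"
    proof cases
      case 1
      then show ?thesis
        using interior_arc_image[OF arc] arc_imp_path[OF arc] closed_path_image by blast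
    qed auto
  qed
  then have "\<not> ball (f v) d \<subseteq> K"
    using d(1) interior_maximal[of "ball (f v) d" K] by (metis centre_in_ball empty_iff open_ball subsetD)
  then obtain c where c: "c \<in> ball (f v) d" "c \<notin> K" by blast
  have c_edge: "c \<notin> path_image (\<gamma> x y)" if "adj x y" for x y
    using c(2) draw_edge[OF that] that unfolding K_def edges_def by blast
  have c_vertex: "f u \<noteq> c" if "u \<in> V" for u using c(2) that unfolding K_def by blast
  define h where "h = (\<lambda>z. inverse (z - c))"
  have inj_h: "inj_on h S" for S by (auto simp: h_def inj_on_def)
  have cont_h: "continuous_on S h" if "c \<notin> S" for S
    unfolding h_def using that by (intro continuous_intros) auto
  define f' where "f' = h \<circ> f"
  define \<gamma>' where "\<gamma>' = (\<lambda>u w. h \<circ> \<gamma> u w)"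
  have im: "path_image (\<gamma>' x y) = h ` path_image (\<gamma> x y)" for x y
    by (simp add: \<gamma>'_def path_image_compose)
  have hI: "h ` A \<inter> h ` B = h ` (A \<inter> B)" for A B
    using inj_h[of UNIV] by (simp add: image_Int)
  have pd: "plane_drawing V adj f' \<gamma>'"
  proof
    show "simple_graph V adj" by (rule graph)
    show "inj_on f' V" unfolding f'_def using inj inj_h by (rule comp_inj_on)
    fix x y assume xy: "adj x y"
    have "path (\<gamma>' x y)"
      unfolding \<gamma>'_def using arc_imp_path[OF arc[OF xy]] cont_h[OF c_edge[OF xy]]
      by (rule path_continuous_image)
    moreover have "inj_on (\<gamma>' x y) {0..1}"
      unfolding \<gamma>'_def using arc[OF xy] inj_h by (intro comp_inj_on) (auto simp: arc_def)
    ultimately show "arc (\<gamma>' x y)" by (simp add: arc_def)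
    show "pathstart (\<gamma>' x y) = f' x" "pathfinish (\<gamma>' x y) = f' y"
      using ends[OF xy] by (simp_all add: \<gamma>'_def f'_def pathstart_compose pathfinish_compose)
    show "path_image (\<gamma>' x y) = path_image (\<gamma>' y x)" using sym_image[OF xy] im by simp
    show "path_image (\<gamma>' x y) \<inter> f' ` V = {f' x, f' y}"
      using hI[of "path_image (\<gamma> x y)" "f ` V"] vertices_on_edge[OF xy] im by (simp add: f'_def image_comp)
    fix u w assume uw: "adj u w" and ne: "{x, y} \<noteq> {u, w}"
    show "path_image (\<gamma>' x y) \<inter> path_image (\<gamma>' u w) \<subseteq> f' ` ({x, y} \<inter> {u, w})"
      using image_mono[OF crossing[OF xy uw ne], of h] hI im by (simp add: f'_def image_comp)
  qed
  interpret P: plane_drawing V adj f' \<gamma>' by (rule pd)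
  have draw': "P.draw E = h ` draw E" for E
    unfolding P.draw_def draw_def using im by blast
  define U where "U = h ` (ball (f v) d - {c})"
  have c_draw: "c \<notin> draw E" for E using c_edge unfolding draw_def by blast
  have 1: "connected U"
    unfolding U_def by (intro connected_continuous_image cont_h connected_open_delete) auto
  \<comment> \<open>Since \<open>h\<close> has the inverse \<open>c + inverse w\<close> away from 0,
    its image is also a preimage under a continuous map, from which openness can be read
    off.\<close>
  have 2: "U = (\<lambda>w. c + inverse w) -` ball (f v) d \<inter> (- {0})"
  proof (intro set_eqI iffI)
    fix w assume "w \<in> U"
    then show "w \<in> (\<lambda>w. c + inverse w) -` ball (f v) d \<inter> (- {0})"
      by (auto simp: U_def h_def)
  next
    fix w assume w: "w \<in> (\<lambda>w. c + inverse w) -` ball (f v) d \<inter> (- {0})"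
    have "w = h (c + inverse w)" by (simp add: h_def)
    then show "w \<in> U" using w unfolding U_def by (intro image_eqI[of _ _ "c + inverse w"]) auto
  qed
  have "open ((- {0}) \<inter> (\<lambda>w. c + inverse w) -` ball (f v) d)"
    by (intro continuous_open_preimage continuous_intros) auto
  then have 3: "open U" unfolding 2 by (simp add: Int_commute)
  have 4: "\<not> bounded U"
  proof
    assume "bounded U"
    then obtain M where M: "M > 0" "\<And>w. w \<in> U \<Longrightarrow> norm w \<le> M" using bounded_pos by blast
    obtain r where r: "r > 0" "ball c r \<subseteq> ball (f v) d"
      using c(1) open_ball open_contains_ball by blast
    \<comment> \<open>The point \<open>c + t\<close> is sent to \<open>1/t\<close>, which is at
      least \<open>2 * M\<close> and so violates the bound \<open>M\<close>.\<close>
    define t where "t = min (r / 2) (inverse (2 * M))"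
    have t: "t > 0" "t < r" "t \<le> inverse (2 * M)" using r(1) M(1) by (auto simp: t_def)
    have "c + of_real t \<in> ball c r" using t by (simp add: dist_norm)
    then have "c + of_real t \<in> ball (f v) d - {c}" using r(2) t by auto
    then have "h (c + of_real t) \<in> U" unfolding U_def by (rule imageI)
    then have "inverse t \<le> M" using M(2) t(1) by (force simp: h_def norm_inverse)
    moreover have "2 * M \<le> inverse t" using le_imp_inverse_le[OF t(3,1)] by (simp only: inverse_inverse_eq)
    ultimately show False using M(1) by linarith
  qed
  have 5: "f' v \<in> U" using d(1) c_vertex[OF v] by (auto simp: U_def f'_def)
  have "h ` (ball (f v) d - {c}) \<inter> h ` draw ?E = h ` ((ball (f v) d - {c}) \<inter> draw ?E)" by (rule hI)
  also have "\<dots> = {}" using d(2) by blast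
  finally have 6: "U \<inter> P.draw ?E = {}" unfolding U_def draw' .
  show thesis by (rule that[OF pd 3 1 4 5 6])
qed

end

lemma planar_imp_plane_drawing:
  assumes "simple_graph V adj" "planar V adj"
  obtains f \<gamma> where "plane_drawing V adj f \<gamma>"
  using assms(2) unfolding planar_def
proof (elim exE conjE)
  fix f :: "'a \<Rightarrow> complex" and \<gamma>
  assume "inj_on f V"
    and "\<forall>u v. adj u v \<longrightarrow> arc (\<gamma> u v) \<and> pathstart (\<gamma> u v) = f u \<and> pathfinish (\<gamma> u v) = f v \<and>
        path_image (\<gamma> u v) = path_image (\<gamma> v u) \<and> path_image (\<gamma> u v) \<inter> f ` V = {f u, f v}"
    and "\<forall>u v x y. adj u v \<longrightarrow> adj x y \<longrightarrow> {u, v} \<noteq> {x, y} \<longrightarrow>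
        path_image (\<gamma> u v) \<inter> path_image (\<gamma> x y) \<subseteq> f ` ({u, v} \<inter> {x, y})"
  then have "plane_drawing V adj f \<gamma>"
    unfolding plane_drawing_def using assms(1) by (intro conjI; blast)
  then show thesis by (rule that)
qed

text \<open>Everything that the counting takes from the drawing; no topology occurs afterwards. At a
  vertex of degree at least 3 a third edge and \<open>link\<close> exclude a shared corner. The
  vertex \<open>v\<close> may have no third edge, and there the unbounded region does it.\<close>

lemma planar_faces:
  assumes G: "simple_graph V adj" and "planar V adj" and v: "v \<in> V"
    and link: "\<And>b x y. b \<in> V \<Longrightarrow> x \<in> V - {b} \<Longrightarrow> y \<in> V - {b} \<Longrightarrow>
      (\<lambda>u w. adj u w \<and> u \<noteq> b \<and> w \<noteq> b)\<^sup>*\<^sup>* x y"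
  obtains F where "\<And>C. C \<in> F \<Longrightarrow> is_cycle adj C"
    "card (edges adj) + 1 \<le> card F + card V"
    "\<And>C1 C2 C3 e. \<lbrakk>C1 \<in> F; C2 \<in> F; C3 \<in> F; e \<in> C1; e \<in> C2; e \<in> C3\<rbrakk> \<Longrightarrow> C1 = C2 \<or> C1 = C3 \<or> C2 = C3"
    "\<And>C D a b c. \<lbrakk>C \<in> F; D \<in> F; {a, b} \<in> C; {b, c} \<in> C; {a, b} \<in> D; {b, c} \<in> D; a \<noteq> c;
       b = v \<or> 3 \<le> deg V adj b\<rbrakk> \<Longrightarrow> C = D"
proof -
  obtain f0 \<gamma>0 where "plane_drawing V adj f0 \<gamma>0" by (rule planar_imp_plane_drawing[OF G assms(2)])
  then interpret P0: plane_drawing V adj f0 \<gamma>0 .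
  obtain f \<gamma> U where pd: "plane_drawing V adj f \<gamma>" and U: "open U" "connected U" "\<not> bounded U" "f v \<in> U"
    "U \<inter> plane_drawing.draw adj \<gamma> {e \<in> edges adj. v \<notin> e} = {}"
    by (rule P0.outer_drawing[OF v])
  interpret P: plane_drawing V adj f \<gamma> by (rule pd)
  show thesis
  proof (rule that[of "{C. P.face C}"])
    show "is_cycle adj C" if "C \<in> {C. P.face C}" for C using that by (simp add: P.face_def)
    show "card (edges adj) + 1 \<le> card {C. P.face C} + card V"
      using v by (intro P.card_faces) auto
    show "C1 = C2 \<or> C1 = C3 \<or> C2 = C3"
      if "C1 \<in> {C. P.face C}" "C2 \<in> {C. P.face C}" "C3 \<in> {C. P.face C}" "e \<in> C1" "e \<in> C2" "e \<in> C3"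
      for C1 C2 C3 e using P.edge_in_two_faces[of C1 C2 C3 e] that by blast
    fix C D a b c
    assume CD: "C \<in> {C. P.face C}" "D \<in> {C. P.face C}" "{a, b} \<in> C" "{b, c} \<in> C" "{a, b} \<in> D"
      "{b, c} \<in> D" "a \<noteq> c" and b: "b = v \<or> 3 \<le> deg V adj b"
    show "C = D"
    proof (rule ccontr)
      assume ne: "C \<noteq> D"
      from b show False
      proof
        assume "b = v"
        then show False
          using P.no_common_corner_outer[OF _ _ ne CD(3-7) U(1,2)] CD U(3-5) by simp
      next
        assume deg: "3 \<le> deg V adj b"
        have "is_cycle adj C" using CD(1) by (simp add: P.face_def)
        then have adj: "adj a b" "adj b c"
          using is_cycle_subset_edges CD(3,4) edge_iff[OF P.graphD(6)] by blast+
        have "\<not> {u \<in> V. adj b u} \<subseteq> {a, c}"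
          using deg card_mono[of "{a, c}" "{u \<in> V. adj b u}"] CD(7) unfolding deg_def by auto
        then obtain x where x: "x \<in> V" "adj b x" "x \<noteq> a" "x \<noteq> c" by blast
        have "(\<lambda>u w. adj u w \<and> u \<noteq> b \<and> w \<noteq> b)\<^sup>*\<^sup>* x a"
          using link[of b x a] x adj P.graphD(2,3,4)[OF adj(1)] P.graphD(4)[OF x(2)] by blast
        then show False
          using P.no_common_corner_linked[OF _ _ ne CD(3-7) x(2-4)] CD by simp
      qed
    qed
  qed
qed

section \<open>Short faces\<close>

lemma has_cycle_listI:
  assumes "simple_graph V adj" "distinct p" "3 \<le> length p" "successively adj p" "adj (last p) (hd p)"
  shows "has_cycle V adj (length p)"
proof -
  let ?C = "insert {last p, hd p} (ed p)"
  have p: "gpath adj p" using assms(2,4) by (simp add: gpath_def)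
  then have "is_cycle adj ?C" unfolding is_cycle_def using assms(3,5) by blast
  then show ?thesis
    using card_cycle_has_cycle[OF assms(1)] cycle_closed_list(1)[OF p assms(3)] by metis
qed

lemma card_le_2_if_no_three:
  assumes "\<And>x y z. x \<in> A \<Longrightarrow> y \<in> A \<Longrightarrow> z \<in> A \<Longrightarrow> x = y \<or> x = z \<or> y = z"
  shows "card A \<le> 2"
proof (rule ccontr)
  assume "\<not> card A \<le> 2"
  then obtain B where B: "B \<subseteq> A" "card B = 3" "finite B"
    using obtain_subset_with_card_n[of 3 A] by auto
  then obtain x y z where "B = {x, y, z}" "x \<noteq> y" "x \<noteq> z" "y \<noteq> z" by (auto simp: card_3_iff)
  then show False using assms[of x y z] B(1) by auto
qed

lemma deg_eq_card_edges:
  assumes "simple_graph V adj"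
  shows "deg V adj v = card {e \<in> edges adj. v \<in> e}"
proof -
  note D = simple_graphD[OF assms]
  have "{e \<in> edges adj. v \<in> e} = (\<lambda>u. {v, u}) ` {u \<in> V. adj v u}"
    using D(2-5) by (auto simp: edges_def insert_commute)
  moreover have "inj_on (\<lambda>u. {v, u}) {u \<in> V. adj v u}"
    by (auto simp: inj_on_def doubleton_eq_iff)
  ultimately show ?thesis unfolding deg_def by (simp add: card_image)
qed

lemma sum_deg:
  assumes G: "simple_graph V adj"
  shows "(\<Sum>v\<in>V. deg V adj v) = 2 * card (edges adj)"
proof -
  have "(\<Sum>v\<in>V. deg V adj v) = (\<Sum>v\<in>V. \<Sum>e | e \<in> edges adj \<and> v \<in> e. 1)"
    by (simp add: deg_eq_card_edges[OF G])
  also have "\<dots> = (\<Sum>e\<in>edges adj. \<Sum>v | v \<in> V \<and> v \<in> e. 1)"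
    by (rule sum.swap_restrict) (use simple_graphD(1)[OF G] finite_edges[OF G] in auto)
  also have "\<dots> = (\<Sum>e\<in>edges adj. 2)"
  proof (rule sum.cong)
    fix e assume "e \<in> edges adj"
    then obtain u v where uv: "e = {u, v}" "adj u v" by (auto simp: edges_def)
    then have "{w. w \<in> V \<and> w \<in> e} = {u, v}" "u \<noteq> v" using simple_graphD[OF G] by auto
    then show "(\<Sum>v | v \<in> V \<and> v \<in> e. 1) = (2::nat)" by simp
  qed simp
  finally show ?thesis by simp
qed

definition triangle :: "'a \<Rightarrow> 'a \<Rightarrow> 'a \<Rightarrow> 'a set set" where
  "triangle x y z = {{x, y}, {x, z}, {y, z}}"

lemma triangle_rotate: "triangle x y z = triangle y x z" "triangle x y z = triangle x z y"
  by (auto simp: triangle_def insert_commute)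

lemma triangle_inject:
  assumes "triangle v x y = triangle v x' y'" "v \<noteq> x" "v \<noteq> y" "x \<noteq> y" "v \<noteq> x'" "v \<noteq> y'" "x' \<noteq> y'"
  shows "x = x' \<and> y = y' \<or> x = y' \<and> y = x'"
proof -
  have "{v, x} \<in> triangle v x y" "{v, y} \<in> triangle v x y" by (auto simp: triangle_def)
  then have "{v, x} \<in> triangle v x' y'" "{v, y} \<in> triangle v x' y'" unfolding assms(1) .
  then show ?thesis using assms(2-) by (auto simp: triangle_def doubleton_eq_iff)
qed

lemma card_triangle: "distinct [v, x, y] \<Longrightarrow> card (triangle v x y) = 3"
  by (auto simp: triangle_def card_insert_if doubleton_eq_iff)

text \<open>\<open>D\<close> is the degree in the whole graph, of which \<open>V\<close> is the vertex set of an end block with cut vertex \<open>v0\<close>.\<close>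

locale face_family =
  fixes V :: "'a set" and adj :: "'a \<Rightarrow> 'a \<Rightarrow> bool" and F :: "'a set set set" and v0 :: 'a and D :: "'a \<Rightarrow> nat"
  assumes graph: "simple_graph V adj"
    and face_cycle: "C \<in> F \<Longrightarrow> is_cycle adj C"
    and card_faces: "card (edges adj) + 1 \<le> card F + card V"
    and two_faces: "\<lbrakk>C1 \<in> F; C2 \<in> F; C3 \<in> F; e \<in> C1; e \<in> C2; e \<in> C3\<rbrakk> \<Longrightarrow> C1 = C2 \<or> C1 = C3 \<or> C2 = C3"
    and corner: "\<lbrakk>C1 \<in> F; C2 \<in> F; {a, b} \<in> C1; {b, c} \<in> C1; {a, b} \<in> C2; {b, c} \<in> C2; a \<noteq> c\<rbrakk> \<Longrightarrow> C1 = C2"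
    and D_eq: "v \<in> V \<Longrightarrow> v \<noteq> v0 \<Longrightarrow> D v = deg V adj v"
    and D_ge_3: "v \<in> V \<Longrightarrow> 3 \<le> D v"
    and v0: "v0 \<in> V" "deg V adj v0 \<ge> 1"
    and no_K4: "\<not> has_K4 V adj"
    and no_C: "\<not> has_cycle V adj 5" "\<not> has_cycle V adj 6" "\<not> has_cycle V adj 7"
    and no_D2: "tri V adj x y z \<Longrightarrow> D x = 3 \<Longrightarrow> D y = 3 \<Longrightarrow> 5 \<le> D z"
    and no_D3: "dia V adj w p q r \<Longrightarrow> dia V adj w p' q' r' \<Longrightarrow> D w = 6 \<Longrightarrow> D p = 3 \<Longrightarrow> D q = 4 \<Longrightarrow> D r = 3 \<Longrightarrow>
      D p' = 3 \<Longrightarrow> D q' = 4 \<Longrightarrow> D r' = 4 \<Longrightarrow> {p, q, r} \<inter> {p', q', r'} = {} \<Longrightarrow> False"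
    and no_D4: "dia V adj x y a b \<Longrightarrow> D x = 3 \<Longrightarrow> D y = 3 \<Longrightarrow> 4 \<le> D a \<Longrightarrow> 4 \<le> D b \<Longrightarrow> False"
    and no_D6: "dia V adj x y a b \<Longrightarrow> D x = 4 \<Longrightarrow> D y = 3 \<Longrightarrow> D a = 4 \<Longrightarrow> D b = 4 \<Longrightarrow> False"
    and no_D7: "dia V adj x y a b \<Longrightarrow> D x = 5 \<Longrightarrow> D y = 3 \<Longrightarrow> D a = 4 \<Longrightarrow> D b = 4 \<Longrightarrow>
      z \<notin> {x, y, a, b} \<Longrightarrow> D z = 3 \<Longrightarrow> adj x z \<Longrightarrow> False"
    and no_D9: "adj u v \<Longrightarrow> adj v w \<Longrightarrow> u \<noteq> w \<Longrightarrow> D u = 3 \<Longrightarrow> D v = 3 \<Longrightarrow> D w = 3 \<Longrightarrow> adj u w"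
    and no_D10: "dia V adj x y a b \<Longrightarrow> D x = 5 \<Longrightarrow> D y = 3 \<Longrightarrow> D a = 4 \<Longrightarrow> D b = 3 \<Longrightarrow> False"
    and no_D11: "tri V adj x y z \<Longrightarrow> D x = 5 \<Longrightarrow> D y = 3 \<Longrightarrow> D z = 3 \<Longrightarrow> u \<notin> {x, y, z} \<Longrightarrow> D u = 3 \<Longrightarrow>
      adj x u \<Longrightarrow> False"
    and no_D12: "tri V adj x y z \<Longrightarrow> tri V adj x y' z' \<Longrightarrow> D x = 6 \<Longrightarrow> D y = 3 \<Longrightarrow> D z = 3 \<Longrightarrow>
      D y' = 3 \<Longrightarrow> D z' = 3 \<Longrightarrow> {y, z} \<inter> {y', z'} = {} \<Longrightarrow> False"
begin

lemmas graphD = simple_graphD[OF graph]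

lemma adj_sym: "adj x y \<longleftrightarrow> adj y x" using graphD(5) by blast

lemma finite_F: "finite F"
proof -
  have "F \<subseteq> Pow (edges adj)" using face_cycle is_cycle_subset_edges by blast
  then show ?thesis by (rule finite_subset) (simp add: finite_edges[OF graph])
qed

lemma face_edge:
  assumes "C \<in> F" "{x, y} \<in> C" shows "adj x y"
proof -
  have "{x, y} \<in> edges adj" using is_cycle_subset_edges[OF face_cycle[OF assms(1)]] assms(2) by blast
  then show ?thesis by (simp add: edge_iff[OF graphD(6)])
qed

lemma card_face_cases:
  assumes "C \<in> F" shows "card C = 3 \<or> card C = 4 \<or> 8 \<le> card C"
proof -
  have "has_cycle V adj (card C)" "3 \<le> card C"
    using card_cycle_has_cycle[OF graph] card_cycle_ge_3 face_cycle[OF assms] by auto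
  then have "card C \<noteq> 5" "card C \<noteq> 6" "card C \<noteq> 7" using no_C by metis+
  then show ?thesis using \<open>3 \<le> card C\<close> by linarith
qed

lemma no_closed_5: "distinct [a, b, c, d, e] \<Longrightarrow> adj a b \<Longrightarrow> adj b c \<Longrightarrow> adj c d \<Longrightarrow> adj d e \<Longrightarrow> adj e a \<Longrightarrow> False"
  using has_cycle_listI[OF graph, of "[a, b, c, d, e]"] no_C(1) by (simp add: eval_nat_numeral)

lemma no_closed_6: "distinct [a, b, c, d, e, f] \<Longrightarrow> adj a b \<Longrightarrow> adj b c \<Longrightarrow> adj c d \<Longrightarrow> adj d e \<Longrightarrow> adj e f \<Longrightarrow>
    adj f a \<Longrightarrow> False"
  using has_cycle_listI[OF graph, of "[a, b, c, d, e, f]"] no_C(2) by (simp add: eval_nat_numeral)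

lemma no_K4':
  assumes "adj a b" "adj a c" "adj a d" "adj b c" "adj b d" "adj c d"
  shows False
proof -
  have "has_K4 V adj"
    unfolding has_K4_def
    using assms graphD(2)[OF assms(1)] graphD(2)[OF assms(4)] graphD(2)[OF assms(6)] graphD(3)[OF assms(6)]
    by (intro exI[of _ a] exI[of _ b] exI[of _ c] exI[of _ d] conjI)
  then show ?thesis using no_K4 by simp
qed

lemma triangle_face:
  assumes "C \<in> F" "card C = 3" "{v, x} \<in> C"
  obtains y where "C = triangle v x y" "distinct [v, x, y]" "adj v x" "adj v y" "adj x y"
proof -
  obtain p where p: "gpath adj p" "hd p = v" "last p = x" "3 \<le> length p" "C = insert {v, x} (ed p)"
    "{v, x} \<notin> ed p"
    by (rule cycle_minus_edge[OF graphD(6) face_cycle[OF assms(1)] assms(3)])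
  have "card (ed p) = 2" using assms(2) p(5,6) by simp
  then have "length p = 3" using card_ed[of p] p(1) by (simp add: gpath_def)
  then obtain y where y: "p = [v, y, x]" using p(2,3) by (auto simp: length_Suc_conv numeral_3_eq_3)
  show thesis
    by (rule that[of y])
      (use p y adj_sym face_edge[OF assms(1,3)] in \<open>auto simp: triangle_def insert_commute gpath_def\<close>)
qed

lemma quad_face:
  assumes "C \<in> F" "card C = 4" "{v, x} \<in> C"
  obtains y z where "C = {{v, x}, {x, y}, {y, z}, {z, v}}" "distinct [v, x, y, z]"
    "adj v x" "adj x y" "adj y z" "adj z v"
proof -
  obtain p where p: "gpath adj p" "hd p = v" "last p = x" "3 \<le> length p" "C = insert {v, x} (ed p)"
    "{v, x} \<notin> ed p"
    by (rule cycle_minus_edge[OF graphD(6) face_cycle[OF assms(1)] assms(3)])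
  have "card (ed p) = 3" using assms(2) p(5,6) by simp
  then have "length p = 4" using card_ed[of p] p(1) by (simp add: gpath_def)
  then obtain y z where y: "p = [v, z, y, x]" using p(2,3) by (auto simp: length_Suc_conv eval_nat_numeral)
  show thesis
    by (rule that[of y z])
      (use p y adj_sym face_edge[OF assms(1,3)] in \<open>auto simp: insert_commute gpath_def\<close>)
qed

text \<open>By \<open>corner\<close> the third vertex of the triangle is not on the quadrilateral.
  Replacing the common edge by the detour through this vertex turns the 4-cycle into a
  5-cycle.\<close>

lemma triangle_quad_no_common_edge:
  assumes "C \<in> F" "card C = 3" "C' \<in> F" "card C' = 4" "{v, x} \<in> C" "{v, x} \<in> C'"
  shows False
proof -
  obtain y where y: "C = triangle v x y" "distinct [v, x, y]" "adj v x" "adj v y" "adj x y"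
    by (rule triangle_face[OF assms(1,2,5)])
  obtain c d where cd: "C' = {{v, x}, {x, c}, {c, d}, {d, v}}" "distinct [v, x, c, d]"
    "adj v x" "adj x c" "adj c d" "adj d v"
    by (rule quad_face[OF assms(3,4,6)])
  have ne: "C \<noteq> C'" using assms by auto
  have xv: "{x, v} \<in> C" "{x, v} \<in> C'" using assms(5,6) by (simp_all add: insert_commute)
  have C: "{x, y} \<in> C" "{v, y} \<in> C" unfolding y(1) by (simp_all add: triangle_def)
  have C': "{x, c} \<in> C'" "{v, d} \<in> C'" unfolding cd(1) by (simp_all add: insert_commute[of v d])
  have "y \<noteq> c" using corner[OF assms(1,3,5) C(1) assms(6)] C'(1) y(2) ne by auto
  moreover have "y \<noteq> d" using corner[OF assms(1,3) xv(1) C(2) xv(2)] C'(2) y(2) ne by auto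
  ultimately show False
    using no_closed_5[of v y x c d] y cd adj_sym by auto
qed

text \<open>Let the cycles run through \<open>v, x, c, d\<close> and \<open>v, x, e, f\<close>. Then
  \<open>corner\<close> gives \<open>e \<noteq> c\<close> and \<open>f \<noteq> d\<close>. Of the
  crossed coincidences \<open>e = d\<close> and \<open>f = c\<close>, both together give a K4,
  exactly one gives a 5-cycle, and none gives a 6-cycle.\<close>

lemma quads_no_common_edge:
  assumes "C \<in> F" "card C = 4" "C' \<in> F" "card C' = 4" "{v, x} \<in> C" "{v, x} \<in> C'" "C \<noteq> C'"
  shows False
proof -
  obtain c d where cd: "C = {{v, x}, {x, c}, {c, d}, {d, v}}" "distinct [v, x, c, d]"
    "adj v x" "adj x c" "adj c d" "adj d v"
    by (rule quad_face[OF assms(1,2,5)])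
  obtain e f where ef: "C' = {{v, x}, {x, e}, {e, f}, {f, v}}" "distinct [v, x, e, f]"
    "adj v x" "adj x e" "adj e f" "adj f v"
    by (rule quad_face[OF assms(3,4,6)])
  have xv: "{x, v} \<in> C" "{x, v} \<in> C'" using assms(5,6) by (simp_all add: insert_commute)
  have C: "{x, c} \<in> C" "{v, d} \<in> C" unfolding cd(1) by (simp_all add: insert_commute[of v d])
  have C': "{x, e} \<in> C'" "{v, f} \<in> C'" unfolding ef(1) by (simp_all add: insert_commute[of v f])
  have "e \<noteq> c" using corner[OF assms(1,3,5) C(1) assms(6)] C'(1) cd(2) assms(7) by auto
  moreover have "f \<noteq> d" using corner[OF assms(1,3) xv(1) C(2) xv(2)] C'(2) cd(2) assms(7) by auto
  moreover have "e \<noteq> d \<or> f \<noteq> c"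
    using no_K4'[of v x c d] cd ef adj_sym by auto
  moreover have "e \<noteq> d" if "f \<noteq> c"
    using no_closed_5[of v f d c x] that cd ef \<open>f \<noteq> d\<close> adj_sym by auto
  moreover have "f \<noteq> c" if "e \<noteq> d"
    using no_closed_5[of x e c d v] that cd ef \<open>e \<noteq> c\<close> adj_sym by auto
  ultimately have "distinct [x, c, d, v, f, e]" using cd(2) ef(2) by auto
  then show False using no_closed_6[of x c d v f e] cd ef adj_sym by auto
qed

lemma small_faces_common_edge:
  assumes "C \<in> F" "C' \<in> F" "card C \<le> 4" "card C' \<le> 4" "C \<noteq> C'" "{v, x} \<in> C" "{v, x} \<in> C'"
  obtains y z where "C = triangle v x y" "C' = triangle v x z" "distinct [v, x, y, z]"
    "adj v x" "adj v y" "adj x y" "adj v z" "adj x z"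
proof -
  have "card C \<in> {3, 4}" "card C' \<in> {3, 4}"
    using card_face_cases assms by force+
  then have "card C = 3" "card C' = 3"
    using triangle_quad_no_common_edge[OF assms(1) _ assms(2) _ assms(6,7)]
      triangle_quad_no_common_edge[OF assms(2) _ assms(1) _ assms(7,6)]
      quads_no_common_edge[OF assms(1) _ assms(2) _ assms(6,7,5)] by auto
  obtain y where y: "C = triangle v x y" "distinct [v, x, y]" "adj v x" "adj v y" "adj x y"
    by (rule triangle_face[OF assms(1) \<open>card C = 3\<close> assms(6)])
  obtain z where z: "C' = triangle v x z" "distinct [v, x, z]" "adj v x" "adj v z" "adj x z"
    by (rule triangle_face[OF assms(2) \<open>card C' = 3\<close> assms(7)])
  show thesis by (rule that[of y z]) (use y z assms(5) in auto)
qed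

text \<open>Another short face on the side edge \<open>{v, y}\<close> would be a triangle with third
  vertex \<open>w\<close>. If \<open>w = z\<close>, the vertices \<open>v x y z\<close> form a K4;
  otherwise \<open>x z v w y\<close> is a 5-cycle.\<close>

lemma diamond_side_edge:
  assumes "triangle v x y \<in> F" "triangle v x z \<in> F" "distinct [v, x, y, z]"
    "adj v x" "adj v y" "adj x y" "adj v z" "adj x z"
    and C: "C \<in> F" "card C \<le> 4" "{v, y} \<in> C"
  shows "C = triangle v x y"
proof (rule ccontr)
  assume ne: "C \<noteq> triangle v x y"
  have "card (triangle v x y) \<le> 4"
    using card_triangle[of v x y] assms(3) by simp
  moreover have "{v, y} \<in> triangle v x y" by (simp add: triangle_def)
  ultimately obtain u w where u: "triangle v x y = triangle v y u" "C = triangle v y w" "distinct [v, y, u, w]"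
    "adj v y" "adj v u" "adj y u" "adj v w" "adj y w"
    using small_faces_common_edge[OF assms(1) C(1) _ C(2) ne[symmetric] _ C(3)] by metis
  have "u = x"
    using triangle_inject[OF u(1)] assms(3) u(3) by auto
  show False
  proof (cases "w = z")
    case True
    then show False using no_K4'[of v x y z] assms u by simp
  next
    case False
    then show False using no_closed_5[of x z v w y] assms u \<open>u = x\<close> adj_sym by auto
  qed
qed

text \<open>By \<open>small_faces_common_edge\<close> such an edge is the middle edge of a diamond
  made of two triangular faces. Only diamonds of this kind enter the discharging.\<close>

definition mid :: "'a set \<Rightarrow> bool" where
  "mid e \<longleftrightarrow> (\<exists>C\<in>F. \<exists>C'\<in>F. C \<noteq> C' \<and> card C \<le> 4 \<and> card C' \<le> 4 \<and> e \<in> C \<and> e \<in> C')"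

lemma mid_other_face:
  assumes "mid e"
  obtains C where "C \<in> F" "C \<noteq> T" "card C \<le> 4" "e \<in> C"
proof -
  obtain A B where AB: "A \<in> F" "B \<in> F" "A \<noteq> B" "card A \<le> 4" "card B \<le> 4" "e \<in> A" "e \<in> B"
    using assms unfolding mid_def by blast
  show thesis
  proof (cases "A = T")
    case True
    then show thesis using AB by (intro that[of B]) auto
  next
    case False
    then show thesis using AB by (intro that[of A]) auto
  qed
qed

lemma mid_diamond:
  assumes "triangle v x y \<in> F" "distinct [v, x, y]" "mid {v, x}"
  obtains z where "triangle v x z \<in> F" "distinct [v, x, y, z]"
    "adj v x" "adj v y" "adj x y" "adj v z" "adj x z" "dia V adj v x y z"
proof -
  have e: "{v, x} \<in> triangle v x y" by (simp add: triangle_def)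
  obtain C where C: "C \<in> F" "C \<noteq> triangle v x y" "card C \<le> 4" "{v, x} \<in> C"
    by (rule mid_other_face[OF assms(3)])
  have c3: "card (triangle v x y) \<le> 4" using card_triangle[OF assms(2)] by simp
  obtain u z where u: "triangle v x y = triangle v x u" "C = triangle v x z" "distinct [v, x, u, z]"
    "adj v x" "adj v u" "adj x u" "adj v z" "adj x z"
    by (rule small_faces_common_edge[OF assms(1) C(1) c3 C(3) C(2)[symmetric] e C(4)])
  have "u = y" using triangle_inject[OF u(1)] assms(2) u(3) by auto
  then show thesis
    using u C(1) graphD(2,3) by (intro that[of z]) (auto simp: dia_def)
qed

text \<open>In the diamond with middle edge \<open>{v, x}\<close> the edge \<open>{v, y}\<close> is
  a side edge, which admits no second short face. Hence the branches of \<open>gift\<close> below do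
  not compete.\<close>

lemma mid_unique:
  assumes "triangle v x y \<in> F" "distinct [v, x, y]" "mid {v, x}"
  shows "\<not> mid {v, y}"
proof
  assume m: "mid {v, y}"
  obtain C where C: "C \<in> F" "C \<noteq> triangle v x y" "card C \<le> 4" "{v, y} \<in> C"
    by (rule mid_other_face[OF m])
  obtain z where "triangle v x z \<in> F" "distinct [v, x, y, z]"
    "adj v x" "adj v y" "adj x y" "adj v z" "adj x z"
    by (rule mid_diamond[OF assms])
  then show False using diamond_side_edge[of v x y z C] assms(1) C by blast
qed

section \<open>Discharging\<close>

text \<open>In a triangle with a 3-vertex \<open>x\<close> on an edge shared with another triangle, \<open>x\<close> takes 1 and the vertex \<open>y\<close>
  off that edge gives 0, 2 or 4 according to its degree; \<open>side_gift y\<close> brings the balance to 4.\<close>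

definition side_gift :: "'a \<Rightarrow> int" where
  "side_gift y = (if D y = 3 then 5 else if D y = 4 then 3 else 1)"

text \<open>The payment of \<open>v\<close> to the triangular face \<open>v x y\<close> on top of
  the flat 2. A 3-vertex pays nothing, or receives 1 if it lies on a middle edge. On a middle edge
  between larger vertices both ends pay 2 and the third vertex nothing. Without a middle edge each
  vertex of degree at least 4 pays 2, or 4 if the other two are 3-vertices.\<close>

definition gift :: "'a \<Rightarrow> 'a \<Rightarrow> 'a \<Rightarrow> int" where
  "gift v x y =
    (if mid {v, x} then if D v = 3 then -1 else if D x = 3 then side_gift y else 2
     else if mid {v, y} then if D v = 3 then -1 else if D y = 3 then side_gift x else 2
     else if D v = 3 then 0
     else if mid {x, y} then if D x = 3 \<or> D y = 3 then if D v = 4 then 2 else 4 else 0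
     else if D x = 3 \<and> D y = 3 then 4 else 2)"

lemma triangle_face_tri:
  assumes "triangle v x y \<in> F" "distinct [v, x, y]"
  shows "tri V adj v x y" "adj v x" "adj v y" "adj x y"
proof -
  show a: "adj v x" "adj v y" "adj x y"
    using face_edge[OF assms(1)] by (simp_all add: triangle_def)
  show "tri V adj v x y"
    unfolding tri_def using a graphD(2)[OF a(1)] graphD(3)[OF a(1)] graphD(3)[OF a(2)] by simp
qed

lemma triangle_no_D2:
  assumes "triangle v x y \<in> F" "distinct [v, x, y]" "D v = 3" "D x = 3"
  shows "5 \<le> D y"
  using no_D2[OF triangle_face_tri(1)[OF assms(1,2)] assms(3,4)] .

lemma gift_commute:
  assumes "triangle v x y \<in> F" "distinct [v, x, y]"
  shows "gift v x y = gift v y x"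
  using mid_unique[OF assms] by (auto simp: gift_def insert_commute)

lemma D_triangle_ge_3:
  assumes "triangle v x y \<in> F" "distinct [v, x, y]"
  shows "3 \<le> D v" "3 \<le> D x" "3 \<le> D y"
  using triangle_face_tri(1)[OF assms] D_ge_3 by (auto simp: tri_def)

text \<open>(D2) forces both side vertices of the diamond to have degree at least 5, and then the
  diamond is (D4).\<close>

lemma no_mid_3_3:
  assumes T: "triangle v x y \<in> F" "distinct [v, x, y]" and "mid {v, x}" "D v = 3" "D x = 3"
  shows False
proof -
  obtain z where z: "triangle v x z \<in> F" "distinct [v, x, y, z]" "dia V adj v x y z"
    by (rule mid_diamond[OF T assms(3)])
  have "5 \<le> D y" "5 \<le> D z"
    using triangle_no_D2[OF T] triangle_no_D2[OF z(1)] z(2) assms by auto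
  then show False using no_D4[OF z(3)] assms by simp
qed

lemma gift_sum_mid:
  assumes T: "triangle v x y \<in> F" "distinct [v, x, y]" and m: "mid {v, x}"
  shows "4 \<le> gift v x y + gift x v y + gift y v x"
proof -
  have T': "triangle x v y \<in> F" "distinct [x, v, y]" using T triangle_rotate(1)[of v x y] by auto
  have m': "mid {x, v}" using m by (simp add: insert_commute)
  have "\<not> mid {v, y}" "\<not> mid {x, y}" using mid_unique[OF T m] mid_unique[OF T' m'] .
  moreover have "\<not> (D v = 3 \<and> D x = 3)" using no_mid_3_3[OF T m] by blast
  ultimately show ?thesis
    using m m' D_triangle_ge_3[OF T] by (auto simp: gift_def side_gift_def insert_commute)
qed

lemma gift_sum_no_mid:
  assumes T: "triangle v x y \<in> F" "distinct [v, x, y]" and m: "\<not> mid {v, x}" "\<not> mid {v, y}" "\<not> mid {x, y}"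
  shows "4 \<le> gift v x y + gift x v y + gift y v x"
proof -
  have m': "\<not> mid {x, v}" "\<not> mid {y, v}" "\<not> mid {y, x}" using m by (simp_all add: insert_commute)
  have "\<not> (D v = 3 \<and> D x = 3 \<and> D y = 3)" using triangle_no_D2[OF T] by auto
  then show ?thesis using m m' by (auto simp: gift_def)
qed

lemma gift_sum:
  assumes T: "triangle v x y \<in> F" "distinct [v, x, y]"
  shows "4 \<le> gift v x y + gift x v y + gift y v x"
proof -
  have T1: "triangle v y x \<in> F" "distinct [v, y, x]" using T triangle_rotate(2)[of v x y] by auto
  have eq: "triangle x y v = triangle v x y" "triangle y v x = triangle v x y"
    by (auto simp: triangle_def)
  have T2: "triangle x y v \<in> F" "distinct [x, y, v]" unfolding eq using T by auto
  have T3: "triangle x v y \<in> F" "distinct [x, v, y]" using T triangle_rotate(1)[of v x y] by auto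
  have T4: "triangle y v x \<in> F" "distinct [y, v, x]" unfolding eq using T by auto
  have "4 \<le> gift v x y + gift x v y + gift y v x" if "mid {v, y}"
    using gift_sum_mid[OF T1 that] gift_commute[OF T] gift_commute[OF T3] gift_commute[OF T4] by simp
  moreover have "4 \<le> gift v x y + gift x v y + gift y v x" if "mid {x, y}"
    using gift_sum_mid[OF T2 that] gift_commute[OF T] gift_commute[OF T3] gift_commute[OF T4] by simp
  ultimately show ?thesis using gift_sum_mid[OF T] gift_sum_no_mid[OF T] by blast
qed

text \<open>\<open>gift\<close> takes the other two vertices in order, whereas the face is a set. By
  \<open>triangle_inject\<close> and \<open>gift_commute\<close> the order does not matter, so the
  description is proper on triangular faces at \<open>v\<close>. Faces of length 4 are satisfied by
  the flat payment alone.\<close>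

definition share :: "'a \<Rightarrow> 'a set set \<Rightarrow> int" where
  "share v C = (if card C = 3
     then THE r. \<exists>x y. C = triangle v x y \<and> distinct [v, x, y] \<and> r = gift v x y else 0)"

lemma share_triangle:
  assumes "triangle v x y \<in> F" "distinct [v, x, y]"
  shows "share v (triangle v x y) = gift v x y"
proof -
  have "(THE r. \<exists>x' y'. triangle v x y = triangle v x' y' \<and> distinct [v, x', y'] \<and> r = gift v x' y') = gift v x y"
  proof (rule the_equality)
    show "\<exists>x' y'. triangle v x y = triangle v x' y' \<and> distinct [v, x', y'] \<and> gift v x y = gift v x' y'"
      using assms(2) by blast
    fix r assume "\<exists>x' y'. triangle v x y = triangle v x' y' \<and> distinct [v, x', y'] \<and> r = gift v x' y'"
    then obtain x' y' where *: "triangle v x y = triangle v x' y'" "distinct [v, x', y']" "r = gift v x' y'"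
      by blast
    have "x = x' \<and> y = y' \<or> x = y' \<and> y = x'"
      using triangle_inject[OF *(1)] *(2) assms(2) by auto
    then show "r = gift v x y" using *(3) gift_commute[OF assms] by auto
  qed
  then show ?thesis by (simp add: share_def card_triangle[OF assms(2)])
qed

section \<open>Short faces around a vertex\<close>

definition small_at :: "'a \<Rightarrow> 'a set set set" where
  "small_at v = {C \<in> F. card C \<le> 4 \<and> v \<in> \<Union> C}"

definition nbrs_in :: "'a \<Rightarrow> 'a set set \<Rightarrow> 'a set" where
  "nbrs_in v C = {x. {v, x} \<in> C}"

definition mids :: "'a \<Rightarrow> 'a set" where
  "mids v = {x. mid {v, x}}"

text \<open>For \<open>x\<close> in \<open>mids v\<close> these are the two triangles of the diamond
  with middle edge \<open>{v, x}\<close>. Their payments are bounded jointly, because the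
  configurations speak of diamonds.\<close>

definition pair :: "'a \<Rightarrow> 'a \<Rightarrow> 'a set set set" where
  "pair v x = {C \<in> small_at v. x \<in> nbrs_in v C}"

definition singles :: "'a \<Rightarrow> 'a set set set" where
  "singles v = small_at v - (\<Union>x\<in>mids v. pair v x)"

lemma finite_small_at: "finite (small_at v)"
  using finite_F by (simp add: small_at_def)

lemma nbrs_in_subset: "C \<in> F \<Longrightarrow> nbrs_in v C \<subseteq> {u \<in> V. adj v u}"
  unfolding nbrs_in_def using face_edge graphD(3) by blast

lemma finite_nbrs: "finite {u \<in> V. adj v u}"
  using graphD(1) by simp

lemma finite_nbrs_in: "C \<in> small_at v \<Longrightarrow> finite (nbrs_in v C)"
  by (rule finite_subset[OF nbrs_in_subset finite_nbrs]) (simp add: small_at_def)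

lemma card_nbrs_in: "C \<in> small_at v \<Longrightarrow> card (nbrs_in v C) = 2"
  unfolding nbrs_in_def small_at_def using card_nbrs_cycle[OF graphD(6) face_cycle] by blast

lemma nbrs_in_triangle: "distinct [v, x, y] \<Longrightarrow> nbrs_in v (triangle v x y) = {x, y}"
  by (auto simp: nbrs_in_def triangle_def doubleton_eq_iff)

lemma mids_pair:
  assumes "x \<in> mids v"
  obtains y z where "pair v x = {triangle v x y, triangle v x z}" "distinct [v, x, y, z]"
    "triangle v x y \<in> F" "triangle v x z \<in> F" "dia V adj v x y z" "triangle v x y \<noteq> triangle v x z"
proof -
  have m: "mid {v, x}" using assms by (simp add: mids_def)
  then obtain A B where AB: "A \<in> F" "B \<in> F" "A \<noteq> B" "card A \<le> 4" "card B \<le> 4" "{v, x} \<in> A" "{v, x} \<in> B"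
    unfolding mid_def by blast
  obtain y z where yz: "A = triangle v x y" "B = triangle v x z" "distinct [v, x, y, z]"
    "adj v x" "adj v y" "adj x y" "adj v z" "adj x z"
    by (rule small_faces_common_edge[OF AB(1,2,4,5,3,6,7)])
  have "pair v x = {A, B}"
  proof
    show "pair v x \<subseteq> {A, B}"
      using two_faces[OF AB(1,2) _ AB(6,7)] AB(3) by (auto simp: pair_def small_at_def nbrs_in_def)
    show "{A, B} \<subseteq> pair v x"
      using AB by (auto simp: pair_def small_at_def nbrs_in_def)
  qed
  moreover have "dia V adj v x y z"
    using yz graphD(2,3) by (auto simp: dia_def)
  ultimately show thesis using that yz AB by simp
qed

lemma mids_pair_nbrs:
  assumes "x \<in> mids v" "pair v x = {triangle v x y, triangle v x z}" "distinct [v, x, y, z]"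
  shows "(\<Union>C\<in>pair v x. nbrs_in v C) = {x, y, z}"
proof -
  have "distinct [v, x, y]" "distinct [v, x, z]" using assms(3) by auto
  then show ?thesis using nbrs_in_triangle unfolding assms(2) by auto
qed

lemma common_nbr:
  assumes "C \<in> small_at v" "C' \<in> small_at v" "C \<noteq> C'" "u \<in> nbrs_in v C" "u \<in> nbrs_in v C'"
  shows "u \<in> mids v" "C \<in> pair v u"
  using assms by (auto simp: mids_def mid_def pair_def small_at_def nbrs_in_def)

text \<open>A triangle of the diamond on \<open>{v, x}\<close> has just one neighbour of
  \<open>v\<close> besides \<open>x\<close>. If another short face at \<open>v\<close> used it too,
  the triangle would have two middle edges at \<open>v\<close>, against
  \<open>mid_unique\<close>.\<close>

lemma common_nbr_of_pair:
  assumes "x \<in> mids v" "C \<in> pair v x" "C' \<in> small_at v" "C \<noteq> C'" "u \<in> nbrs_in v C" "u \<in> nbrs_in v C'"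
  shows "u = x"
proof (rule ccontr)
  assume ne: "u \<noteq> x"
  have C: "C \<in> small_at v" "{v, x} \<in> C" "C \<in> F" "card C \<le> 4"
    using assms(2) by (auto simp: pair_def small_at_def nbrs_in_def)
  have mu: "mid {v, u}" using common_nbr(1)[OF C(1) assms(3-6)] by (simp add: mids_def)
  obtain y z where yz: "pair v x = {triangle v x y, triangle v x z}" "distinct [v, x, y, z]"
    "triangle v x y \<in> F" "triangle v x z \<in> F"
    by (rule mids_pair[OF assms(1)])
  then obtain w where w: "C = triangle v x w" "distinct [v, x, w]" "triangle v x w \<in> F"
    using assms(2) by auto
  have "u = w" using assms(5) ne nbrs_in_triangle[OF w(2)] w(1) by auto
  then show False using mid_unique[OF w(3,2)] mu assms(1) by (simp add: mids_def)
qed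

lemma pair_disjoint:
  assumes "x \<in> mids v" "x' \<in> mids v" "x \<noteq> x'" "C \<in> pair v x" "C' \<in> pair v x'"
  shows "nbrs_in v C \<inter> nbrs_in v C' = {}" "C \<noteq> C'"
proof -
  have C: "C \<in> small_at v" "C' \<in> small_at v" using assms(4,5) by (auto simp: pair_def)
  show ne: "C \<noteq> C'"
  proof
    assume eq: "C = C'"
    obtain y z where yz: "pair v x = {triangle v x y, triangle v x z}" "distinct [v, x, y, z]"
      "triangle v x y \<in> F" "triangle v x z \<in> F"
      by (rule mids_pair[OF assms(1)])
    then obtain w where w: "C = triangle v x w" "distinct [v, x, w]" "triangle v x w \<in> F"
      using assms(4) by auto
    have "x' \<in> nbrs_in v C" using assms(5) eq by (simp add: pair_def)
    then have "x' = w" using assms(3) nbrs_in_triangle[OF w(2)] w(1) by auto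
    then show False using mid_unique[OF w(3,2)] assms(1,2) by (simp add: mids_def)
  qed
  show "nbrs_in v C \<inter> nbrs_in v C' = {}"
    using common_nbr_of_pair[OF assms(1,4) C(2) ne] common_nbr_of_pair[OF assms(2,5) C(1) ne[symmetric]]
      assms(3) by blast
qed

lemma singlesD:
  assumes "C \<in> singles v"
  shows "C \<in> small_at v" "x \<in> mids v \<Longrightarrow> x \<notin> nbrs_in v C"
  using assms by (auto simp: singles_def pair_def)

lemma mids_subset: "mids v \<subseteq> {u \<in> V. adj v u}"
proof
  fix x assume "x \<in> mids v"
  then obtain C where "C \<in> F" "{v, x} \<in> C" by (auto simp: mids_def mid_def)
  then show "x \<in> {u \<in> V. adj v u}" using face_edge graphD(3) by blast
qed

lemma finite_mids: "finite (mids v)"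
  by (rule finite_subset[OF mids_subset finite_nbrs])

text \<open>A diamond with middle vertex \<open>v\<close> uses three neighbours of \<open>v\<close>
  and every other short face at \<open>v\<close> uses two. These sets are disjoint, because a
  neighbour common to two short faces is the other end of a middle edge.\<close>

lemma count_nbrs: "3 * card (mids v) + 2 * card (singles v) \<le> deg V adj v"
proof -
  let ?N = "\<lambda>x. \<Union>C\<in>pair v x. nbrs_in v C"
  have finp: "finite (?N x)" if "x \<in> mids v" for x
    by (intro finite_UN_I) (auto simp: pair_def finite_small_at finite_nbrs_in)
  have fins: "finite (singles v)" using finite_small_at by (simp add: singles_def)
  have c3: "card (?N x) = 3" if x: "x \<in> mids v" for x
  proof -
    obtain y z where yz: "pair v x = {triangle v x y, triangle v x z}" "distinct [v, x, y, z]"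
      by (rule mids_pair[OF x])
    show ?thesis using mids_pair_nbrs[OF x yz] yz(2) by simp
  qed
  have "card (\<Union>x\<in>mids v. ?N x) = (\<Sum>x\<in>mids v. card (?N x))"
  proof (rule card_UN_disjoint[OF finite_mids])
    show "\<forall>i\<in>mids v. finite (?N i)" using finp by blast
    show "\<forall>i\<in>mids v. \<forall>j\<in>mids v. i \<noteq> j \<longrightarrow> ?N i \<inter> ?N j = {}"
      using pair_disjoint(1) by blast
  qed
  then have 1: "card (\<Union>x\<in>mids v. ?N x) = 3 * card (mids v)" using c3 by simp
  have "card (\<Union>C\<in>singles v. nbrs_in v C) = (\<Sum>C\<in>singles v. card (nbrs_in v C))"
  proof (rule card_UN_disjoint[OF fins])
    show "\<forall>C\<in>singles v. finite (nbrs_in v C)"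
      using singlesD(1) finite_nbrs_in by blast
    show "\<forall>C\<in>singles v. \<forall>C'\<in>singles v. C \<noteq> C' \<longrightarrow> nbrs_in v C \<inter> nbrs_in v C' = {}"
      using common_nbr(1) singlesD by blast
  qed
  then have 2: "card (\<Union>C\<in>singles v. nbrs_in v C) = 2 * card (singles v)"
    using card_nbrs_in[OF singlesD(1)] by simp
  have 3: "(\<Union>x\<in>mids v. ?N x) \<inter> (\<Union>C\<in>singles v. nbrs_in v C) = {}"
  proof (rule ccontr)
    assume "\<not> ?thesis"
    then obtain x C C' u where *: "x \<in> mids v" "C \<in> pair v x" "C' \<in> singles v" "u \<in> nbrs_in v C" "u \<in> nbrs_in v C'"
      by blast
    have "C \<noteq> C'" using *(1-3) by (auto simp: singles_def)
    then have "u \<in> mids v"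
      using common_nbr(1)[of C v C' u] * singlesD(1) by (auto simp: pair_def)
    then show False using singlesD(2)[OF *(3)] *(5) by blast
  qed
  have "card ((\<Union>x\<in>mids v. ?N x) \<union> (\<Union>C\<in>singles v. nbrs_in v C)) =
      3 * card (mids v) + 2 * card (singles v)"
  proof -
    have "finite (\<Union>x\<in>mids v. ?N x)" using finp finite_mids by blast
    moreover have "finite (\<Union>C\<in>singles v. nbrs_in v C)"
      using fins singlesD(1) finite_nbrs_in by blast
    ultimately show ?thesis using card_Un_disjoint[OF _ _ 3] 1 2 by simp
  qed
  moreover have "(\<Union>x\<in>mids v. ?N x) \<union> (\<Union>C\<in>singles v. nbrs_in v C) \<subseteq> {u \<in> V. adj v u}"
  proof -
    have "nbrs_in v C \<subseteq> {u \<in> V. adj v u}" if "C \<in> small_at v" for C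
      using that by (intro nbrs_in_subset) (simp add: small_at_def)
    then show ?thesis using singlesD(1) unfolding pair_def by blast
  qed
  ultimately show ?thesis
    using card_mono[OF finite_nbrs, of "(\<Union>x\<in>mids v. ?N x) \<union> (\<Union>C\<in>singles v. nbrs_in v C)"]
    unfolding deg_def by simp
qed

definition load :: "'a \<Rightarrow> 'a set set \<Rightarrow> int" where
  "load v C = share v C + 2"

lemma sum_load_split:
  "(\<Sum>C\<in>small_at v. load v C) = (\<Sum>C\<in>singles v. load v C) + (\<Sum>x\<in>mids v. \<Sum>C\<in>pair v x. load v C)"
proof -
  let ?P = "\<Union>x\<in>mids v. pair v x"
  have P: "?P \<subseteq> small_at v" by (auto simp: pair_def)
  have "(\<Sum>C\<in>small_at v. load v C) = (\<Sum>C\<in>singles v. load v C) + (\<Sum>C\<in>?P. load v C)"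
    unfolding singles_def by (rule sum.subset_diff[OF P finite_small_at])
  also have "(\<Sum>C\<in>?P. load v C) = (\<Sum>x\<in>mids v. \<Sum>C\<in>pair v x. load v C)"
  proof (rule sum.UNION_disjoint[OF finite_mids])
    show "\<forall>x\<in>mids v. finite (pair v x)" using finite_small_at by (simp add: pair_def)
    show "\<forall>x\<in>mids v. \<forall>x'\<in>mids v. x \<noteq> x' \<longrightarrow> pair v x \<inter> pair v x' = {}"
      using pair_disjoint(2) by blast
  qed
  finally show ?thesis .
qed

text \<open>No edge at \<open>v\<close> in this face is a middle edge, so the first two branches of
  \<open>gift\<close> are out. At a 4-vertex the payment for two 3-vertices cannot occur by (D2).
  The 3-vertex behind a load above 4 is later the outside vertex of (D7) or (D11).\<close>

lemma single_load:
  assumes "C \<in> singles v"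
  shows "load v C \<le> 6" "D v = 3 \<Longrightarrow> load v C \<le> 2" "D v = 4 \<Longrightarrow> load v C \<le> 4"
    "4 < load v C \<Longrightarrow> \<exists>u\<in>nbrs_in v C. D u = 3"
proof -
  have C: "C \<in> small_at v" "C \<in> F" using singlesD(1)[OF assms] by (auto simp: small_at_def)
  have "load v C \<le> 6 \<and> (D v = 3 \<longrightarrow> load v C \<le> 2) \<and> (D v = 4 \<longrightarrow> load v C \<le> 4) \<and>
    (4 < load v C \<longrightarrow> (\<exists>u\<in>nbrs_in v C. D u = 3))"
  proof (cases "card C = 3")
    case False
    then show ?thesis by (simp add: load_def share_def)
  next
    case True
    obtain x where "x \<in> nbrs_in v C" using card_nbrs_in[OF C(1)] by fastforce
    then have vx: "{v, x} \<in> C" by (simp add: nbrs_in_def)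
    obtain y where y: "C = triangle v x y" "distinct [v, x, y]"
      by (rule triangle_face[OF C(2) True vx])
    have T: "triangle v x y \<in> F" using C(2) y(1) by simp
    have N: "nbrs_in v C = {x, y}" using nbrs_in_triangle[OF y(2)] y(1) by simp
    have nm: "\<not> mid {v, x}" "\<not> mid {v, y}"
      using singlesD(2)[OF assms, of x] singlesD(2)[OF assms, of y] N by (auto simp: mids_def)
    have eq: "triangle x y v = triangle v x y" by (auto simp: triangle_def)
    have "5 \<le> D v" if "D x = 3" "D y = 3"
      using triangle_no_D2[of x y v] that T y(2) eq by auto
    moreover have "load v C = gift v x y + 2" using share_triangle[OF T y(2)] y(1) by (simp add: load_def)
    ultimately show ?thesis
      using nm N by (auto simp: gift_def)
  qed
  then show "load v C \<le> 6" "D v = 3 \<Longrightarrow> load v C \<le> 2" "D v = 4 \<Longrightarrow> load v C \<le> 4"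
    "4 < load v C \<Longrightarrow> \<exists>u\<in>nbrs_in v C. D u = 3" by blast+
qed

definition pair_load :: "'a \<Rightarrow> 'a \<Rightarrow> int" where
  "pair_load v x = (\<Sum>C\<in>pair v x. load v C)"

lemma pair_load_eq:
  assumes "x \<in> mids v"
  obtains y z where "dia V adj v x y z" "distinct [v, x, y, z]"
    "triangle v x y \<in> F" "triangle v x z \<in> F" "(\<Union>C\<in>pair v x. nbrs_in v C) = {x, y, z}" "D y \<le> D z"
    "pair_load v x = (if D v = 3 then 2 else if D x = 3 then side_gift y + side_gift z + 4 else 8)"
proof -
  obtain y z where yz: "pair v x = {triangle v x y, triangle v x z}" "distinct [v, x, y, z]"
    "triangle v x y \<in> F" "triangle v x z \<in> F" "dia V adj v x y z" "triangle v x y \<noteq> triangle v x z"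
    by (rule mids_pair[OF assms])
  have "mid {v, x}" using assms by (simp add: mids_def)
  then have g: "gift v x u = (if D v = 3 then -1 else if D x = 3 then side_gift u else 2)" for u
    by (simp add: gift_def)
  have s: "share v (triangle v x y) = gift v x y" "share v (triangle v x z) = gift v x z"
    using share_triangle yz by simp_all
  have l: "pair_load v x = (if D v = 3 then 2 else if D x = 3 then side_gift y + side_gift z + 4 else 8)"
    unfolding pair_load_def yz(1) using yz(6) by (simp add: load_def s g)
  have N: "(\<Union>C\<in>pair v x. nbrs_in v C) = {x, y, z}" by (rule mids_pair_nbrs[OF assms yz(1,2)])
  have dia': "dia V adj v x z y" using yz(5) by (auto simp: dia_def)
  show thesis
  proof (cases "D y \<le> D z")
    case True
    show thesis by (rule that[OF yz(5,2,3,4) N True l])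
  next
    case False
    then have le: "D z \<le> D y" by simp
    show thesis
      by (rule that[OF dia' _ yz(4,3) _ le]) (use yz(2) N l in \<open>auto simp: add.commute\<close>)
  qed
qed

text \<open>If \<open>D x = 3\<close> and \<open>D v\<close> is larger, side degrees (3,3), (3,4),
  (3,5+), (4,4), (4,5+), (5+,5+) give loads 14, 12, 10, 10, 8, 6. The first is impossible: by (D9)
  the sides would be adjacent, which makes a K4. At a 4-vertex (D2) and (D6) remove everything above
  8, and at a 5-vertex (D10) removes 12.\<close>

lemma pair_load_cases:
  assumes x: "x \<in> mids v"
  obtains y z where "dia V adj v x y z" "distinct [v, x, y, z]"
    "(\<Union>C\<in>pair v x. nbrs_in v C) = {x, y, z}"
    "pair_load v x \<le> 12" "10 < pair_load v x \<longrightarrow> D x = 3 \<and> D y = 3 \<and> D z = 4"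
    "8 < pair_load v x \<longrightarrow> D x = 3 \<and> (D y = 3 \<or> D y = 4 \<and> D z = 4)"
    "D v = 3 \<longrightarrow> pair_load v x \<le> 2" "D v = 4 \<longrightarrow> pair_load v x \<le> 8" "D v = 5 \<longrightarrow> pair_load v x \<le> 10"
proof -
  obtain y z where yz: "dia V adj v x y z" "distinct [v, x, y, z]"
    "triangle v x y \<in> F" "triangle v x z \<in> F" "(\<Union>C\<in>pair v x. nbrs_in v C) = {x, y, z}" "D y \<le> D z"
    "pair_load v x = (if D v = 3 then 2 else if D x = 3 then side_gift y + side_gift z + 4 else 8)"
    by (rule pair_load_eq[OF x])
  have dy: "distinct [v, x, y]" using yz(2) by simp
  have ge: "3 \<le> D x" "3 \<le> D y" "3 \<le> D v" using D_triangle_ge_3[OF yz(3) dy] by auto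
  have not333: "D z \<noteq> 3" if "D x = 3" "D y = 3"
  proof
    assume "D z = 3"
    then have "adj y z"
      using no_D9[of y x z] that yz(1,2) adj_sym by (auto simp: dia_def)
    then show False using no_K4'[of v x y z] yz(1) by (auto simp: dia_def)
  qed
  have eq: "triangle x y v = triangle v x y" by (auto simp: triangle_def)
  have no334: "5 \<le> D v" if "D x = 3" "D y = 3"
    using triangle_no_D2[of x y v] that yz(3) dy eq by auto
  have no4344: "\<not> (D v = 4 \<and> D x = 3 \<and> D y = 4 \<and> D z = 4)" using no_D6[OF yz(1)] by blast
  have "dia V adj v x z y" using yz(1) by (auto simp: dia_def)
  then have no5343: "\<not> (D v = 5 \<and> D x = 3 \<and> D y = 3 \<and> D z = 4)" using no_D10 by blast
  show thesis
    by (rule that[OF yz(1,2,5)])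
      (use yz(6,7) ge not333 no334 no4344 no5343 in \<open>auto simp: side_gift_def split: if_splits\<close>)
qed

lemma load_sum: "(\<Sum>C\<in>small_at v. load v C) = (\<Sum>C\<in>singles v. load v C) + (\<Sum>x\<in>mids v. pair_load v x)"
  using sum_load_split by (simp add: pair_load_def)

lemma load_sum_le:
  assumes "\<And>C. C \<in> singles v \<Longrightarrow> load v C \<le> a" "\<And>x. x \<in> mids v \<Longrightarrow> pair_load v x \<le> b"
  shows "(\<Sum>C\<in>small_at v. load v C) \<le> a * int (card (singles v)) + b * int (card (mids v))"
  using sum_bounded_above[of "singles v" "load v" a] sum_bounded_above[of "mids v" "pair_load v" b] assms
  unfolding load_sum by (simp add: mult.commute)

lemma load_sum_le_general:
  "(\<Sum>C\<in>small_at v. load v C) \<le> 6 * int (card (singles v)) + 12 * int (card (mids v))"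
proof (rule load_sum_le)
  show "load v C \<le> 6" if "C \<in> singles v" for C using single_load(1)[OF that] .
  show "pair_load v x \<le> 12" if "x \<in> mids v" for x by (rule pair_load_cases[OF that])
qed

lemma adj_nbrs_in: "C \<in> small_at v \<Longrightarrow> u \<in> nbrs_in v C \<Longrightarrow> adj v u"
  using face_edge by (auto simp: small_at_def nbrs_in_def)

text \<open>The bound is the budget 6 * 5 - 16. Exceeding it needs a pair above 8 and a single above
  4. The single supplies a 3-vertex outside the diamond; the diamond contains a T(5,3,3), giving
  (D11), or is Dia(5-3,4,4), giving (D7).\<close>

lemma pair_single_load:
  assumes "D v = 5" "x \<in> mids v" "C \<in> singles v"
  shows "pair_load v x + load v C \<le> 14"
proof (rule ccontr)
  assume gt: "\<not> ?thesis"
  obtain y z where yz: "dia V adj v x y z" "distinct [v, x, y, z]"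
    "(\<Union>C\<in>pair v x. nbrs_in v C) = {x, y, z}"
    "pair_load v x \<le> 12" "10 < pair_load v x \<longrightarrow> D x = 3 \<and> D y = 3 \<and> D z = 4"
    "8 < pair_load v x \<longrightarrow> D x = 3 \<and> (D y = 3 \<or> D y = 4 \<and> D z = 4)"
    "D v = 3 \<longrightarrow> pair_load v x \<le> 2" "D v = 4 \<longrightarrow> pair_load v x \<le> 8" "D v = 5 \<longrightarrow> pair_load v x \<le> 10"
    by (rule pair_load_cases[OF assms(2)])
  have "4 < load v C" using gt yz(9) assms(1) by simp
  then obtain u where u: "u \<in> nbrs_in v C" "D u = 3" using single_load(4)[OF assms(3)] by blast
  have au: "adj v u" using adj_nbrs_in[OF singlesD(1)[OF assms(3)] u(1)] .
  have "u \<notin> {x, y, z}"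
  proof
    assume "u \<in> {x, y, z}"
    then obtain C' where C': "C' \<in> pair v x" "u \<in> nbrs_in v C'" using yz(3) by blast
    have "C' \<noteq> C" using C'(1) assms(2,3) by (auto simp: singles_def)
    then have "u \<in> mids v"
      using common_nbr(1)[of C' v C u] C' u(1) singlesD(1)[OF assms(3)] by (simp add: pair_def)
    then show False using singlesD(2)[OF assms(3)] u(1) by blast
  qed
  then have out: "u \<notin> {v, x, y, z}" using graphD(4)[OF au] by auto
  have "D x = 3 \<and> (D y = 3 \<or> D y = 4 \<and> D z = 4)"
    using yz(6) gt single_load(1)[OF assms(3)] by simp
  moreover have "tri V adj v x y" using yz(1) by (auto simp: dia_def tri_def)
  ultimately show False
    using no_D7[OF yz(1) assms(1) _ _ _ out u(2) au] no_D11[of v x y u] assms(1) out u(2) au by auto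
qed

text \<open>The bound is the budget 6 * 6 - 16. As a pair costs at most 12, exceeding it needs one
  pair above 10 and the other above 8. The former is Dia(6-3,4,3) and contains a T(6,3,3); the
  latter contains a T(6,3,3), giving (D12), or is Dia(6-3,4,4), giving (D3).\<close>

lemma two_pairs_load:
  assumes "D v = 6" "x \<in> mids v" "x' \<in> mids v" "x \<noteq> x'"
  shows "pair_load v x + pair_load v x' \<le> 20"
proof -
  have *: False if x: "x \<in> mids v" "x' \<in> mids v" "x \<noteq> x'" and l: "10 < pair_load v x" "8 < pair_load v x'" for x x'
  proof -
    obtain y z where yz: "dia V adj v x y z" "distinct [v, x, y, z]"
      "(\<Union>C\<in>pair v x. nbrs_in v C) = {x, y, z}"
    "pair_load v x \<le> 12" "10 < pair_load v x \<longrightarrow> D x = 3 \<and> D y = 3 \<and> D z = 4"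
    "8 < pair_load v x \<longrightarrow> D x = 3 \<and> (D y = 3 \<or> D y = 4 \<and> D z = 4)"
    "D v = 3 \<longrightarrow> pair_load v x \<le> 2" "D v = 4 \<longrightarrow> pair_load v x \<le> 8" "D v = 5 \<longrightarrow> pair_load v x \<le> 10"
      by (rule pair_load_cases[OF x(1)])
    obtain y' z' where yz': "dia V adj v x' y' z'" "distinct [v, x', y', z']"
      "(\<Union>C\<in>pair v x'. nbrs_in v C) = {x', y', z'}"
    "pair_load v x' \<le> 12" "10 < pair_load v x' \<longrightarrow> D x' = 3 \<and> D y' = 3 \<and> D z' = 4"
    "8 < pair_load v x' \<longrightarrow> D x' = 3 \<and> (D y' = 3 \<or> D y' = 4 \<and> D z' = 4)"
    "D v = 3 \<longrightarrow> pair_load v x' \<le> 2" "D v = 4 \<longrightarrow> pair_load v x' \<le> 8" "D v = 5 \<longrightarrow> pair_load v x' \<le> 10"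
      by (rule pair_load_cases[OF x(2)])
    have "(\<Union>C\<in>pair v x. nbrs_in v C) \<inter> (\<Union>C\<in>pair v x'. nbrs_in v C) = {}"
      using pair_disjoint(1)[OF x] by blast
    then have disj: "{x, y, z} \<inter> {x', y', z'} = {}" using yz(3) yz'(3) by simp
    have d: "D x = 3" "D y = 3" "D z = 4" "D x' = 3" "D y' = 3 \<or> D y' = 4 \<and> D z' = 4"
      using yz(5) yz'(6) l by auto
    have t: "tri V adj v x y" "tri V adj v x' y'" using yz(1) yz'(1) by (auto simp: dia_def tri_def)
    have "dia V adj v x z y" using yz(1) by (auto simp: dia_def)
    from d(5) show False
    proof
      assume "D y' = 3"
      then show False using no_D12[OF t assms(1)] d disj by auto
    next
      assume "D y' = 4 \<and> D z' = 4"
      then show False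
        using no_D3[OF \<open>dia V adj v x z y\<close> yz'(1) assms(1)] d disj by auto
    qed
  qed
  have "pair_load v x \<le> 12" by (rule pair_load_cases[OF assms(2)])
  moreover have "pair_load v x' \<le> 12" by (rule pair_load_cases[OF assms(3)])
  ultimately show ?thesis
    using *[OF assms(2-4)] *[OF assms(3,2) assms(4)[symmetric]] by fastforce
qed

text \<open>Degrees 3 to 6 have budgets 2, 8, 14 and 20. With s singles and p pairs at a vertex of
  degree d at least 8 the neighbour count suffices: 6s + 12p \<le> 4(2s + 3p) \<le> 4d \<le> 6d -
  16.\<close>

lemma load_sum_vertex:
  assumes "3 * card (mids v) + 2 * card (singles v) \<le> D v" "3 \<le> D v"
  shows "(\<Sum>C\<in>small_at v. load v C) \<le> 6 * int (D v) - 16"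
proof -
  let ?p = "card (mids v)" and ?s = "card (singles v)" and ?L = "\<Sum>C\<in>small_at v. load v C"
  have fins: "finite (singles v)" using finite_small_at by (simp add: singles_def)
  note gen = load_sum_le_general[of v]
  consider "D v = 3" | "D v = 4" | "D v = 5" | "D v = 6" | "D v \<ge> 7" using assms(2) by linarith
  then show ?thesis
  proof cases
    case 1
    have "?L \<le> 2 * int ?s + 2 * int ?p"
    proof (rule load_sum_le)
      show "load v C \<le> 2" if "C \<in> singles v" for C using single_load(2)[OF that 1] .
      show "pair_load v x \<le> 2" if "x \<in> mids v" for x
        by (rule pair_load_cases[OF that]) (use 1 in simp)
    qed
    moreover have "?p + ?s \<le> 1" using assms(1) 1 by linarith
    ultimately show ?thesis using 1 by linarith
  next
    case 2
    have "?L \<le> 4 * int ?s + 8 * int ?p"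
    proof (rule load_sum_le)
      show "load v C \<le> 4" if "C \<in> singles v" for C using single_load(3)[OF that 2] .
      show "pair_load v x \<le> 8" if "x \<in> mids v" for x
        by (rule pair_load_cases[OF that]) (use 2 in simp)
    qed
    moreover have "?s + 2 * ?p \<le> 2" using assms(1) 2 by presburger
    ultimately show ?thesis using 2 by linarith
  next
    case 3
    consider "?p = 0" | "?p = 1" "?s = 0" | "?p = 1" "?s = 1" using assms(1) 3 by linarith
    then show ?thesis
    proof cases
      case 1
      then have "?s \<le> 2" using assms(1) 3 by linarith
      then show ?thesis using gen 1 3 by linarith
    next
      case 2
      then show ?thesis using gen 3 by linarith
    next
      case 3
      then obtain x C where xC: "mids v = {x}" "singles v = {C}"
        by (metis card_1_singletonE)
      then have "?L = load v C + pair_load v x" by (simp add: load_sum)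
      then show ?thesis using pair_single_load[OF \<open>D v = 5\<close>, of x C] xC \<open>D v = 5\<close> by simp
    qed
  next
    case 4
    consider "?p = 2" "?s = 0" | "?p = 0" "?s \<le> 3" | "?p = 1" "?s \<le> 1" using assms(1) 4 by linarith
    then show ?thesis
    proof cases
      case 1
      then obtain x x' where x: "mids v = {x, x'}" "x \<noteq> x'" by (auto simp: card_2_iff)
      moreover have "singles v = {}" using 1(2) fins by simp
      ultimately have "?L = pair_load v x + pair_load v x'" by (simp add: load_sum)
      then show ?thesis using two_pairs_load[OF 4, of x x'] x 4 by simp
    next
      case 2
      then show ?thesis using gen 4 by linarith
    next
      case 3
      then show ?thesis using gen 4 by linarith
    qed
  next
    case 5
    have "6 * ?s + 12 * ?p + 16 \<le> 6 * D v"
    \<comment> \<open>For degree 7 the estimate 4d = 28 exceeds the budget 26, but integers with 3p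
      + 2s \<le> 7 reach at most 24.\<close>
    proof (cases "D v = 7")
      case True
      consider "?p = 0" "?s \<le> 3" | "?p = 1" "?s \<le> 2" | "?p = 2" "?s = 0" using assms(1) True by linarith
      then show ?thesis using True by cases simp_all
    next
      case False
      then show ?thesis using assms(1) 5 by linarith
    qed
    then show ?thesis using gen by linarith
  qed
qed

text \<open>A triangle receives three times 2 and the extra 4, which is 10 = 16 - 6; a face of
  length 4 receives four times 2, which is 8 = 16 - 8.\<close>

lemma load_sum_face:
  assumes "C \<in> F" "card C \<le> 4"
  shows "16 - 2 * int (card C) \<le> (\<Sum>v\<in>\<Union> C. load v C)"
proof (cases "card C = 3")
  case True
  have "C \<noteq> {}" using True by auto
  then obtain e where e: "e \<in> C" by blast
  then obtain v x where vx: "e = {v, x}"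
    using is_cycle_subset_edges[OF face_cycle[OF assms(1)]] by (auto simp: edges_def)
  obtain y where y: "C = triangle v x y" "distinct [v, x, y]"
    by (rule triangle_face[OF assms(1) True]) (use e vx in auto)
  have T: "triangle v x y \<in> F" "triangle x v y \<in> F" "triangle y v x \<in> F"
    "triangle x v y = C" "triangle y v x = C"
  proof -
    show "triangle x v y = C" "triangle y v x = C" unfolding y(1) by (auto simp: triangle_def)
    then show "triangle v x y \<in> F" "triangle x v y \<in> F" "triangle y v x \<in> F" using assms(1) y(1) by auto
  qed
  have "share v C = gift v x y" "share x C = gift x v y" "share y C = gift y v x"
    using share_triangle[OF T(1)] share_triangle[OF T(2)] share_triangle[OF T(3)] y T(4,5) by auto
  moreover have "\<Union> C = {v, x, y}" unfolding y(1) by (auto simp: triangle_def)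
  ultimately show ?thesis
    using gift_sum[OF T(1) y(2)] y(2) True by (simp add: load_def)
next
  case False
  then have "card C = 4" using card_face_cases[OF assms(1)] assms(2) by linarith
  moreover have "card (\<Union> C) = 4" using card_Union_cycle[OF face_cycle[OF assms(1)]] calculation by simp
  ultimately show ?thesis by (simp add: load_def share_def)
qed

lemma sum_card_faces: "(\<Sum>C\<in>F. card C) \<le> 2 * card (edges adj)"
proof -
  have sub: "C \<subseteq> edges adj" if "C \<in> F" for C using is_cycle_subset_edges[OF face_cycle[OF that]] .
  have "(\<Sum>C\<in>F. card C) = (\<Sum>C\<in>F. \<Sum>e | e \<in> edges adj \<and> e \<in> C. 1)"
  proof (rule sum.cong)
    fix C assume "C \<in> F"
    then have "{e. e \<in> edges adj \<and> e \<in> C} = C" using sub by auto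
    then show "card C = (\<Sum>e | e \<in> edges adj \<and> e \<in> C. 1)" by simp
  qed simp
  also have "\<dots> = (\<Sum>e\<in>edges adj. \<Sum>C | C \<in> F \<and> e \<in> C. 1)"
    by (rule sum.swap_restrict) (use finite_F finite_edges[OF graph] in auto)
  also have "\<dots> \<le> (\<Sum>e\<in>edges adj. 2)"
  proof (rule sum_mono)
    fix e
    have "card {C. C \<in> F \<and> e \<in> C} \<le> 2"
      by (rule card_le_2_if_no_three) (use two_faces in blast)
    then show "(\<Sum>C | C \<in> F \<and> e \<in> C. 1) \<le> (2::nat)" by simp
  qed
  finally show ?thesis by simp
qed

text \<open>The same payments are counted by faces and by vertices. The result 16|F| - 4|E| \<le>
  12|E| - 16|V| + 15 contradicts |E| + 1 \<le> |F| + |V| by a margin of 1.\<close>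

lemma inconsistent: False
proof -
  let ?E = "int (card (edges adj))" and ?L = "\<Sum>v\<in>V. \<Sum>C\<in>small_at v. load v C"
  let ?S = "{C \<in> F. card C \<le> 4}"
  have "?L = (\<Sum>v\<in>V. \<Sum>C | C \<in> ?S \<and> v \<in> \<Union> C. load v C)"
    by (simp add: small_at_def conj_assoc)
  also have "\<dots> = (\<Sum>C\<in>?S. \<Sum>v | v \<in> V \<and> v \<in> \<Union> C. load v C)"
    by (rule sum.swap_restrict) (use finite_F graphD(1) in auto)
  also have "\<dots> \<ge> (\<Sum>C\<in>?S. 16 - 2 * int (card C))"
  proof (rule sum_mono)
    fix C assume C: "C \<in> ?S"
    have "\<Union> C \<subseteq> V"
      using is_cycle_subset_edges[OF face_cycle[of C]] edges_subset_Pow[OF graph] C by blast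
    then have "{v. v \<in> V \<and> v \<in> \<Union> C} = \<Union> C" by blast
    then show "16 - 2 * int (card C) \<le> (\<Sum>v | v \<in> V \<and> v \<in> \<Union> C. load v C)"
      using load_sum_face[of C] C by simp
  qed
  finally have "(\<Sum>C\<in>?S. 16 - 2 * int (card C)) \<le> ?L" .
  moreover have "(\<Sum>C\<in>F. 16 - 2 * int (card C)) \<le> (\<Sum>C\<in>?S. 16 - 2 * int (card C))"
  proof -
    have "(\<Sum>C\<in>F. 16 - 2 * int (card C)) = (\<Sum>C\<in>F - ?S. 16 - 2 * int (card C)) + (\<Sum>C\<in>?S. 16 - 2 * int (card C))"
      by (rule sum.subset_diff) (use finite_F in auto)
    \<comment> \<open>The remaining faces have length at least 8, so their terms are not
      positive.\<close>
    moreover have "(\<Sum>C\<in>F - ?S. 16 - 2 * int (card C)) \<le> 0"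
      by (rule sum_nonpos) (use card_face_cases in force)
    ultimately show ?thesis by linarith
  qed
  moreover have "(\<Sum>C\<in>F. 16 - 2 * int (card C)) = 16 * int (card F) - 2 * int (\<Sum>C\<in>F. card C)"
    by (simp add: sum_subtractf sum_distrib_left)
  moreover have "int (\<Sum>C\<in>F. card C) \<le> 2 * ?E" using sum_card_faces by linarith
  ultimately have lower: "16 * int (card F) - 4 * ?E \<le> ?L" by linarith
  have upper: "?L \<le> 12 * ?E - 16 * int (card V) + 15"
  proof -
    have le: "(\<Sum>C\<in>small_at v. load v C) \<le> 6 * int (deg V adj v) - 16 + (if v = v0 then 15 else 0)"
      if "v \<in> V" for v
    proof (cases "v = v0")
      case True
      \<comment> \<open>At \<open>v0\<close> only the general bound is available: 6s + 12p is at
        most four times the degree in the block. As this degree is positive, that stays below six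
        times the degree, which is an overdraft of at most 15.\<close>
      have "6 * card (singles v) + 12 * card (mids v) + 1 \<le> 6 * deg V adj v"
        using count_nbrs[of v] v0(2) unfolding True by linarith
      then show ?thesis using load_sum_le_general[of v] True by simp
    next
      case False
      then show ?thesis
        using load_sum_vertex[of v] count_nbrs[of v] D_eq[OF that False] D_ge_3[OF that] by simp
    qed
    have "?L \<le> (\<Sum>v\<in>V. 6 * int (deg V adj v) - 16 + (if v = v0 then 15 else 0))"
      by (rule sum_mono) (use le in blast)
    also have "\<dots> = 6 * int (\<Sum>v\<in>V. deg V adj v) - 16 * int (card V) + 15"
      using graphD(1) v0(1) by (simp add: sum.distrib sum_subtractf sum_distrib_left)
    finally show ?thesis using sum_deg[OF graph] by simp
  qed
  show False using lower upper card_faces by linarith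
qed

end

section \<open>Passing to an end block\<close>

text \<open>All edges that leave \<open>B\<close> start at \<open>v\<close>, so every other vertex
  of \<open>B\<close> keeps its full degree. The cardinality bound excludes the trivial set
  \<open>{v}\<close>.\<close>

definition attached_at :: "('a \<Rightarrow> 'a \<Rightarrow> bool) \<Rightarrow> 'a set \<Rightarrow> 'a \<Rightarrow> bool" where
  "attached_at adj B v \<longleftrightarrow> v \<in> B \<and> 2 \<le> card B \<and> (\<forall>u\<in>B - {v}. \<forall>w. adj u w \<longrightarrow> w \<in> B)"

text \<open>Let \<open>K\<close> be what is reachable from \<open>x\<close> in \<open>B\<close>
  without \<open>b\<close>, and suppose that \<open>y\<close> is not in it. If \<open>v\<close> is
  not in \<open>K\<close>, then \<open>insert b K\<close> is attached at \<open>b\<close> and lacks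
  \<open>y\<close>; otherwise \<open>B - K\<close> is attached at \<open>b\<close> and lacks
  \<open>x\<close>. Both contradict minimality.\<close>

lemma minimal_attached_linked:
  assumes G: "simple_graph V adj" and B: "B \<subseteq> V" "attached_at adj B v"
    and min: "\<And>B' v'. B' \<subseteq> V \<Longrightarrow> attached_at adj B' v' \<Longrightarrow> card B \<le> card B'"
    and b: "b \<in> B" and x: "x \<in> B - {b}" and y: "y \<in> B - {b}"
  shows "(\<lambda>u w. (adj u w \<and> u \<in> B \<and> w \<in> B) \<and> u \<noteq> b \<and> w \<noteq> b)\<^sup>*\<^sup>* x y"
proof (rule ccontr)
  define R where "R = (\<lambda>u w. (adj u w \<and> u \<in> B \<and> w \<in> B) \<and> u \<noteq> b \<and> w \<noteq> b)"
  define K where "K = {z. R\<^sup>*\<^sup>* x z}"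
  assume "\<not> ?thesis"
  then have yK: "y \<notin> K" by (simp add: K_def R_def)
  have finB: "finite B" using B(1) simple_graphD(1)[OF G] finite_subset by blast
  have xK: "x \<in> K" by (simp add: K_def)
  have KB: "z \<in> B - {b}" if "z \<in> K" for z
  proof -
    have "R\<^sup>*\<^sup>* x z" using that by (simp add: K_def)
    then show ?thesis using x by (induction rule: rtranclp_induct) (auto simp: R_def)
  qed
  have step: "w \<in> K" if "u \<in> K" "adj u w" "w \<in> B" "w \<noteq> b" for u w
  proof -
    have "R u w" using that KB[OF that(1)] by (simp add: R_def)
    then show ?thesis using that(1) by (simp add: K_def)
  qed
  have closed: "w \<in> B" if "u \<in> B" "u \<noteq> v" "adj u w" for u w
    using B(2) that by (auto simp: attached_at_def)
  show False
  proof (cases "v \<in> K")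
    case False
    let ?B = "insert b K"
    have sub: "?B \<subset> B" using KB b y yK by blast
    have "card {b, x} \<le> card ?B"
      using finite_subset[OF _ finB, of ?B] sub xK by (intro card_mono) auto
    then have "2 \<le> card ?B" using x by (simp add: card_insert_if split: if_splits)
    moreover have "w \<in> ?B" if u: "u \<in> ?B - {b}" "adj u w" for u w
    proof -
      have "u \<in> K" using u(1) by blast
      then have "w \<in> B" using closed[of u w] KB[of u] u(2) False by blast
      then show ?thesis using step[OF \<open>u \<in> K\<close> u(2)] by blast
    qed
    ultimately have "attached_at adj ?B b" unfolding attached_at_def by blast
    then have "card B \<le> card ?B" using min[of ?B b] sub B(1) by blast
    then show False using psubset_card_mono[OF finB sub] by simp
  next
    case True
    let ?B = "B - K"
    have sub: "?B \<subset> B" using xK x by blast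
    have "card {b, y} \<le> card ?B"
      using finB b y yK KB by (intro card_mono) auto
    then have "2 \<le> card ?B" using y by (simp add: card_insert_if split: if_splits)
    moreover have "w \<in> ?B" if u: "u \<in> ?B - {b}" "adj u w" for u w
    proof -
      have "u \<in> B" "u \<noteq> v" using u True by auto
      then have "w \<in> B" using closed u(2) by blast
      moreover have "w \<notin> K" using step[of w u] u simple_graphD(5)[OF G u(2)] by auto
      ultimately show ?thesis by simp
    qed
    moreover have "b \<in> ?B" using b KB by blast
    ultimately have "attached_at adj ?B b" unfolding attached_at_def by blast
    then have "card B \<le> card ?B" using min[of ?B b] B(1) by blast
    then show False using psubset_card_mono[OF finB sub] by simp
  qed
qed

lemma simple_graph_induced:
  assumes "simple_graph V adj" "B \<subseteq> V"
  shows "simple_graph B (\<lambda>u w. adj u w \<and> u \<in> B \<and> w \<in> B)"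
  using assms finite_subset unfolding simple_graph_def by auto

lemma planar_induced:
  assumes "planar V adj" "B \<subseteq> V"
  shows "planar B (\<lambda>u w. adj u w \<and> u \<in> B \<and> w \<in> B)"
  using assms(1) unfolding planar_def
proof (elim exE conjE)
  fix f :: "'a \<Rightarrow> complex" and \<gamma>
  assume inj: "inj_on f V"
    and edge: "\<forall>u v. adj u v \<longrightarrow> arc (\<gamma> u v) \<and> pathstart (\<gamma> u v) = f u \<and> pathfinish (\<gamma> u v) = f v \<and>
        path_image (\<gamma> u v) = path_image (\<gamma> v u) \<and> path_image (\<gamma> u v) \<inter> f ` V = {f u, f v}"
    and cross: "\<forall>u v x y. adj u v \<longrightarrow> adj x y \<longrightarrow> {u, v} \<noteq> {x, y} \<longrightarrow>
        path_image (\<gamma> u v) \<inter> path_image (\<gamma> x y) \<subseteq> f ` ({u, v} \<inter> {x, y})"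
  show "\<exists>(f :: 'a \<Rightarrow> complex) \<gamma>. inj_on f B \<and>
     (\<forall>u v. adj u v \<and> u \<in> B \<and> v \<in> B \<longrightarrow>
        arc (\<gamma> u v) \<and> pathstart (\<gamma> u v) = f u \<and> pathfinish (\<gamma> u v) = f v \<and>
        path_image (\<gamma> u v) = path_image (\<gamma> v u) \<and> path_image (\<gamma> u v) \<inter> f ` B = {f u, f v}) \<and>
     (\<forall>u v x y. adj u v \<and> u \<in> B \<and> v \<in> B \<longrightarrow> adj x y \<and> x \<in> B \<and> y \<in> B \<longrightarrow> {u, v} \<noteq> {x, y} \<longrightarrow>
        path_image (\<gamma> u v) \<inter> path_image (\<gamma> x y) \<subseteq> f ` ({u, v} \<inter> {x, y}))"
  proof (intro exI[of _ f] exI[of _ \<gamma>] conjI allI impI)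
    show "inj_on f B" using inj assms(2) by (rule inj_on_subset)
    fix u v assume uv: "adj u v \<and> u \<in> B \<and> v \<in> B"
    then have *: "arc (\<gamma> u v) \<and> pathstart (\<gamma> u v) = f u \<and> pathfinish (\<gamma> u v) = f v \<and>
        path_image (\<gamma> u v) = path_image (\<gamma> v u) \<and> path_image (\<gamma> u v) \<inter> f ` V = {f u, f v}"
      using edge by blast
    then show "arc (\<gamma> u v)" "pathstart (\<gamma> u v) = f u" "pathfinish (\<gamma> u v) = f v"
      "path_image (\<gamma> u v) = path_image (\<gamma> v u)" by blast+
    show "path_image (\<gamma> u v) \<inter> f ` B = {f u, f v}"
      using * uv assms(2) by blast
    fix x y assume "adj x y \<and> x \<in> B \<and> y \<in> B" "{u, v} \<noteq> {x, y}"
    then show "path_image (\<gamma> u v) \<inter> path_image (\<gamma> x y) \<subseteq> f ` ({u, v} \<inter> {x, y})"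
      using cross uv by blast
  qed
qed

theorem mainTheorem8:
  fixes V :: "'a set" and adj :: "'a \<Rightarrow> 'a \<Rightarrow> bool"
  assumes "simple_graph V adj" and "planar V adj" and "V \<noteq> {}"
    and "\<not> has_K4 V adj" and "\<not> has_cycle V adj 5" and "\<not> has_cycle V adj 6"
    and "\<not> has_cycle V adj 7"
  shows "(\<exists>v\<in>V. deg V adj v \<le> 2)
    \<or> (\<exists>x y z. tri V adj x y z \<and> deg V adj x = 3 \<and> deg V adj y = 3 \<and>
         (deg V adj z = 3 \<or> deg V adj z = 4))
    \<or> (\<exists>w p q r p' q' r'. dia V adj w p q r \<and> dia V adj w p' q' r' \<and>
         deg V adj w = 6 \<and> deg V adj p = 3 \<and> deg V adj q = 4 \<and> deg V adj r = 3 \<and>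
         deg V adj p' = 3 \<and> deg V adj q' = 4 \<and> deg V adj r' = 4 \<and>
         {p, q, r} \<inter> {p', q', r'} = {})
    \<or> (\<exists>x y a b. dia V adj x y a b \<and> deg V adj x = 3 \<and> deg V adj y = 3 \<and>
         deg V adj a \<ge> 4 \<and> deg V adj b \<ge> 4)
    \<or> (\<exists>x y a b. dia V adj x y a b \<and> deg V adj x = 4 \<and> deg V adj y = 5 \<and>
         deg V adj a = 3 \<and> deg V adj b = 3)
    \<or> (\<exists>x y a b. dia V adj x y a b \<and> deg V adj x = 4 \<and> deg V adj y = 3 \<and>
         deg V adj a = 4 \<and> deg V adj b = 4)
    \<or> (\<exists>x y a b z. dia V adj x y a b \<and> deg V adj x = 5 \<and> deg V adj y = 3 \<and>
         deg V adj a = 4 \<and> deg V adj b = 4 \<and>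
         z \<notin> {x, y, a, b} \<and> deg V adj z = 3 \<and> adj x z)
    \<or> (\<exists>x y a b z. dia V adj x y a b \<and> deg V adj x = 5 \<and> deg V adj y = 5 \<and>
         deg V adj a = 3 \<and> deg V adj b = 3 \<and>
         z \<notin> {x, y, a, b} \<and> deg V adj z = 3 \<and> adj x z)
    \<or> (\<exists>u v w. u \<in> V \<and> v \<in> V \<and> w \<in> V \<and> u \<noteq> w \<and>
         deg V adj u = 3 \<and> deg V adj v = 3 \<and> deg V adj w = 3 \<and>
         adj u v \<and> adj v w \<and> \<not> adj u w)
    \<or> (\<exists>x y a b. dia V adj x y a b \<and> deg V adj x = 5 \<and> deg V adj y = 3 \<and>
         deg V adj a = 4 \<and> deg V adj b = 3)
    \<or> (\<exists>x y z w. tri V adj x y z \<and> deg V adj x = 5 \<and> deg V adj y = 3 \<and>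
         deg V adj z = 3 \<and> w \<notin> {x, y, z} \<and> deg V adj w = 3 \<and> adj x w)
    \<or> (\<exists>x y z y' z'. tri V adj x y z \<and> tri V adj x y' z' \<and> deg V adj x = 6 \<and>
         deg V adj y = 3 \<and> deg V adj z = 3 \<and> deg V adj y' = 3 \<and> deg V adj z' = 3 \<and>
         {y, z} \<inter> {y', z'} = {})"
proof (rule ccontr)
  assume "\<not> ?thesis"
  note neg = this[unfolded de_Morgan_disj]
  note N1 = neg[THEN conjunct1]
  note neg2 = neg[THEN conjunct2]
  note N2 = neg2[THEN conjunct1]
  note neg3 = neg2[THEN conjunct2]
  note N3 = neg3[THEN conjunct1]
  note neg4 = neg3[THEN conjunct2]
  note N4 = neg4[THEN conjunct1]
  note neg5 = neg4[THEN conjunct2]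
  note neg6 = neg5[THEN conjunct2]
  note N6 = neg6[THEN conjunct1]
  note neg7 = neg6[THEN conjunct2]
  note N7 = neg7[THEN conjunct1]
  note neg8 = neg7[THEN conjunct2]
  note neg9 = neg8[THEN conjunct2]
  note N9 = neg9[THEN conjunct1]
  note neg10 = neg9[THEN conjunct2]
  note N10 = neg10[THEN conjunct1]
  note neg11 = neg10[THEN conjunct2]
  note N11 = neg11[THEN conjunct1]
  note N12 = neg11[THEN conjunct2]
  note G = assms(1)
  note GD = simple_graphD[OF G]
  define D where "D = deg V adj"
  have D3: "3 \<le> D u" if "u \<in> V" for u using N1 that unfolding D_def by force
  obtain u0 where u0: "u0 \<in> V" using assms(3) by blast
  have "D u0 \<le> card V" unfolding D_def deg_def using GD(1) by (intro card_mono) auto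
  \<comment> \<open>The whole vertex set is attached at any of its vertices, so a smallest attached
    set exists, whether or not the graph has a cut vertex.\<close>
  then have "attached_at adj V u0"
    using D3[OF u0] u0 GD(3) by (auto simp: attached_at_def)
  then have ex: "V \<subseteq> V \<and> Ex (attached_at adj V)" by blast
  obtain B where B': "B \<subseteq> V \<and> Ex (attached_at adj B)"
    "\<forall>B'. B' \<subseteq> V \<and> Ex (attached_at adj B') \<longrightarrow> card B \<le> card B'"
    using ex_has_least_nat[of "\<lambda>B. B \<subseteq> V \<and> Ex (attached_at adj B)" V card, OF ex] by blast
  then obtain v where B: "B \<subseteq> V" "attached_at adj B v" by blast
  have min: "card B \<le> card B'" if "B' \<subseteq> V" "attached_at adj B' v'" for B' v'
    using B'(2) that by blast
  define adj' where "adj' = (\<lambda>u w. adj u w \<and> u \<in> B \<and> w \<in> B)"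
  have G': "simple_graph B adj'" unfolding adj'_def by (rule simple_graph_induced[OF G B(1)])
  have P': "planar B adj'" unfolding adj'_def by (rule planar_induced[OF assms(2) B(1)])
  have vB: "v \<in> B" and cardB: "2 \<le> card B" using B(2) by (auto simp: attached_at_def)
  have link: "(\<lambda>u w. adj' u w \<and> u \<noteq> b \<and> w \<noteq> b)\<^sup>*\<^sup>* x y"
    if "b \<in> B" "x \<in> B - {b}" "y \<in> B - {b}" for b x y
    unfolding adj'_def using that by (intro minimal_attached_linked[OF G B min])
  have degB: "deg B adj' u = D u" if "u \<in> B" "u \<noteq> v" for u
  proof -
    have "w \<in> B" if "adj u w" for w
      using B(2) \<open>u \<in> B\<close> \<open>u \<noteq> v\<close> that by (simp add: attached_at_def)
    then have "{w \<in> B. adj' u w} = {w \<in> V. adj u w}"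
      using \<open>u \<in> B\<close> B(1) unfolding adj'_def by blast
    then show ?thesis by (simp add: D_def deg_def)
  qed
  \<comment> \<open>A vertex \<open>w\<close> of \<open>B\<close> other than \<open>v\<close> has at
    least three neighbours in \<open>B\<close>, hence a neighbour \<open>b\<close> other than
    \<open>v\<close>. Without \<open>b\<close> the vertices \<open>v\<close> and \<open>w\<close>
    are still linked, so some edge of the block leaves \<open>v\<close>.\<close>
  have degv: "1 \<le> deg B adj' v"
  proof -
    obtain w where w: "w \<in> B" "w \<noteq> v"
      using cardB card_mono[of "{v}" B] by fastforce
    have "3 \<le> card {u \<in> B. adj' w u}"
      using D3[of w] degB[OF w] w B(1) unfolding deg_def by auto
    then have "\<not> {u \<in> B. adj' w u} \<subseteq> {v}" using card_mono[of "{v}" "{u \<in> B. adj' w u}"] by auto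
    then obtain b where b: "b \<in> B" "adj' w b" "b \<noteq> v" by blast
    have "(\<lambda>u w. adj' u w \<and> u \<noteq> b \<and> w \<noteq> b)\<^sup>*\<^sup>* v w"
      using link[of b v w] b w vB GD(4) by (auto simp: adj'_def)
    then obtain y where "adj' v y" using w(2) by (metis (no_types, lifting) converse_rtranclpE)
    then have "{u \<in> B. adj' v u} \<noteq> {}" by (auto simp: adj'_def)
    then show ?thesis
      using simple_graphD(1)[OF G'] card_gt_0_iff[of "{u \<in> B. adj' v u}"] unfolding deg_def by simp
  qed
  show False
  proof (rule planar_faces[OF G' P' vB link])
    fix F
    assume F: "\<And>C. C \<in> F \<Longrightarrow> is_cycle adj' C"
      "card (edges adj') + 1 \<le> card F + card B"
      "\<And>C1 C2 C3 e. \<lbrakk>C1 \<in> F; C2 \<in> F; C3 \<in> F; e \<in> C1; e \<in> C2; e \<in> C3\<rbrakk> \<Longrightarrow> C1 = C2 \<or> C1 = C3 \<or> C2 = C3"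
      "\<And>C C' a b c. \<lbrakk>C \<in> F; C' \<in> F; {a, b} \<in> C; {b, c} \<in> C; {a, b} \<in> C'; {b, c} \<in> C'; a \<noteq> c;
         b = v \<or> 3 \<le> deg B adj' b\<rbrakk> \<Longrightarrow> C = C'"
    have dia: "dia V adj x y a b" if "dia B adj' x y a b" for x y a b
      using that B(1) by (auto simp: dia_def adj'_def)
    have tri: "tri V adj x y z" if "tri B adj' x y z" for x y z
      using that B(1) by (auto simp: tri_def adj'_def)
    have cyc: "\<not> has_cycle B adj' k" if "\<not> has_cycle V adj k" for k
      using that B(1) unfolding has_cycle_def adj'_def by blast
    have "face_family B adj' F v D"
    proof
      show "simple_graph B adj'" by (rule G')
      show "is_cycle adj' C" if "C \<in> F" for C using F(1)[OF that] .
      show "card (edges adj') + 1 \<le> card F + card B" by (rule F(2))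
      show "C1 = C2 \<or> C1 = C3 \<or> C2 = C3"
        if "C1 \<in> F" "C2 \<in> F" "C3 \<in> F" "e \<in> C1" "e \<in> C2" "e \<in> C3" for C1 C2 C3 e using F(3)[OF that] .
      show "C1 = C2"
        if "C1 \<in> F" "C2 \<in> F" "{a, b} \<in> C1" "{b, c} \<in> C1" "{a, b} \<in> C2" "{b, c} \<in> C2" "a \<noteq> c" for C1 C2 a b c
      proof (rule F(4)[OF that])
        have "{a, b} \<subseteq> B"
          using is_cycle_subset_edges[OF F(1)[OF that(1)]] that(3) edges_subset_Pow[OF G'] by blast
        then have "b \<in> B" "b \<in> V" using B(1) by auto
        then show "b = v \<or> 3 \<le> deg B adj' b" by (cases "b = v") (simp_all add: degB D3)
      qed
      show "D u = deg B adj' u" if "u \<in> B" "u \<noteq> v" for u using degB[OF that] by simp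
      show "3 \<le> D u" if "u \<in> B" for u using D3 that B(1) by blast
      show "v \<in> B" "1 \<le> deg B adj' v" by fact+
      show "\<not> has_K4 B adj'" using assms(4) B(1) unfolding has_K4_def adj'_def by blast
      show "\<not> has_cycle B adj' 5" "\<not> has_cycle B adj' 6" "\<not> has_cycle B adj' 7"
        using cyc assms(5-7) by blast+
      show "5 \<le> D z" if t: "tri B adj' x y z" "D x = 3" "D y = 3" for x y z
      proof -
        have "z \<in> V" using tri[OF t(1)] by (simp add: tri_def)
        moreover have "D z \<noteq> 3" "D z \<noteq> 4" using N2 tri[OF t(1)] t(2,3) unfolding D_def by blast+
        ultimately show ?thesis using D3[of z] by simp
      qed
      show False if "dia B adj' w p q r" "dia B adj' w p' q' r'" "D w = 6" "D p = 3" "D q = 4" "D r = 3"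
        "D p' = 3" "D q' = 4" "D r' = 4" "{p, q, r} \<inter> {p', q', r'} = {}" for w p q r p' q' r'
        using N3 dia[OF that(1)] dia[OF that(2)] that(3-) unfolding D_def by blast
      show False if "dia B adj' x y a b" "D x = 3" "D y = 3" "4 \<le> D a" "4 \<le> D b" for x y a b
        using N4 dia[OF that(1)] that(2-) unfolding D_def by blast
      show False if "dia B adj' x y a b" "D x = 4" "D y = 3" "D a = 4" "D b = 4" for x y a b
        using N6 dia[OF that(1)] that(2-) unfolding D_def by blast
      show False if "dia B adj' x y a b" "D x = 5" "D y = 3" "D a = 4" "D b = 4"
        "z \<notin> {x, y, a, b}" "D z = 3" "adj' x z" for x y a b z
        using N7 dia[OF that(1)] that(2-) unfolding D_def adj'_def by blast
      show "adj' u w" if "adj' u v" "adj' v w" "u \<noteq> w" "D u = 3" "D v = 3" "D w = 3" for u v w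
      proof -
        have a: "adj u v" "adj v w" "u \<in> B" "w \<in> B" using that(1,2) by (auto simp: adj'_def)
        then have "adj u w"
          using N9 that(3-) GD(2)[OF a(1)] GD(3)[OF a(1)] GD(3)[OF a(2)] unfolding D_def by blast
        then show ?thesis using a by (simp add: adj'_def)
      qed
      show False if "dia B adj' x y a b" "D x = 5" "D y = 3" "D a = 4" "D b = 3" for x y a b
        using N10 dia[OF that(1)] that(2-) unfolding D_def by blast
      show False if "tri B adj' x y z" "D x = 5" "D y = 3" "D z = 3" "u \<notin> {x, y, z}" "D u = 3" "adj' x u"
        for x y z u
        using N11 tri[OF that(1)] that(2-) unfolding D_def adj'_def by blast
      show False if "tri B adj' x y z" "tri B adj' x y' z'" "D x = 6" "D y = 3" "D z = 3" "D y' = 3" "D z' = 3"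
        "{y, z} \<inter> {y', z'} = {}" for x y z y' z'
        using N12 tri[OF that(1)] tri[OF that(2)] that(3-) unfolding D_def by blast
    qed
    then show False by (rule face_family.inconsistent)
  qed
qed

end
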